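(* Let $m\in\mathbb N$, let $\mathcal X$ be the GK curve, let $G=\sum_{P\in\mathcal X(\mathbb F_{q^2})}mP$ and $D=\sum_{P\in\mathcal X(\mathbb F_{q^6})\setminus\mathcal X(\mathbb F_{q^2})}P$, and let $C=C_{\mathcal L}(D,G)$ be the associated functional AG code over $\mathbb F_{q^6}$, of length $n=q^8-q^6+q^5-q^3$. Let $d^*=n-\deg G=q^8-q^6+q^5-q^3-m(q^3+1)$ be the designed minimum distance. Whenever $d^*>0$, the code $C$ attains the designed minimum distance, that is, the minimum distance of $C$ equals $d^*$.
   Context: Let $q$ be a prime power. The GK curve $\mathcal X$ is the non-singular projective curve in $PG(3,\overline{\mathbb F}_q)$ defined by the affine equations $Y^{q+1}=X^q+X$, $Z^{q^2-q+1}=Y^{q^2}-Y$. It has a unique point at infinity $P_\infty$, which is $\mathbb F_{q^2}$-rational, genus $g=\frac{q^5-2q^3+q^2}{2}$, and $|\mathcal X(\mathbb F_{q^6})|=q^8-q^6+q^5+1$, $|\mathcal X(\mathbb F_{q^2})|=q^3+1$, where $\mathcal X(\mathbb F_{q^i})$ is the set of $\mathbb F_{q^i}$-rational points. Functional code: for an $\mathbb F_{q^6}$-rational divisor $G$, $\mathcal L(G)=\{f\in\mathbb F_{q^6}(\mathcal X)\setminus\{0\}: (f)+G\ge 0\}\cup\{0\}$. For $D=P_1+\cdots+P_n$ with distinct $\mathbb F_{q^6}$-rational $P_i$ not in $\mathrm{supp}(G)$, $C_{\mathcal L}(D,G)=\{(f(P_1),\ldots,f(P_n)) : f\in\mathcal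 L(G)\}\subseteq\mathbb F_{q^6}^n$. *)

theory Defs
  imports
    "HOL-Analysis.Cartesian_Space"
    "HOL-Algebra.Algebraic_Closure_Type"
    "HOL-Library.Poly_Mapping"
    "HOL-Number_Theory.Prime_Powers"
begin

unbundle no fps_syntax

section \<open>Projective space and projective varieties\<close>

text \<open>
  Multivariate polynomials are finitely supported maps from exponents to coefficients; the
  variables are indexed by a finite type, so that polynomials can be evaluated at vectors.
\<close>

type_synonym ('n, 'a) mpoly = "('n \<Rightarrow>\<^sub>0 nat) \<Rightarrow>\<^sub>0 'a"

definition poly_value :: "('n::finite, 'a::comm_semiring_1) mpoly \<Rightarrow> 'a ^ 'n \<Rightarrow> 'a" where
  "poly_value g v =
     (\<Sum>e \<in> Poly_Mapping.keys g. Poly_Mapping.lookup g e * (\<Prod>i\<in>UNIV. v $ i ^ Poly_Mapping.lookup e i))"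

definition homogeneous :: "nat \<Rightarrow> ('n::finite, 'a::zero) mpoly \<Rightarrow> bool" where
  "homogeneous d g \<longleftrightarrow> (\<forall>e \<in> Poly_Mapping.keys g. (\<Sum>i\<in>UNIV. Poly_Mapping.lookup e i) = d)"

definition coeffs_in :: "'a set \<Rightarrow> ('n, 'a::zero) mpoly \<Rightarrow> bool" where
  "coeffs_in k g \<longleftrightarrow> (\<forall>e. Poly_Mapping.lookup g e \<in> k)"

text \<open>A projective point is the set of all its homogeneous coordinate vectors, without the zero vector.\<close>

definition proj_point :: "'a::field ^ 'n \<Rightarrow> ('a ^ 'n) set" where
  "proj_point v = {c *s v | c. c \<noteq> 0}"

definition proj_space :: "('a::field ^ 'n) set set" where
  "proj_space = proj_point ` (UNIV - {0})"

definition vanishes_at :: "('n::finite, 'a::field) mpoly \<Rightarrow> ('a ^ 'n) set \<Rightarrow> bool" where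
  "vanishes_at g P \<longleftrightarrow> (\<forall>v\<in>P. poly_value g v = 0)"

definition proj_closure :: "('a::field ^ 'n::finite) set set \<Rightarrow> ('a ^ 'n) set set" where
  "proj_closure S =
     {P \<in> proj_space. \<forall>d g. homogeneous d g \<and> (\<forall>Q\<in>S. vanishes_at g Q) \<longrightarrow> vanishes_at g P}"

definition rational_points :: "'a set \<Rightarrow> ('a ^ 'n) set set \<Rightarrow> ('a ^ 'n) set set" where
  "rational_points k \<X> = {P \<in> \<X>. \<exists>v\<in>P. \<forall>i. v $ i \<in> k}"

text \<open>In an algebraic closure of a finite field of characteristic \<open>p\<close>, this is the subfield with
  \<open>r\<close> elements whenever \<open>r\<close> is a positive power of \<open>p\<close>.\<close>

definition finite_subfield :: "nat \<Rightarrow> 'a::field set" where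
  "finite_subfield r = {a. a ^ r = a}"


section \<open>Function fields\<close>

text \<open>
  The definitions below are meant for a projective variety \<open>\<X>\<close> over an algebraically closed field.
  A rational function on \<open>\<X>\<close> is a class of pairs \<open>(g, h)\<close>, read as \<open>g / h\<close>, of homogeneous
  polynomials of the same degree such that \<open>h\<close> does not vanish identically on \<open>\<X>\<close>.
\<close>

definition fractions ::
    "('a::field ^ 'n::finite) set set \<Rightarrow> (('n, 'a) mpoly \<times> ('n, 'a) mpoly) set" where
  "fractions \<X> =
     {(g, h). (\<exists>d. homogeneous d g \<and> homogeneous d h) \<and> (\<exists>P\<in>\<X>. \<not> vanishes_at h P)}"

definition fraction_rel ::
    "('a::field ^ 'n::finite) set set \<Rightarrow> (('n, 'a) mpoly \<times> ('n, 'a) mpoly) rel" where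
  "fraction_rel \<X> =
     {((g, h), (g', h')). (g, h) \<in> fractions \<X> \<and> (g', h') \<in> fractions \<X> \<and>
        (\<forall>P\<in>\<X>. vanishes_at (g * h' - g' * h) P)}"

definition function_field ::
    "('a::field ^ 'n::finite) set set \<Rightarrow> (('n, 'a) mpoly \<times> ('n, 'a) mpoly) set ring" where
  "function_field \<X> =
     \<lparr>carrier = fractions \<X> // fraction_rel \<X>,
      monoid.mult = (\<lambda>A B. fraction_rel \<X> ``
        {(g * g', h * h') | g h g' h'. (g, h) \<in> A \<and> (g', h') \<in> B}),
      one = fraction_rel \<X> `` {(1, 1)},
      ring.zero = fraction_rel \<X> `` {(0, 1)},
      ring.add = (\<lambda>A B. fraction_rel \<X> ``
        {(g * h' + g' * h, h * h') | g h g' h'. (g, h) \<in> A \<and> (g', h') \<in> B})\<rparr>"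

text \<open>The function field over a subfield \<open>k\<close>, as a subfield of the function field over the algebraic
  closure.\<close>

definition function_field_over ::
    "'a::field set \<Rightarrow> ('a ^ 'n::finite) set set \<Rightarrow> (('n, 'a) mpoly \<times> ('n, 'a) mpoly) set set" where
  "function_field_over k \<X> =
     {f \<in> carrier (function_field \<X>). \<exists>(g, h)\<in>f. coeffs_in k g \<and> coeffs_in k h}"

text \<open>Only meaningful if the rational function is regular at \<open>P\<close>.\<close>

definition value_at ::
    "(('n::finite, 'a::field) mpoly \<times> ('n, 'a) mpoly) set \<Rightarrow> ('a ^ 'n) set \<Rightarrow> 'a" where
  "value_at f P =
     (THE c. \<exists>(g, h)\<in>f. \<exists>v\<in>P. poly_value h v \<noteq> 0 \<and> c = poly_value g v / poly_value h v)"

definition local_ring ::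
    "('a::field ^ 'n::finite) set set \<Rightarrow> ('a ^ 'n) set \<Rightarrow> (('n, 'a) mpoly \<times> ('n, 'a) mpoly) set set" where
  "local_ring \<X> P = {f \<in> carrier (function_field \<X>). \<exists>(g, h)\<in>f. \<not> vanishes_at h P}"

definition local_maximal_ideal ::
    "('a::field ^ 'n::finite) set set \<Rightarrow> ('a ^ 'n) set \<Rightarrow> (('n, 'a) mpoly \<times> ('n, 'a) mpoly) set set" where
  "local_maximal_ideal \<X> P = {f \<in> local_ring \<X> P. value_at f P = 0}"

definition uniformizer ::
    "('a::field ^ 'n::finite) set set \<Rightarrow> ('a ^ 'n) set \<Rightarrow>
       (('n, 'a) mpoly \<times> ('n, 'a) mpoly) set \<Rightarrow> bool" where
  "uniformizer \<X> P t \<longleftrightarrow> t \<in> local_ring \<X> P \<and>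
     local_maximal_ideal \<X> P = {t \<otimes>\<^bsub>function_field \<X>\<^esub> a | a. a \<in> local_ring \<X> P}"

text \<open>The order of a non-zero rational function at a non-singular point of a curve.\<close>

definition order_at ::
    "('a::field ^ 'n::finite) set set \<Rightarrow> ('a ^ 'n) set \<Rightarrow>
       (('n, 'a) mpoly \<times> ('n, 'a) mpoly) set \<Rightarrow> int" where
  "order_at \<X> P f =
     (THE n. \<exists>t u. uniformizer \<X> P t \<and> u \<in> local_ring \<X> P - local_maximal_ideal \<X> P \<and>
        f = (t [^]\<^bsub>function_field \<X>\<^esub> n) \<otimes>\<^bsub>function_field \<X>\<^esub> u)"


section \<open>Divisors and functional codes\<close>

text \<open>Divisors are elements of the free abelian group on the points over the algebraic closure,
  so every point has degree one.\<close>

type_synonym 'p divisor = "'p \<Rightarrow>\<^sub>0 int"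

definition divisor_degree :: "'p divisor \<Rightarrow> int" where
  "divisor_degree G = (\<Sum>P \<in> Poly_Mapping.keys G. Poly_Mapping.lookup G P)"

text \<open>
  For the non-zero elements the condition says \<open>(f) + G \<ge> 0\<close>, tested at all points over the algebraic
  closure; this is the same as testing it at the places of the function field over \<open>k\<close>, since
  constant field extensions are unramified.
\<close>

definition riemann_roch_space ::
    "'a::field set \<Rightarrow> ('a ^ 'n::finite) set set \<Rightarrow> ('a ^ 'n) set divisor \<Rightarrow>
       (('n, 'a) mpoly \<times> ('n, 'a) mpoly) set set" where
  "riemann_roch_space k \<X> G =
     {f \<in> function_field_over k \<X> - {\<zero>\<^bsub>function_field \<X>\<^esub>}.
        \<forall>P\<in>\<X>. order_at \<X> P f + Poly_Mapping.lookup G P \<ge> 0} \<union> {\<zero>\<^bsub>function_field \<X>\<^esub>}"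

text \<open>The list \<open>Ps\<close> enumerates the points \<open>P\<^sub>1, \<dots>, P\<^sub>n\<close> with \<open>D = P\<^sub>1 + \<dots> + P\<^sub>n\<close>.\<close>

definition functional_code ::
    "'a::field set \<Rightarrow> ('a ^ 'n::finite) set set \<Rightarrow> ('a ^ 'n) set list \<Rightarrow> ('a ^ 'n) set divisor \<Rightarrow>
       'a list set" where
  "functional_code k \<X> Ps G = {map (value_at f) Ps | f. f \<in> riemann_roch_space k \<X> G}"

definition hamming_distance :: "'a list \<Rightarrow> 'a list \<Rightarrow> nat" where
  "hamming_distance c c' = card {i. i < length c \<and> c ! i \<noteq> c' ! i}"

definition minimum_distance :: "'a list set \<Rightarrow> nat" where
  "minimum_distance C = Inf {hamming_distance c c' | c c'. c \<in> C \<and> c' \<in> C \<and> c \<noteq> c'}"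


section \<open>The GK curve\<close>

text \<open>
  The affine point \<open>(x, y, z)\<close> has homogeneous coordinates \<open>(x : y : z : 1)\<close>. The curve is the
  projective closure of the affine curve: homogenising its two equations is not enough, because the
  resulting equations also hold on a line at infinity.
\<close>

definition gk_affine_points :: "nat \<Rightarrow> ('a::field ^ 4) set set" where
  "gk_affine_points q =
     {proj_point (vector [x, y, z, 1]) | x y z.
        y ^ (q + 1) = x ^ q + x \<and> z ^ (q\<^sup>2 - q + 1) = y ^ (q\<^sup>2) - y}"

definition gk_curve :: "nat \<Rightarrow> ('a::field ^ 4) set set" where
  "gk_curve q = proj_closure (gk_affine_points q)"

end

theory Submission
  imports Defs "HOL-Library.Function_Algebras" "HOL-Number_Theory.Residues"
begin

text \<open>
  Write \<open>N = q\<^sup>2 - q + 1\<close>, so that \<open>N * (q + 1) = q ^ 3 + 1\<close>, and let \<open>k\<close> be the algebraic closure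
  of the field with \<open>q\<close> elements. The affine curve is a tower of two Artin--Schreier coverings of
  the \<open>z\<close>-line, \<open>y ^ q\<^sup>2 - y = z ^ N\<close> and \<open>x ^ q + x = y ^ (q + 1)\<close>, and everything below rests on this.

  \<^bold>\<open>Points.\<close> For an affine point put \<open>w = y ^ q\<^sup>2 - y\<close>. The points with \<open>w = 0\<close> are the \<open>q ^ 3\<close> affine points
  over the field with \<open>q\<^sup>2\<close> elements; on them \<open>z = 0\<close>. A point with \<open>w \<noteq> 0\<close> is rational over the field
  with \<open>q ^ 6\<close> elements if and only if \<open>u = w ^ (q\<^sup>2 - 1)\<close> satisfies \<open>u ^ (q + 1) + u ^ q + 1 = 0\<close>
  (\<open>rational_q6_iff\<close>). Multiplying \<open>y\<close> by a root of unity of order dividing \<open>q + 1\<close> does not change \<open>u\<close>, so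
  the condition depends on \<open>y ^ (q + 1) = x ^ q + x\<close> alone. Hence a plane \<open>x = a\<close> through one point of \<open>D\<close>
  meets the curve in exactly \<open>q ^ 3 + 1\<close> affine points, all of which belong to \<open>D\<close> (\<open>card_section\<close>), and
  there are \<open>q ^ 3 * (q\<^sup>2 - 1)\<close> such planes. This also gives the length of the code.

  \<^bold>\<open>Few zeros.\<close> The function \<open>z\<close> has a simple zero at each affine point over the field with \<open>q\<^sup>2\<close> elements,
  no other zeros, and a pole of order \<open>q ^ 3\<close> at infinity; \<open>x\<close> has a pole of order \<open>q ^ 3 + 1\<close> there.
  Therefore the product of \<open>x - a\<close> over \<open>m\<close> planes as above, divided by \<open>z ^ m\<close>, lies in the
  Riemann--Roch space of \<open>G\<close> and vanishes at precisely \<open>m * (q ^ 3 + 1)\<close> points of \<open>D\<close>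
  (\<open>minimal_function\<close>). That enough planes exist is what positivity of the designed distance says.

  \<^bold>\<open>Not more zeros.\<close> If \<open>f\<close> lies in the Riemann--Roch space of \<open>G\<close>, then \<open>f * z ^ m\<close> is regular on the affine
  curve and has a pole of order at most \<open>m * (q ^ 3 + 1)\<close> at infinity, and one must bound its zeros by
  that number. Instead of the general theory of divisors, the covering of the \<open>z\<close>-line is used.
  It is unramified, so the coordinate ring \<open>A\<close> is free over \<open>k[z]\<close> with basis \<open>x ^ i * y ^ j\<close> for \<open>i < q\<close> and
  \<open>j < q\<^sup>2\<close>, and a function vanishing on the fibre over \<open>c\<close> is divisible by \<open>z - c\<close>
  (\<open>fibre_vanish_dvd\<close>); as a consequence every function that is regular on the affine curve is a polynomial
  (\<open>regular_imp_polynomial\<close>). The pole order at infinity is a weight on \<open>A\<close> under which the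
  monomials \<open>x ^ i * y ^ j * z ^ l\<close> of this basis have pairwise different weights, so the weight is multiplicative and \<open>A\<close> is a domain.
  Finally the \<open>q ^ 3\<close> maps \<open>(x, y, z) \<mapsto> (x + b ^ q * y + c, y + b, z)\<close> with \<open>b ^ q\<^sup>2 = b\<close> and
  \<open>c ^ q + c = b ^ (q + 1)\<close> permute each fibre simply transitively. The norm of \<open>a\<close> with respect to them is a
  polynomial in \<open>z\<close> whose degree is the weight of \<open>a\<close>, and it vanishes at \<open>c\<close> to at least the order given by
  the number of zeros of \<open>a\<close> in the fibre over \<open>c\<close>. So \<open>a\<close> has no more zeros than its weight
  (\<open>zeros_le_weight\<close>). Applied to the difference of two such polynomials this bounds the number of
  places in which two different code words agree.

  \<^bold>\<open>Orders.\<close> The abstract order of a rational function at a point is computed by an additive function on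
  homogeneous forms that vanishes exactly on the forms not vanishing at the point and for which fractions of
  non-negative value are regular (locale \<open>gk_place\<close>). At an affine point this is the multiplicity with
  respect to \<open>z - c\<close>, at infinity it is the defect of the weight.
\<close>

section \<open>Roots of polynomials and fibres of maps\<close>

text \<open>A root of higher multiplicity is a root of the derivative, so all roots counted by the degree are different.\<close>

lemma card_roots_separable:
  fixes p :: "'a::alg_closed_field poly"
  assumes "\<And>x. poly p x = 0 \<Longrightarrow> poly (pderiv p) x \<noteq> 0"
  shows "card {x. poly p x = 0} = Polynomial.degree p"
proof -
  have p0: "p \<noteq> 0" using assms by force
  obtain A where A: "size A = Polynomial.degree p"
    "p = smult (Polynomial.lead_coeff p) (\<Prod>x\<in>#A. [:-x, 1:])"
    using alg_closed_imp_factorization[OF p0] by blast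
  have "proots p = proots (\<Prod>x\<in>#A. [:-x, 1:])"
    using A(2) p0 by (metis leading_coeff_0_iff proots_smult)
  also have "\<dots> = A"
  proof (induction A)
    case (add x A)
    have "(\<Prod>x\<in>#A. [:-x, 1:]) \<noteq> 0" by (auto simp: prod_mset_zero_iff)
    then have "proots ([:-x, 1:] * (\<Prod>x\<in>#A. [:-x, 1:])) = add_mset x A"
      using add by (subst proots_mult) auto
    then show ?case by (simp del: mult_pCons_left)
  qed simp
  finally have pA: "proots p = A" .
  have simple: "Polynomial.order a p = 1" if a: "poly p a = 0" for a
  proof (rule ccontr)
    assume "Polynomial.order a p \<noteq> 1"
    moreover have "Polynomial.order a p \<noteq> 0" using a p0 by (simp add: order_root)
    ultimately have "[:-a, 1:] ^ 2 dvd p" by (subst order_divides) linarith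
    then obtain r where "p = [:-a, 1:] * ([:-a, 1:] * r)"
      by (metis dvdE mult.assoc power2_eq_square)
    then have "poly (pderiv p) a = 0"
      by (simp add: pderiv_mult pderiv_pCons del: mult_pCons_left)
    with assms[OF a] show False by simp
  qed
  have "size (proots p) = (\<Sum>x\<in>set_mset (proots p). count (proots p) x)"
    by (rule size_multiset_overloaded_eq)
  also have "\<dots> = (\<Sum>x\<in>set_mset (proots p). 1)"
    using simple p0 by (intro sum.cong) auto
  also have "\<dots> = card {x. poly p x = 0}" using p0 by simp
  finally show ?thesis using pA A(1) by simp
qed

lemma card_fibration:
  assumes "finite B" "\<And>a. a \<in> A \<Longrightarrow> f a \<in> B"
    "\<And>b. b \<in> B \<Longrightarrow> card {a \<in> A. f a = b} = c" "c > 0"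
  shows "card A = c * card B" "finite A"
proof -
  have eq: "A = (\<Union>b\<in>B. {a \<in> A. f a = b})" using assms(2) by auto
  have fin: "finite {a \<in> A. f a = b}" if "b \<in> B" for b
    using assms(3)[OF that] assms(4) card_gt_0_iff by metis
  show "finite A" by (subst eq) (use fin assms(1) in blast)
  have "card (\<Union>b\<in>B. {a \<in> A. f a = b}) = (\<Sum>b\<in>B. card {a \<in> A. f a = b})"
    by (intro card_UN_disjoint) (use assms(1) fin in auto)
  then show "card A = c * card B" unfolding eq[symmetric] using assms(3) by simp
qed

lemma card_vimage_const:
  assumes "finite B" "\<And>b. b \<in> B \<Longrightarrow> card {a. f a = b} = c" "c > 0"
  shows "card {a. f a \<in> B} = c * card B" "finite {a. f a \<in> B}"
proof -
  have "card {a \<in> {a. f a \<in> B}. f a = b} = c" if "b \<in> B" for b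
  proof -
    have "{a \<in> {a. f a \<in> B}. f a = b} = {a. f a = b}" using that by auto
    then show ?thesis using assms(2)[OF that] by simp
  qed
  from card_fibration[where A = "{a. f a \<in> B}", OF assms(1) _ this assms(3)]
  show "card {a. f a \<in> B} = c * card B" "finite {a. f a \<in> B}" by auto
qed

section \<open>The affine curve as a type\<close>

text \<open>Taking the affine points as a type makes the functions on the curve a commutative ring under pointwise
  operations, so that an identity valid on the curve is an equation in that ring.\<close>

typedef (overloaded) 'f gk_point =
  "{p :: 'f::{field,finite} alg_closure \<times> 'f alg_closure \<times> 'f alg_closure. case p of (x, y, z) \<Rightarrow>
    y ^ (CARD('f) + 1) = x ^ CARD('f) + x \<and>
    z ^ (CARD('f)\<^sup>2 - CARD('f) + 1) = y ^ CARD('f)\<^sup>2 - y}"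
  by (rule exI[of _ "(0, 0, 0)"]) (simp add: power_0_left)

definition cx :: "'f::{field,finite} gk_point \<Rightarrow> 'f alg_closure" where
  "cx P = fst (Rep_gk_point P)"
definition cy :: "'f::{field,finite} gk_point \<Rightarrow> 'f alg_closure" where
  "cy P = fst (snd (Rep_gk_point P))"
definition cz :: "'f::{field,finite} gk_point \<Rightarrow> 'f alg_closure" where
  "cz P = snd (snd (Rep_gk_point P))"

lemma gk_point_eqI: "cx P = cx Q \<Longrightarrow> cy P = cy Q \<Longrightarrow> cz P = cz Q \<Longrightarrow> P = Q"
  by (simp add: cx_def cy_def cz_def Rep_gk_point_inject[symmetric] prod_eq_iff)

section \<open>Frobenius maps\<close>

locale gk =
  fixes q :: nat and F :: "'f::{field,finite} itself"
  assumes card_F: "CARD('f) = q" and primepow_q: "primepow q"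
begin

definition N :: nat where "N = q^2 - q + 1"

lemma q_gt_1: "q > 1" using primepow_gt_Suc_0[OF primepow_q] by simp

lemma q_char: "\<exists>n>0. q = CHAR('f alg_closure) ^ n"
proof -
  have pr: "prime CHAR('f)"
    by (rule prime_CHAR_semidom, rule finite_imp_CHAR_pos) simp
  have "CHAR('f) dvd q" using CHAR_dvd_CARD[where 'a='f] card_F by simp
  then show ?thesis using primepow_q pr unfolding primepow_def
    by (metis CHAR_alg_closure prime_dvd_power primes_dvd_imp_eq)
qed

lemma prime_char: "prime CHAR('f alg_closure)"
  by (simp, rule prime_CHAR_semidom, rule finite_imp_CHAR_pos) simp

lemma of_nat_q [simp]: "of_nat q = (0::'f alg_closure)"
  using q_char by (auto simp: of_nat_eq_0_iff_char_dvd)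

lemma frob_add: "(x + y :: 'f alg_closure) ^ (q ^ j) = x ^ (q ^ j) + y ^ (q ^ j)"
proof -
  obtain n where n: "q = CHAR('f alg_closure) ^ n" using q_char by blast
  show ?thesis by (rule freshmans_dream'[OF prime_char, of _ "n * j"]) (simp add: n power_mult)
qed

lemma frob_diff: "(x - y :: 'f alg_closure) ^ (q ^ j) = x ^ (q ^ j) - y ^ (q ^ j)"
  using frob_add[of "x - y" y j] by (simp add: algebra_simps)

lemmas frob_add1 = frob_add[where j = 1, simplified]
lemmas frob_diff1 = frob_diff[where j = 1, simplified]

lemma frob_minus: "(- x :: 'f alg_closure) ^ (q ^ j) = - (x ^ (q ^ j))"
  using frob_diff[of 0 x j] q_gt_1 by (simp add: power_0_left)

lemma frob_frob: "((x :: 'f alg_closure) ^ (q ^ i)) ^ (q ^ j) = x ^ (q ^ (i + j))"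
  by (simp add: power_add flip: power_mult)

text \<open>These three instances serve as rewrite rules for iterated Frobenius maps; a general rule would not
  match numerals in the exponent.\<close>

lemma frob_steps:
  fixes x :: "'f alg_closure"
  shows "(x ^ q) ^ q = x ^ q ^ 2" "(x ^ q ^ 2) ^ q = x ^ q ^ 3" "(x ^ q ^ 3) ^ q = x ^ q ^ 4"
  by (simp_all add: eval_nat_numeral ac_simps flip: power_mult)

lemma q_cubed: "N * (q + 1) = q ^ 3 + 1"
proof -
  have "q \<le> q^2" by (simp add: power2_eq_square)
  then have "int (N * (q + 1)) = int (q ^ 3 + 1)"
    by (simp add: N_def of_nat_diff algebra_simps power2_eq_square power3_eq_cube)
  then show ?thesis by (simp only: of_nat_eq_iff)
qed

lemma N_pos: "N > 0" by (simp add: N_def)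

lemma of_nat_N: "of_nat N = (1::'f alg_closure)"
proof -
  have "of_nat (N * (q + 1)) = (of_nat (q ^ 3 + 1) :: 'f alg_closure)" by (simp only: q_cubed)
  then show ?thesis by simp
qed

text \<open>The derivative is the constant \<open>e\<close>, because the characteristic divides \<open>q\<close>.\<close>

lemma card_artin_schreier:
  fixes e s :: "'f alg_closure"
  assumes "e \<noteq> 0" "j > 0"
  shows "card {x. x ^ (q ^ j) + e * x = s} = q ^ j"
proof -
  define p where "p = Polynomial.monom 1 (q ^ j) + [:- s, e:]"
  have qj: "q ^ j > 1" using one_less_power[OF q_gt_1 assms(2)] .
  have d: "Polynomial.degree p = q ^ j" unfolding p_def
    using qj q_gt_1 by (subst degree_add_eq_left) (auto simp: Polynomial.degree_monom_eq)
  have "pderiv p = [:e:]"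
    using assms(2) by (simp add: p_def pderiv_add pderiv_monom pderiv_pCons)
  then have "card {x. poly p x = 0} = q ^ j"
    using card_roots_separable[of p] assms(1) d by simp
  moreover have "poly p x = 0 \<longleftrightarrow> x ^ (q ^ j) + e * x = s" for x
    by (auto simp: p_def poly_monom algebra_simps)
  ultimately show ?thesis by simp
qed

lemma card_frob_plus: "card {x :: 'f alg_closure. x ^ q + x = s} = q"
  using card_artin_schreier[of 1 1 s] by simp

lemma card_frob2_minus: "card {y :: 'f alg_closure. y ^ q\<^sup>2 - y = s} = q\<^sup>2"
  using card_artin_schreier[of "-1" 2 s] by simp

lemma card_roots_power:
  fixes s :: "'f alg_closure"
  assumes "of_nat n \<noteq> (0 :: 'f alg_closure)" "s \<noteq> 0"
  shows "card {x. x ^ n = s} = n"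
proof -
  define p where "p = Polynomial.monom 1 n + [:- s:]"
  have n: "n > 0" using assms(1) by (cases n) auto
  have d: "Polynomial.degree p = n" unfolding p_def
    using n by (subst degree_add_eq_left) (auto simp: Polynomial.degree_monom_eq)
  have v: "poly p x = 0 \<longleftrightarrow> x ^ n = s" for x
    by (auto simp: p_def poly_monom algebra_simps)
  have "poly (pderiv p) x = of_nat n * x ^ (n - 1)" for x
    by (simp add: p_def pderiv_add pderiv_monom pderiv_pCons poly_monom)
  then have "poly (pderiv p) x \<noteq> 0" if "poly p x = 0" for x
    using that assms n v[of x] by (auto simp: power_0_left)
  from card_roots_separable[OF this] show ?thesis using d v by simp
qed

section \<open>Counting rational points\<close>

text \<open>The possible values of \<open>w ^ (q\<^sup>2 - 1)\<close> at the points of \<open>D\<close>, where \<open>w = y ^ q\<^sup>2 - y\<close>.\<close>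

definition ratios :: "'f alg_closure set" where "ratios = {u. u ^ (q + 1) + u ^ q + 1 = 0}"

text \<open>The derivative is \<open>u ^ q\<close>, and \<open>0\<close> is not a root.\<close>

lemma card_ratios: "card ratios = q + 1"
proof -
  define p :: "'f alg_closure poly"
    where "p = Polynomial.monom 1 (q + 1) + (Polynomial.monom 1 q + 1)"
  have d: "Polynomial.degree p = q + 1" unfolding p_def
    using q_gt_1 by (subst degree_add_eq_left)
      (auto simp: Polynomial.degree_monom_eq intro!: degree_add_less)
  have v: "poly p x = 0 \<longleftrightarrow> x \<in> ratios" for x
    by (auto simp: p_def poly_monom ratios_def algebra_simps)
  have "poly (pderiv p) x = x ^ q" for x
    by (simp add: p_def pderiv_add pderiv_monom poly_monom del: of_nat_Suc) simp
  then have "poly (pderiv p) x \<noteq> 0" if "poly p x = 0" for x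
    using that v[of x] q_gt_1 by (auto simp: ratios_def power_0_left)
  from card_roots_separable[OF this] show ?thesis using d v by simp
qed

text \<open>The values of \<open>y ^ q\<^sup>2 - y\<close> at the points of \<open>D\<close>. The equation is that of \<open>ratios\<close> for
  \<open>w ^ (q\<^sup>2 - 1)\<close>, multiplied by \<open>w ^ (q + 1)\<close>.\<close>

definition increments :: "'f alg_closure set" where
  "increments = {w. w \<noteq> 0 \<and> w ^ q\<^sup>2 * w ^ q ^ 3 + w * w ^ q ^ 3 + w * w ^ q = 0}"

lemma card_increments: "card increments = (q + 1) * (q\<^sup>2 - 1)" and finite_increments: "finite increments"
proof -
  have q2: "q\<^sup>2 > 1" using one_less_power[OF q_gt_1, of 2] by simp
  have WU: "increments = {w. w ^ (q\<^sup>2 - 1) \<in> ratios}"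
  proof -
    have "w \<in> increments \<longleftrightarrow> w ^ (q\<^sup>2 - 1) \<in> ratios" for w
    proof (cases "w = 0")
      case True
      then show ?thesis using q2 q_gt_1 by (simp add: increments_def ratios_def power_0_left)
    next
      case False
      have 1: "w ^ (q\<^sup>2 - 1) = w ^ q\<^sup>2 / w" using False q2
        by (simp add: power_diff)
      have 2: "(w ^ (q\<^sup>2 - 1)) ^ q = w ^ q ^ 3 / w ^ q"
        unfolding 1 power_divide by (simp add: power2_eq_square power3_eq_cube flip: power_mult)
      have "(c / b * (a / w) + c / b + 1) * (w * b) = a * c + w * c + w * b"
        if "b \<noteq> 0" for a b c :: "'f alg_closure"
        using that False by (simp add: field_simps)
      from this[of "w ^ q" "w ^ q ^ 3" "w ^ q\<^sup>2"] False
      have "w ^ q ^ 3 / w ^ q * (w ^ q\<^sup>2 / w) + w ^ q ^ 3 / w ^ q + 1 = 0 \<longleftrightarrow>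
          w ^ q\<^sup>2 * w ^ q ^ 3 + w * w ^ q ^ 3 + w * w ^ q = 0"
        by (metis mult_eq_0_iff power_eq_0_iff)
      then show ?thesis
        using False by (simp only: increments_def ratios_def mem_Collect_eq power_add 2 power_one_right)
          (simp only: 1 not_False_eq_True simp_thms)
    qed
    then show ?thesis by blast
  qed
  have nz: "of_nat (q\<^sup>2 - 1) \<noteq> (0::'f alg_closure)" using q2 by (simp add: of_nat_diff)
  have u0: "u \<noteq> 0" if "u \<in> ratios" for u using that q_gt_1 by (auto simp: ratios_def power_0_left)
  have fU: "finite ratios" using card_ratios by (metis Suc_eq_plus1 card.infinite nat.distinct(1))
  have pos: "q\<^sup>2 - 1 > 0" using q2 by simp
  show "card increments = (q + 1) * (q\<^sup>2 - 1)" "finite increments"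
    using card_vimage_const[where f = "\<lambda>w. w ^ (q\<^sup>2 - 1)", OF fU card_roots_power[OF nz u0] pos]
    unfolding WU by (simp_all only: card_ratios mult.commute)
qed

text \<open>The two conditions on the right express that \<open>y\<close> and \<open>z\<close> are fixed by the Frobenius map of the field with
  \<open>q ^ 6\<close> elements. Indeed the sum is \<open>y ^ q ^ 6 - y\<close>. The product \<open>w * w ^ q\<close> is \<open>z ^ (q ^ 3 + 1)\<close>, and the
  second condition says that it is fixed by \<open>t \<mapsto> t ^ q ^ 3\<close>, which for \<open>z \<noteq> 0\<close> amounts to \<open>z ^ q ^ 6 = z\<close>.
  That the single equation defining \<open>increments\<close> implies both is seen by combining it with its \<open>q\<close>-th power.\<close>

lemma increments_iff:
  fixes w :: "'f alg_closure"
  assumes "w \<noteq> 0"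
  shows "w \<in> increments \<longleftrightarrow> w + w ^ q ^ 2 + w ^ q ^ 4 = 0 \<and> w * w ^ q = w ^ q ^ 3 * w ^ q ^ 4"
proof -
  define w1 w2 w3 w4 where w: "w1 = w ^ q" "w2 = w ^ q ^ 2" "w3 = w ^ q ^ 3" "w4 = w ^ q ^ 4"
  have nz: "w1 \<noteq> 0" "w2 \<noteq> 0" "w3 \<noteq> 0" using assms by (auto simp: w)
  have e0: "w \<in> increments \<longleftrightarrow> w2 * w3 + w * w3 + w * w1 = 0" using assms by (simp add: increments_def w)
  have f: "w1 ^ q = w2" "w2 ^ q = w3" "w3 ^ q = w4"
    by (simp_all only: w frob_steps)
  show ?thesis unfolding w[symmetric]
  proof
    assume "w \<in> increments"
    then have E0: "w2 * w3 + w * w3 + w * w1 = 0" using e0 by simp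
    then have "(w2 * w3 + w * w3 + w * w1) ^ q = 0" using q_gt_1 by simp
    then have E1: "w3 * w4 + w1 * w4 + w1 * w2 = 0"
      by (simp add: frob_add1 power_mult_distrib f flip: w(1))
    have "(w3 + w1) * (w2 + w) = w1 * w2 + (w2 * w3 + w * w3 + w * w1)"
      by (simp add: algebra_simps)
    then have a: "(w3 + w1) * (w2 + w) = w1 * w2" using E0 by simp
    have "w4 * (w3 + w1) = (w3 * w4 + w1 * w4 + w1 * w2) - w1 * w2"
      by (simp add: algebra_simps)
    then have b: "w4 * (w3 + w1) = - (w1 * w2)" using E1 by simp
    have "w4 * (w1 * w2) = (w4 * (w3 + w1)) * (w2 + w)"
      unfolding a[symmetric] by (simp add: ac_simps)
    then have "w4 * (w1 * w2) = - (w2 + w) * (w1 * w2)" unfolding b by (simp add: algebra_simps)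
    then have "w4 = - (w2 + w)" using nz by (simp only: mult_cancel_right) simp
    moreover have "w * w1 - w3 * (- (w2 + w)) = w2 * w3 + w * w3 + w * w1"
      by (simp add: algebra_simps)
    then have "w * w1 = w3 * (- (w2 + w))" using E0 by simp
    ultimately show "w + w2 + w4 = 0 \<and> w * w1 = w3 * w4" by simp
  next
    assume "w + w2 + w4 = 0 \<and> w * w1 = w3 * w4"
    then have sum0: "w2 + w + w4 = 0" and prod: "w * w1 = w3 * w4"
      by (simp_all add: ac_simps)
    have "w2 * w3 + w * w3 + w * w1 = w3 * (w2 + w + w4)"
      unfolding prod by (simp add: algebra_simps)
    then show "w \<in> increments" unfolding e0 sum0 by simp
  qed
qed


lemma curve_y: "cy P ^ (q + 1) = cx P ^ q + cx P" for P :: "'f gk_point"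
  using Rep_gk_point[of P] by (auto simp: cx_def cy_def card_F split: prod.splits)

lemma curve_z: "cz P ^ N = cy P ^ q\<^sup>2 - cy P" for P :: "'f gk_point"
  using Rep_gk_point[of P] by (auto simp: cz_def cy_def card_F N_def split: prod.splits)

lemma curve_point_exists:
  fixes x y z :: "'f alg_closure"
  assumes "y ^ (q + 1) = x ^ q + x" "z ^ N = y ^ q\<^sup>2 - y"
  shows "\<exists>P. cx P = x \<and> cy P = y \<and> cz P = z"
proof -
  define P :: "'f gk_point" where "P = Abs_gk_point (x, y, z)"
  have "Rep_gk_point P = (x, y, z)" unfolding P_def
    using assms by (intro Abs_gk_point_inverse) (simp add: card_F N_def)
  then show ?thesis by (intro exI[of _ P]) (simp add: cx_def cy_def cz_def)
qed

text \<open>The \<open>y\<close>-coordinates and the \<open>x\<close>-coordinates of the points of \<open>D\<close>.\<close>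

definition code_ys :: "'f alg_closure set" where "code_ys = {y. y ^ q\<^sup>2 - y \<in> increments}"

definition code_xs :: "'f alg_closure set" where "code_xs = {x. \<exists>y\<in>code_ys. y ^ (q + 1) = x ^ q + x}"

definition rational :: "nat \<Rightarrow> 'f gk_point set" where
  "rational r = {P. cx P \<in> finite_subfield r \<and> cy P \<in> finite_subfield r \<and> cz P \<in> finite_subfield r}"

lemma card_code_ys: "card code_ys = q\<^sup>2 * ((q + 1) * (q\<^sup>2 - 1))" and finite_code_ys: "finite code_ys"
  using card_vimage_const[where f = "\<lambda>y. y ^ q\<^sup>2 - y", OF finite_increments card_frob2_minus] q_gt_1
  unfolding code_ys_def by (simp_all only: card_increments) simp_all

text \<open>The quotient \<open>e = y' / y\<close> satisfies \<open>e ^ (q + 1) = 1\<close>, hence \<open>e ^ q\<^sup>2 = e\<close>; so \<open>w = y ^ q\<^sup>2 - y\<close> is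
  multiplied by \<open>e\<close>, and each term of the equation for \<open>w\<close> by \<open>e ^ (q + 1) = 1\<close>.\<close>

lemma norm_eq_imp_code_y:
  assumes "y \<in> code_ys" "y' ^ (q + 1) = y ^ (q + 1)"
  shows "y' \<in> code_ys"
proof -
  have w: "y ^ q\<^sup>2 - y \<in> increments" using assms(1) by (simp add: code_ys_def)
  have y0: "y \<noteq> 0" using w q_gt_1 by (auto simp: increments_def power_0_left)
  define e where "e = y' / y"
  have y': "y' = e * y" using y0 by (simp add: e_def)
  have e1: "e ^ (q + 1) = 1" using assms(2) y0 by (simp add: y' power_mult_distrib)
  then have e0: "e \<noteq> 0" by auto
  have "(e * e ^ q) ^ q = 1" using e1 by simp
  then have "e ^ q * e ^ q\<^sup>2 = e ^ q * e"
    using e1 by (simp add: power_mult_distrib power2_eq_square ac_simps flip: power_mult)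
  then have e2: "e ^ q\<^sup>2 = e" using e0 by simp
  have e3: "e ^ q ^ 3 = e ^ q"
    using frob_frob[of e 2 1] e2 by (simp add: numeral_3_eq_3)
  have "y' ^ q\<^sup>2 - y' = e * (y ^ q\<^sup>2 - y)"
    by (simp add: y' power_mult_distrib e2 algebra_simps)
  moreover have "e * w \<in> increments" if "w \<in> increments" for w
  proof -
    have "e * w ^ q\<^sup>2 * (e ^ q * w ^ q ^ 3) + e * w * (e ^ q * w ^ q ^ 3) + e * w * (e ^ q * w ^ q)
        = e ^ (q + 1) * (w ^ q\<^sup>2 * w ^ q ^ 3 + w * w ^ q ^ 3 + w * w ^ q)"
      by (simp add: algebra_simps)
    then show ?thesis using that e0 by (simp add: increments_def power_mult_distrib e2 e3)
  qed
  ultimately show ?thesis using w by (simp add: code_ys_def)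
qed

text \<open>If \<open>y\<close> is fixed by the Frobenius map, then \<open>z = 0\<close> and \<open>y ^ (q + 1)\<close> lies in the field with \<open>q\<close>
  elements, so that \<open>x ^ q + x\<close> does, too.\<close>

lemma rational_q2_iff: "P \<in> rational (q ^ 2) \<longleftrightarrow> cy P ^ q\<^sup>2 = cy P" for P
proof
  assume y: "cy P ^ q\<^sup>2 = cy P"
  then have z: "cz P = 0" using curve_z[of P] N_pos by simp
  have "(cy P ^ (q + 1)) ^ q = (cx P ^ q + cx P) ^ q" by (simp only: curve_y)
  then have "cy P ^ q\<^sup>2 * cy P ^ q = cx P ^ q\<^sup>2 + cx P ^ q"
    by (simp add: frob_add1 power_mult_distrib power2_eq_square ac_simps flip: power_mult)
  then have "cx P ^ q\<^sup>2 + cx P ^ q = cx P ^ q + cx P"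
    using y curve_y[of P] by simp
  then show "P \<in> rational (q ^ 2)" using y z q_gt_1 by (simp add: rational_def finite_subfield_def power_0_left)
qed (simp add: rational_def finite_subfield_def)

lemma zero_z_iff: "cz P = 0 \<longleftrightarrow> P \<in> rational (q ^ 2)" for P
  unfolding rational_q2_iff using curve_z[of P] N_pos by (metis eq_iff_diff_eq_0 power_eq_0_iff)

lemma card_rational_q2: "card (rational (q ^ 2)) = q ^ 3" and finite_rational_q2: "finite (rational (q ^ 2))"
proof -
  define B where "B = {y :: 'f alg_closure. y ^ q\<^sup>2 - y = 0}"
  have B: "card B = q\<^sup>2" unfolding B_def by (rule card_frob2_minus)
  then have fB: "finite B" using q_gt_1 by (intro card_ge_0_finite) simp
  have "card {P \<in> rational (q ^ 2). cy P = y} = q" if "y \<in> B" for y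
  proof -
    have "bij_betw cx {P \<in> rational (q ^ 2). cy P = y} {x. x ^ q + x = y ^ (q + 1)}"
    proof (rule bij_betwI')
      fix P Q assume "P \<in> {P \<in> rational (q ^ 2). cy P = y}" "Q \<in> {P \<in> rational (q ^ 2). cy P = y}"
      then show "cx P = cx Q \<longleftrightarrow> P = Q"
        using zero_z_iff[of P] zero_z_iff[of Q] by (auto intro: gk_point_eqI)
    next
      fix P assume "P \<in> {P \<in> rational (q ^ 2). cy P = y}"
      then show "cx P \<in> {x. x ^ q + x = y ^ (q + 1)}" using curve_y[of P] by simp
    next
      fix x assume "x \<in> {x. x ^ q + x = y ^ (q + 1)}"
      then have "y ^ (q + 1) = x ^ q + x" "0 ^ N = y ^ q\<^sup>2 - y"
        using N_pos that by (auto simp: B_def power_0_left)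
      then obtain P where "cx P = x" "cy P = y" "cz P = 0"
        using curve_point_exists by blast
      then show "\<exists>P \<in> {P \<in> rational (q ^ 2). cy P = y}. x = cx P"
        using zero_z_iff[of P] by auto
    qed
    from bij_betw_same_card[OF this] show ?thesis by (simp only: card_frob_plus)
  qed
  moreover have "cy P \<in> B" if "P \<in> rational (q ^ 2)" for P
    using that by (simp add: rational_q2_iff B_def)
  ultimately show "card (rational (q ^ 2)) = q ^ 3" "finite (rational (q ^ 2))"
    using card_fibration[where f = cy and A = "rational (q ^ 2)" and c = q, OF fB] q_gt_1
    by (simp_all add: B power2_eq_square power3_eq_cube)
qed

text \<open>For \<open>y\<close> and \<open>z\<close> this is \<open>increments_iff\<close>. The coordinate \<open>x\<close> is then rational as well: repeated use of
  \<open>x ^ q = y ^ (q + 1) - x\<close> writes \<open>x ^ q ^ 6 - x\<close> as an alternating sum of products of conjugates of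
  \<open>y\<close>, which equals \<open>w ^ q ^ 3 * w ^ q ^ 4 - w * w ^ q\<close> for \<open>w = y ^ q\<^sup>2 - y\<close>.\<close>

lemma rational_q6_iff: "P \<in> rational (q ^ 6) - rational (q ^ 2) \<longleftrightarrow> cy P \<in> code_ys" for P :: "'f gk_point"
proof -
  define x y z where xyz: "x = cx P" "y = cy P" "z = cz P"
  define w where "w = y ^ q\<^sup>2 - y"
  have frob: "w ^ q ^ j = y ^ q ^ (j + 2) - y ^ q ^ j" for j
    using frob_frob[of y 2 j] by (simp add: w_def frob_diff add.commute)
  have zN: "z ^ N = w" using curve_z[of P] by (simp add: xyz w_def)
  have w0: "w = 0 \<longleftrightarrow> P \<in> rational (q ^ 2)" using rational_q2_iff[of P] by (simp add: w_def xyz)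
  have z0: "z = 0 \<longleftrightarrow> w = 0" using zN N_pos by (auto simp: power_0_left)
  have Yw: "y \<in> code_ys \<longleftrightarrow> w \<in> increments" by (simp add: code_ys_def w_def)
  have z3: "z ^ q ^ 3 * z = w * w ^ q"
  proof -
    have "z ^ (N * (q + 1)) = w * w ^ q" by (simp add: power_mult zN power_add)
    then show ?thesis by (simp only: q_cubed power_add power_one_right)
  qed
  have z6: "z ^ q ^ 6 * z ^ q ^ 3 = w ^ q ^ 3 * w ^ q ^ 4"
  proof -
    have "(z ^ q ^ 3 * z) ^ q ^ 3 = (w * w ^ q) ^ q ^ 3" by (simp only: z3)
    then show ?thesis using frob_frob[of z 3 3] frob_frob[of w 1 3]
      by (simp add: power_mult_distrib)
  qed
  have ysum: "w + w ^ q ^ 2 + w ^ q ^ 4 = y ^ q ^ 6 - y"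
    using frob[of 2] frob[of 4] by (simp add: w_def)
  have z_iff: "z ^ q ^ 6 = z \<longleftrightarrow> w * w ^ q = w ^ q ^ 3 * w ^ q ^ 4" if "w \<noteq> 0"
    using z3 z6 z0 that by (metis mult.commute mult_cancel_right power_eq_0_iff)
  have x6: "x ^ q ^ 6 = x" if y6: "y ^ q ^ 6 = y" and ww: "w * w ^ q = w ^ q ^ 3 * w ^ q ^ 4"
  proof -
    have e: "x ^ q ^ (Suc i) = y ^ q ^ (Suc i) * y ^ q ^ i - x ^ q ^ i" for i
    proof -
      have "(y ^ (q + 1)) ^ q ^ i = (x ^ q + x) ^ q ^ i" using curve_y[of P] by (simp add: xyz)
      then show ?thesis using frob_frob[of x 1 i] frob_frob[of y 1 i]
        by (simp add: frob_add power_mult_distrib algebra_simps)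
    qed
    have "x ^ q ^ 6 - x = y ^ q ^ 6 * y ^ q ^ 5 - y ^ q ^ 5 * y ^ q ^ 4 + y ^ q ^ 4 * y ^ q ^ 3
        - y ^ q ^ 3 * y ^ q ^ 2 + y ^ q ^ 2 * y ^ q - y ^ q * y"
      using e[of 5] e[of 4] e[of 3] e[of 2] e[of 1] e[of 0]
      by (simp add: numeral_2_eq_2[symmetric])
    also have "\<dots> = w ^ q ^ 3 * w ^ q ^ 4 - w * w ^ q"
    proof -
      have "w ^ q = y ^ q ^ 3 - y ^ q" "w ^ q ^ 3 = y ^ q ^ 5 - y ^ q ^ 3"
        "w ^ q ^ 4 = y ^ q ^ 6 - y ^ q ^ 4"
        using frob[of 1] frob[of 3] frob[of 4] by (simp_all add: numeral_3_eq_3[symmetric])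
      then show ?thesis unfolding y6 by (simp only:) (simp add: w_def algebra_simps)
    qed
    finally show ?thesis using ww by simp
  qed
  show ?thesis
  proof (cases "w = 0")
    case True
    then show ?thesis using w0 Yw xyz by (simp add: increments_def)
  next
    case False
    then have "P \<in> rational (q ^ 6) - rational (q ^ 2) \<longleftrightarrow> x ^ q ^ 6 = x \<and> y ^ q ^ 6 = y \<and> z ^ q ^ 6 = z"
      using w0 by (simp add: rational_def finite_subfield_def xyz)
    also have "\<dots> \<longleftrightarrow> w \<in> increments" unfolding increments_iff[OF False] ysum right_minus_eq z_iff[OF False]
      using x6 by blast
    finally show ?thesis using Yw xyz by simp
  qed
qed

text \<open>The plane section has \<open>q + 1\<close> values of \<open>y\<close>, since \<open>y ^ (q + 1)\<close> is a fixed non-zero number, and over each of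
  them \<open>N\<close> values of \<open>z\<close>, since \<open>z ^ N = y ^ q\<^sup>2 - y\<close> is not zero.\<close>

lemma card_section:
  assumes "x \<in> code_xs"
  shows "card {P :: 'f gk_point. cx P = x} = q ^ 3 + 1" "\<And>P. cx P = x \<Longrightarrow> cy P \<in> code_ys"
proof -
  obtain y0 where y0: "y0 \<in> code_ys" "y0 ^ (q + 1) = x ^ q + x" using assms by (auto simp: code_xs_def)
  have code_ys: "y \<in> code_ys" if "y ^ (q + 1) = x ^ q + x" for y
    using norm_eq_imp_code_y[OF y0(1)] y0(2) that by simp
  show "cy P \<in> code_ys" if "cx P = x" for P using code_ys[of "cy P"] curve_y[of P] that by simp
  define B where "B = {y. y ^ (q + 1) = x ^ q + x}"
  have "y0 \<noteq> 0" using y0(1) q_gt_1 by (auto simp: code_ys_def increments_def power_0_left)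
  then have B: "card B = q + 1" unfolding B_def y0(2)[symmetric]
    by (intro card_roots_power) auto
  then have fB: "finite B" by (intro card_ge_0_finite) simp
  have "card {P \<in> {P :: 'f gk_point. cx P = x}. cy P = y} = N" if "y \<in> B" for y
  proof -
    have w: "y ^ q\<^sup>2 - y \<noteq> 0" using code_ys[of y] that by (auto simp: B_def code_ys_def increments_def)
    have bij: "bij_betw cz {P \<in> {P :: 'f gk_point. cx P = x}. cy P = y} {z. z ^ N = y ^ q\<^sup>2 - y}"
    proof (rule bij_betwI')
      fix z assume "z \<in> {z. z ^ N = y ^ q\<^sup>2 - y}"
      then show "\<exists>P \<in> {P \<in> {P. cx P = x}. cy P = y}. z = cz P"
        using curve_point_exists[of y x z] that by (auto simp: B_def)
    qed (use curve_z in \<open>auto intro: gk_point_eqI\<close>)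
    have "card {z. z ^ N = y ^ q\<^sup>2 - y} = N"
      using w by (intro card_roots_power) (simp_all add: of_nat_N)
    with bij_betw_same_card[OF bij] show ?thesis by simp
  qed
  from card_fibration(1)[where f = cy, OF fB _ this N_pos]
  have "card {P :: 'f gk_point. cx P = x} = N * card B" using curve_y by (auto simp: B_def)
  then show "card {P :: 'f gk_point. cx P = x} = q ^ 3 + 1" using B q_cubed by simp
qed

text \<open>The pairs \<open>(x, y)\<close> belonging to points of \<open>D\<close> are counted along both coordinates.\<close>

lemma card_code_xs: "card code_xs = q ^ 3 * (q\<^sup>2 - 1)" and finite_code_xs: "finite code_xs"
proof -
  define A where "A = {(x, y). y \<in> code_ys \<and> y ^ (q + 1) = x ^ q + x}"
  have "card {p \<in> A. snd p = y} = q" if "y \<in> code_ys" for y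
  proof -
    have "bij_betw fst {p \<in> A. snd p = y} {x. x ^ q + x = y ^ (q + 1)}"
      by (rule bij_betwI') (use that in \<open>auto simp: A_def\<close>)
    from bij_betw_same_card[OF this] show ?thesis by (simp only: card_frob_plus)
  qed
  from card_fibration[where f = snd, OF finite_code_ys _ this]
  have 1: "card A = q * card code_ys" and fA: "finite A" using q_gt_1 by (auto simp: A_def)
  have "code_xs = fst ` A" by (force simp: A_def code_xs_def)
  then show fSX: "finite code_xs" using fA by simp
  have fib: "card {p \<in> A. fst p = x} = q + 1" if x: "x \<in> code_xs" for x
  proof -
    obtain y0 where y0: "y0 \<in> code_ys" "y0 ^ (q + 1) = x ^ q + x" using x by (auto simp: code_xs_def)
    have bij: "bij_betw snd {p \<in> A. fst p = x} {y. y ^ (q + 1) = y0 ^ (q + 1)}"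
      by (rule bij_betwI') (use norm_eq_imp_code_y[OF y0(1)] y0(2) in \<open>auto simp: A_def\<close>)
    have "y0 \<noteq> 0" using y0(1) q_gt_1 by (auto simp: code_ys_def increments_def power_0_left)
    then have "card {y. y ^ (q + 1) = y0 ^ (q + 1)} = q + 1" by (intro card_roots_power) auto
    with bij_betw_same_card[OF bij] show ?thesis by simp
  qed
  have "fst p \<in> code_xs" if "p \<in> A" for p using that by (auto simp: A_def code_xs_def)
  from card_fibration(1)[where f = fst and A = A, OF fSX this fib]
  have "card A = (q + 1) * card code_xs" by simp
  then have "(q + 1) * card code_xs = (q + 1) * (q ^ 3 * (q\<^sup>2 - 1))"
    unfolding 1 card_code_ys by (simp only: eval_nat_numeral power_Suc power_0 mult_1_right ac_simps)
  then show "card code_xs = q ^ 3 * (q\<^sup>2 - 1)" by (simp only: mult_cancel1) simp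
qed

lemma rational_diff_eq: "rational (q ^ 6) - rational (q ^ 2) = {P. cx P \<in> code_xs}"
proof -
  have "cy P \<in> code_ys \<longleftrightarrow> cx P \<in> code_xs" for P :: "'f gk_point"
    using card_section(2)[of "cx P" P] curve_y[of P] unfolding code_xs_def by blast
  then show ?thesis using rational_q6_iff by blast
qed

lemma card_rational_diff: "card (rational (q ^ 6) - rational (q ^ 2)) = q ^ 3 * (q\<^sup>2 - 1) * (q ^ 3 + 1)"
  and finite_rational_diff: "finite (rational (q ^ 6) - rational (q ^ 2))"
  using card_vimage_const[where f = "cx :: 'f gk_point \<Rightarrow> _", OF finite_code_xs card_section(1)]
  unfolding rational_diff_eq by (simp_all add: card_code_xs)

end

section \<open>Functions on the affine curve\<close>

type_synonym 'f gk_fun = "'f gk_point \<Rightarrow> 'f alg_closure"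

lemma power_fun_apply: "(f ^ n) x = (f x :: 'b::comm_semiring_1) ^ n"
  by (induction n) auto

lemma prod_fun_apply: "(\<Prod>i\<in>A. f i) x = (\<Prod>i\<in>A. (f i x :: 'b::comm_semiring_1))"
  by (induction A rule: infinite_finite_induct) auto

lemma sum_fun_apply: "(\<Sum>i\<in>A. f i) x = (\<Sum>i\<in>A. (f i x :: 'b::comm_semiring_1))"
  by (induction A rule: infinite_finite_induct) auto

lemmas fun_app = plus_fun_apply times_fun_apply zero_fun_apply one_fun_apply minus_apply
  uminus_apply power_fun_apply prod_fun_apply sum_fun_apply

text \<open>The ring structure is to be used on whole functions. As rewrite rules the pointwise laws would break up
  every sum and product that happens to be eta-expanded.\<close>

declare plus_fun_apply [simp del] times_fun_apply [simp del] zero_fun_apply [simp del]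
  one_fun_apply [simp del] minus_apply [simp del] uminus_apply [simp del]

text \<open>If \<open>p\<close> is not constant, then neither is \<open>p + 1\<close>, and a root of the latter is not a root of \<open>p\<close>.\<close>

lemma poly_all_zero_imp_zero:
  fixes p :: "'a::alg_closed_field poly"
  assumes "\<And>x. poly p x = 0"
  shows "p = 0"
proof (cases "Polynomial.degree p > 0")
  case True
  then have "Polynomial.degree (p + [:1:]) > 0" by (subst degree_add_eq_left) auto
  from alg_closed_imp_poly_has_root[OF this] show ?thesis using assms by auto
next
  case False
  then obtain c where "p = [:c:]" by (metis degree_eq_zeroE gr0I)
  then show ?thesis using assms[of 0] by simp
qed

lemma vandermonde_zero:
  fixes c :: "nat \<Rightarrow> 'a::idom"
  assumes "card S \<ge> n" "finite S" "\<And>s. s \<in> S \<Longrightarrow> (\<Sum>i<n. c i * s ^ i) = 0" "i < n"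
  shows "c i = 0"
proof (rule ccontr)
  assume ci: "c i \<noteq> 0"
  define p where "p = (\<Sum>i<n. Polynomial.monom (c i) i)"
  have co: "Polynomial.coeff p i = c i"
    using assms(4) by (simp add: p_def Polynomial.coeff_sum)
  then have p0: "p \<noteq> 0" using ci by auto
  have "Polynomial.degree p < n"
    unfolding p_def using assms(4)
    by (intro degree_sum_less) (auto intro: le_less_trans[OF Polynomial.degree_monom_le])
  moreover have "S \<subseteq> {x. poly p x = 0}"
    using assms(3) by (auto simp: p_def poly_sum poly_monom)
  then have "card S \<le> Polynomial.degree p"
    by (rule order_trans[OF card_mono[OF poly_roots_finite[OF p0]] card_poly_roots_bound[OF p0]])
  ultimately show False using assms(1) by simp
qed

section \<open>The coordinate ring and its weight\<close>

context gk
begin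

definition cst :: "'f alg_closure \<Rightarrow> 'f gk_fun" where "cst c = (\<lambda>_. c)"

definition mon :: "nat \<Rightarrow> nat \<Rightarrow> nat \<Rightarrow> 'f gk_fun" where
  "mon i j l = cx ^ i * cy ^ j * cz ^ l"

text \<open>The weights of \<open>x\<close>, \<open>y\<close> and \<open>z\<close> are their pole orders at infinity. They make the leading terms
  of the two equations of the curve equally heavy.\<close>

definition mon_weight :: "nat \<Rightarrow> nat \<Rightarrow> nat \<Rightarrow> nat" where
  "mon_weight i j l = i * (q ^ 3 + 1) + j * (q * N) + l * q ^ 3"

lemma cst_apply: "cst c P = c" by (simp add: cst_def)

lemmas fn_app = fun_app cst_apply

lemma cst_0 [simp]: "cst 0 = 0" and cst_1 [simp]: "cst 1 = 1"
  by (simp_all add: fun_eq_iff fn_app)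

lemma cst_mult: "cst (c * d) = cst c * cst d" and cst_add: "cst (c + d) = cst c + cst d"
  and cst_minus: "cst (- c) = - cst c"
  by (simp_all add: fun_eq_iff fn_app)

lemma mon_apply: "mon i j l P = cx P ^ i * cy P ^ j * cz P ^ l" by (simp add: mon_def fn_app)

lemma mon_mult: "mon i j l * mon i' j' l' = mon (i + i') (j + j') (l + l')"
  by (simp add: mon_def power_add ac_simps)

lemma mon_weight_add: "mon_weight (i + i') (j + j') (l + l') = mon_weight i j l + mon_weight i' j' l'"
  by (simp add: mon_weight_def algebra_simps)

inductive spanned :: "nat \<Rightarrow> 'f gk_fun \<Rightarrow> bool" for w where
  zero: "spanned w 0"
| step: "spanned w a \<Longrightarrow> mon_weight i j l < w \<Longrightarrow> spanned w (a + cst c * mon i j l)"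

definition below :: "nat \<Rightarrow> 'f gk_fun set" where "below w = Collect (spanned w)"

lemma below_zero: "0 \<in> below w"
  by (simp add: below_def spanned.zero)

lemma below_step: "a \<in> below w \<Longrightarrow> mon_weight i j l < w \<Longrightarrow> a + cst c * mon i j l \<in> below w"
  by (simp add: below_def spanned.step)

lemma below_induct [consumes 1, case_names zero step]:
  assumes "a \<in> below w" "Q 0"
    "\<And>a i j l c. a \<in> below w \<Longrightarrow> Q a \<Longrightarrow> mon_weight i j l < w \<Longrightarrow> Q (a + cst c * mon i j l)"
  shows "Q a"
  using assms(1) unfolding below_def mem_Collect_eq
  by (induction rule: spanned.induct) (use assms in \<open>auto simp: below_def\<close>)

lemma below_mono: "a \<in> below w \<Longrightarrow> w \<le> w' \<Longrightarrow> a \<in> below w'"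
  by (induction rule: below_induct) (auto intro: below_zero below_step)

lemma below_add: assumes "a \<in> below w" "b \<in> below w" shows "a + b \<in> below w"
  using assms(2)
proof (induction rule: below_induct)
  case (step b i j l c)
  then show ?case using below_step[OF step.IH step.hyps(2), of c] by (simp add: add.assoc)
qed (use assms(1) in simp)

lemma below_mon: "mon_weight i j l < w \<Longrightarrow> cst c * mon i j l \<in> below w"
  using below_step[OF below_zero, of i j l w c] by simp

lemma below_mult_mon: "a \<in> below w \<Longrightarrow> cst c * mon i j l * a \<in> below (w + mon_weight i j l)"
proof (induction rule: below_induct)
  case (step a i' j' l' c')
  have "cst (c * c') * mon (i + i') (j + j') (l + l') \<in> below (w + mon_weight i j l)"
    using step.hyps(2) by (intro below_mon) (simp add: mon_weight_add)
  moreover have "cst (c * c') = cst c * cst c'" by (simp add: fun_eq_iff fn_app)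
  ultimately have "cst c * mon i j l * a + cst c * mon i j l * (cst c' * mon i' j' l') \<in> below (w + mon_weight i j l)"
    using step.IH by (intro below_add) (simp_all add: mon_mult[symmetric] ac_simps)
  then show ?case by (simp add: algebra_simps)
qed (simp add: below_zero)

lemma mon_weight_0 [simp]: "mon_weight 0 0 0 = 0" and mon_0 [simp]: "mon 0 0 0 = 1"
  by (simp_all add: mon_weight_def mon_def)

lemma below_scale: "a \<in> below w \<Longrightarrow> cst c * a \<in> below w"
  using below_mult_mon[of a w c 0 0 0] by simp

lemma below_minus: "a \<in> below w \<Longrightarrow> - a \<in> below w"
proof -
  assume "a \<in> below w"
  from below_scale[OF this, of "-1"] show ?thesis by (simp add: cst_minus)
qed

lemma below_diff: "a \<in> below w \<Longrightarrow> b \<in> below w \<Longrightarrow> a - b \<in> below w"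
  using below_add[of a w "- b"] below_minus[of b w] by simp

lemma below_mult: assumes "a \<in> below w" "b \<in> below w'" shows "a * b \<in> below (w + w')"
  using assms(2)
proof (induction rule: below_induct)
  case (step b i j l c)
  have "cst c * mon i j l * a \<in> below (w + w')"
    using below_mult_mon[OF assms(1), of c i j l] step.hyps(2) by (auto elim: below_mono)
  then show ?case using below_add[OF step.IH, of "cst c * mon i j l * a"] by (simp add: algebra_simps)
qed (simp add: below_zero)

text \<open>
  The coefficient \<open>k\<close> may be zero, and the monomial need not be one of the basis: several monomials have the same
  weight, but modulo lower weights they are all equal (\<open>same_mon_weight_diff\<close>).
\<close>

definition leading_term :: "'f gk_fun \<Rightarrow> 'f alg_closure \<Rightarrow> nat \<Rightarrow> nat \<Rightarrow> nat \<Rightarrow> bool" where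
  "leading_term a k i j l \<longleftrightarrow> a - cst k * mon i j l \<in> below (mon_weight i j l)"

lemma leading_term_mon: "leading_term (mon i j l) 1 i j l" by (simp add: leading_term_def below_zero)

lemma leading_term_mult:
  assumes "leading_term a k i j l" "leading_term b k' i' j' l'"
  shows "leading_term (a * b) (k * k') (i + i') (j + j') (l + l')"
proof -
  define s t where "s = a - cst k * mon i j l" and "t = b - cst k' * mon i' j' l'"
  have st: "s \<in> below (mon_weight i j l)" "t \<in> below (mon_weight i' j' l')" using assms by (auto simp: leading_term_def s_def t_def)
  have ab: "a = cst k * mon i j l + s" "b = cst k' * mon i' j' l' + t" by (simp_all add: s_def t_def)
  have k: "cst (k * k') = cst k * cst k'" by (simp add: fun_eq_iff fn_app)
  have "a * b - cst (k * k') * mon (i + i') (j + j') (l + l')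
      = cst k * mon i j l * t + cst k' * mon i' j' l' * s + s * t"
    unfolding ab k mon_mult[symmetric] by (simp add: algebra_simps)
  moreover have "cst k * mon i j l * t \<in> below (mon_weight i j l + mon_weight i' j' l')"
    "cst k' * mon i' j' l' * s \<in> below (mon_weight i j l + mon_weight i' j' l')" "s * t \<in> below (mon_weight i j l + mon_weight i' j' l')"
    using below_mult_mon[OF st(2), of k i j l] below_mult_mon[OF st(1), of k' i' j' l'] below_mult[OF st]
    by (simp_all add: add.commute)
  ultimately show ?thesis unfolding leading_term_def mon_weight_add by (simp add: below_add)
qed

lemma mon_weight_relations:
  "mon_weight q 0 0 = mon_weight 0 (q + 1) 0" "mon_weight 1 0 0 < mon_weight q 0 0"
  "mon_weight 0 (q\<^sup>2) 0 = mon_weight 0 0 N" "mon_weight 0 1 0 < mon_weight 0 (q\<^sup>2) 0" "mon_weight 0 1 0 < mon_weight 1 0 0"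
proof -
  have "q * (q ^ 3 + 1) = (q + 1) * (q * N)" unfolding q_cubed[symmetric] by (simp add: algebra_simps)
  then show "mon_weight q 0 0 = mon_weight 0 (q + 1) 0" by (simp add: mon_weight_def)
  show "mon_weight 1 0 0 < mon_weight q 0 0" unfolding mon_weight_def using q_gt_1 by (simp del: mult_Suc_right)
  show "mon_weight 0 (q\<^sup>2) 0 = mon_weight 0 0 N" by (simp add: mon_weight_def power2_eq_square power3_eq_cube ac_simps)
  show "mon_weight 0 1 0 < mon_weight 0 (q\<^sup>2) 0" using q_gt_1 N_pos one_less_power[OF q_gt_1, of 2] by (simp add: mon_weight_def)
  have "q * N < (q + 1) * N" using N_pos by simp
  then show "mon_weight 0 1 0 < mon_weight 1 0 0" using q_cubed by (simp add: mon_weight_def mult.commute)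
qed

lemma curve_fun_x: "cx ^ q = cy ^ (q + 1) - (cx :: 'f gk_fun)"
proof
  fix P :: "'f gk_point"
  show "(cx ^ q) P = (cy ^ (q + 1) - cx) P" using curve_y[of P] by (simp add: fn_app)
qed

lemma curve_fun_y: "cy ^ q\<^sup>2 = cz ^ N + (cy :: 'f gk_fun)"
proof
  fix P :: "'f gk_point"
  show "(cy ^ q\<^sup>2) P = (cz ^ N + cy) P" using curve_z[of P] by (simp add: fn_app)
qed

text \<open>Replacing \<open>y ^ q\<^sup>2\<close> by \<open>z ^ N + y\<close> preserves the weight of the leading monomial and lowers that of the other.\<close>

lemma reduce_y:
  "\<exists>j'<q\<^sup>2. \<exists>l'. mon_weight i j' l' = mon_weight i j l \<and> mon i j l - mon i j' l' \<in> below (mon_weight i j l)"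
proof (induction j arbitrary: l rule: less_induct)
  case (less j)
  show ?case
  proof (cases "j < q\<^sup>2")
    case True
    then show ?thesis using below_zero by (metis diff_self)
  next
    case False
    define j0 where "j0 = j - q\<^sup>2"
    have j: "j = j0 + q\<^sup>2" using False by (simp add: j0_def)
    have q2: "q\<^sup>2 > 1" using one_less_power[OF q_gt_1, of 2] by simp
    have m: "mon i j l = mon i j0 (l + N) + mon i (j0 + 1) l"
      unfolding mon_def j power_add curve_fun_y by (simp add: algebra_simps)
    have w: "mon_weight i j0 (l + N) = mon_weight i j l" using mon_weight_relations(3)
      by (simp add: mon_weight_def j algebra_simps power2_eq_square power3_eq_cube)
    have lt: "mon_weight i (j0 + 1) l < mon_weight i j l" using mon_weight_relations(4) by (simp add: mon_weight_def j algebra_simps)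
    have "j0 < j" using q2 q_gt_1 j by simp
    from less.IH[OF this, of "l + N"] obtain j' l' where
      *: "j' < q\<^sup>2" "mon_weight i j' l' = mon_weight i j l" "mon i j0 (l + N) - mon i j' l' \<in> below (mon_weight i j l)"
      unfolding w by blast
    have "mon i j l - mon i j' l' = (mon i j0 (l + N) - mon i j' l') + cst 1 * mon i (j0 + 1) l"
      unfolding m by simp
    moreover have "\<dots> \<in> below (mon_weight i j l)" using * lt by (intro below_step)
    ultimately show ?thesis using * by metis
  qed
qed

text \<open>Replacing \<open>x ^ q\<close> by \<open>y ^ (q + 1) - x\<close> has the same effect. It increases the exponent of \<open>y\<close>, so the
  exponent of \<open>x\<close> is reduced first.\<close>

lemma reduce_mon:
  "\<exists>i'<q. \<exists>j'<q\<^sup>2. \<exists>l'. mon_weight i' j' l' = mon_weight i j l \<and> mon i j l - mon i' j' l' \<in> below (mon_weight i j l)"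
proof (induction i arbitrary: j l rule: less_induct)
  case (less i)
  show ?case
  proof (cases "i < q")
    case True
    then show ?thesis using reduce_y[of i j l] by blast
  next
    case False
    define i0 where "i0 = i - q"
    have i: "i = i0 + q" using False by (simp add: i0_def)
    have m: "mon i j l = mon i0 (j + (q + 1)) l + cst (-1) * mon (i0 + 1) j l"
    proof -
      have k: "cst (-1) = (-1 :: 'f gk_fun)" by (simp add: fun_eq_iff fn_app)
      show ?thesis unfolding mon_def i power_add[of _ i0] power_add[of _ j] curve_fun_x k
        by (simp add: algebra_simps)
    qed
    have w: "mon_weight i0 (j + (q + 1)) l = mon_weight i j l" using mon_weight_relations(1) by (simp add: mon_weight_def i algebra_simps)
    have lt: "mon_weight (i0 + 1) j l < mon_weight i j l" using mon_weight_relations(2) by (simp add: mon_weight_def i algebra_simps)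
    have "i0 < i" using q_gt_1 i by simp
    from less.IH[OF this, of "j + (q + 1)" l] obtain i' j' l' where
      *: "i' < q" "j' < q\<^sup>2" "mon_weight i' j' l' = mon_weight i j l" "mon i0 (j + (q + 1)) l - mon i' j' l' \<in> below (mon_weight i j l)"
      unfolding w by blast
    have "mon i j l - mon i' j' l' = (mon i0 (j + (q + 1)) l - mon i' j' l') + cst (-1) * mon (i0 + 1) j l"
      unfolding m by simp
    moreover have "\<dots> \<in> below (mon_weight i j l)" using * lt by (intro below_step)
    ultimately show ?thesis using * by metis
  qed
qed

text \<open>Modulo \<open>q\<close> the weight is \<open>i\<close>. After subtracting the term of \<open>x\<close> and dividing by \<open>q\<close> there remains
  \<open>j * N + l * q\<^sup>2\<close>, which is \<open>j\<close> modulo \<open>q\<^sup>2\<close> after multiplication by \<open>q + 1\<close>, because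
  \<open>N * (q + 1) = q ^ 3 + 1\<close>.\<close>

lemma mon_weight_inj:
  assumes "mon_weight i j l = mon_weight i' j' l'" "i < q" "i' < q" "j < q\<^sup>2" "j' < q\<^sup>2"
  shows "i = i' \<and> j = j' \<and> l = l'"
proof -
  have m: "mon_weight i j l mod q = i" if "i < q" for i j l
  proof -
    have "mon_weight i j l = i + q * (i * q\<^sup>2 + j * N + l * q\<^sup>2)"
      by (simp add: mon_weight_def power3_eq_cube power2_eq_square algebra_simps)
    then show ?thesis using that by simp
  qed
  have i: "i = i'" using m[OF assms(2)] m[OF assms(3)] assms(1) by metis
  then have "q * (j * N + l * q\<^sup>2) = q * (j' * N + l' * q\<^sup>2)"
    using assms(1) by (simp add: mon_weight_def power3_eq_cube power2_eq_square algebra_simps)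
  then have e: "j * N + l * q\<^sup>2 = j' * N + l' * q\<^sup>2" using q_gt_1 by (simp only: mult_cancel1) simp
  have n: "(j * N + l * q\<^sup>2) * (q + 1) mod q\<^sup>2 = j" if "j < q\<^sup>2" for j l
  proof -
    have "(j * N + l * q\<^sup>2) * (q + 1) = j * (N * (q + 1)) + q\<^sup>2 * (l * (q + 1))"
      by (simp add: algebra_simps)
    also have "\<dots> = j + q\<^sup>2 * (j * q + l * (q + 1))"
      unfolding q_cubed by (simp add: power3_eq_cube power2_eq_square algebra_simps)
    finally show ?thesis using that by simp
  qed
  have j: "j = j'" using n[OF assms(4), of l] n[OF assms(5), of l'] e by metis
  then show ?thesis using i e q_gt_1 by simp
qed

text \<open>This is where the covering of the \<open>z\<close>-line is seen to be unramified: every fibre has \<open>q\<^sup>2\<close> values of \<open>y\<close>, with \<open>q\<close>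
  values of \<open>x\<close> over each of them, so a polynomial of smaller degrees in \<open>x\<close> and \<open>y\<close> that
  vanishes on a fibre is zero.\<close>

lemma fibre_zero:
  assumes "\<And>P :: 'f gk_point. cz P = z \<Longrightarrow> (\<Sum>i<q. \<Sum>j<q\<^sup>2. c i j * cx P ^ i * cy P ^ j) = 0"
    and "i < q" "j < q\<^sup>2"
  shows "c i j = 0"
proof -
  define S where "S = {y. y ^ q\<^sup>2 - y = z ^ N}"
  have S: "card S = q\<^sup>2" unfolding S_def by (rule card_frob2_minus)
  have fS: "finite S" by (rule card_ge_0_finite) (use S q_gt_1 in simp)
  have "(\<Sum>j<q\<^sup>2. c i j * y ^ j) = 0" if y: "y \<in> S" for y
  proof -
    have T: "card {x. x ^ q + x = y ^ (q + 1)} = q" by (rule card_frob_plus)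
    have fT: "finite {x. x ^ q + x = y ^ (q + 1)}" by (rule card_ge_0_finite) (use T q_gt_1 in simp)
    have "(\<Sum>i<q. (\<Sum>j<q\<^sup>2. c i j * y ^ j) * x ^ i) = 0" if x: "x \<in> {x. x ^ q + x = y ^ (q + 1)}" for x
    proof -
      obtain P :: "'f gk_point" where P: "cx P = x" "cy P = y" "cz P = z"
        using curve_point_exists[of y x z] x y by (auto simp: S_def)
      show ?thesis using assms(1)[OF P(3)] by (simp add: P sum_distrib_right sum_distrib_left ac_simps)
    qed
    then show ?thesis
      using vandermonde_zero[of q _ "\<lambda>i. \<Sum>j<q\<^sup>2. c i j * y ^ j", OF _ fT _ assms(2)] T by simp
  qed
  then show ?thesis
    using vandermonde_zero[of "q\<^sup>2" S "\<lambda>j. c i j", OF _ fS _ assms(3)] S by simp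
qed

text \<open>The expansion of a function in the basis \<open>x ^ i * y ^ j\<close> over \<open>k[z]\<close>.\<close>

definition normal_form :: "(nat \<Rightarrow> nat \<Rightarrow> 'f alg_closure poly) \<Rightarrow> 'f gk_fun" where
  "normal_form c = (\<lambda>P. \<Sum>i<q. \<Sum>j<q\<^sup>2. poly (c i j) (cz P) * cx P ^ i * cy P ^ j)"

lemma normal_form_add: "normal_form c + normal_form c' = normal_form (\<lambda>i j. c i j + c' i j)"
  by (simp add: normal_form_def fun_eq_iff fn_app sum.distrib algebra_simps)

lemma normal_form_scale: "cst k * normal_form c = normal_form (\<lambda>i j. Polynomial.smult k (c i j))"
  by (simp add: normal_form_def fun_eq_iff fn_app sum_distrib_left algebra_simps)

lemma normal_form_mon:
  assumes "i < q" "j < q\<^sup>2"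
  shows "mon i j l = normal_form (\<lambda>i' j'. if i' = i \<and> j' = j then Polynomial.monom 1 l else 0)"
proof
  fix P :: "'f gk_point"
  have "(\<Sum>i'<q. \<Sum>j'<q\<^sup>2. poly (if i' = i \<and> j' = j then Polynomial.monom 1 l else 0) (cz P) * cx P ^ i' * cy P ^ j')
    = (\<Sum>i'<q. if i' = i then (\<Sum>j'<q\<^sup>2. if j' = j then cz P ^ l * cx P ^ i' * cy P ^ j' else 0) else 0)"
    by (intro sum.cong refl, split if_split, intro conjI impI sum.cong refl)
      (simp_all add: poly_monom)
  also have "\<dots> = mon i j l P" using assms by (simp add: mon_apply)
  finally show "mon i j l P = normal_form (\<lambda>i' j'. if i' = i \<and> j' = j then Polynomial.monom 1 l else 0) P"
    by (simp add: normal_form_def)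
qed

text \<open>Reducing a monomial leaves a remainder of smaller weight, to which the statement applies by induction on
  the weight.\<close>

lemma below_normal_form:
  "a \<in> below w \<Longrightarrow> \<exists>c. a = normal_form c \<and> (\<forall>i j l. Polynomial.coeff (c i j) l \<noteq> 0 \<longrightarrow> mon_weight i j l < w)"
proof (induction w arbitrary: a rule: less_induct)
  case (less w)
  from less.prems show ?case
  proof (induction rule: below_induct)
    case zero
    have "(0 :: 'f gk_fun) = normal_form (\<lambda>_ _. 0)" by (simp add: normal_form_def fun_eq_iff fn_app)
    then show ?case by (intro exI[of _ "\<lambda>_ _. 0"]) simp
  next
    case (step a i j l k)
    obtain c where c: "a = normal_form c" "\<forall>i j l. Polynomial.coeff (c i j) l \<noteq> 0 \<longrightarrow> mon_weight i j l < w"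
      using step.IH by blast
    obtain i' j' l' where r: "i' < q" "j' < q\<^sup>2" "mon_weight i' j' l' = mon_weight i j l"
      "mon i j l - mon i' j' l' \<in> below (mon_weight i j l)"
      using reduce_mon by blast
    obtain d where d: "mon i j l - mon i' j' l' = normal_form d"
      "\<forall>i' j' l'. Polynomial.coeff (d i' j') l' \<noteq> 0 \<longrightarrow> mon_weight i' j' l' < mon_weight i j l"
      using less.IH[OF step.hyps(2) r(4)] by blast
    define e where "e = (\<lambda>i j. if i = i' \<and> j = j' then Polynomial.monom (1 :: 'f alg_closure) l' else 0)"
    have m: "mon i j l = normal_form d + normal_form e" using d(1) normal_form_mon[OF r(1,2), of l'] by (simp add: e_def algebra_simps)
    have "a + cst k * mon i j l = normal_form (\<lambda>i j. c i j + Polynomial.smult k (d i j + e i j))"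
      unfolding c(1) m normal_form_add normal_form_scale ..
    moreover have "mon_weight i1 j1 l1 < w"
      if "Polynomial.coeff (c i1 j1 + Polynomial.smult k (d i1 j1 + e i1 j1)) l1 \<noteq> 0" for i1 j1 l1
    proof -
      have "Polynomial.coeff (c i1 j1) l1 \<noteq> 0 \<or> Polynomial.coeff (d i1 j1) l1 \<noteq> 0 \<or> Polynomial.coeff (e i1 j1) l1 \<noteq> 0"
        using that by auto
      then show ?thesis using c(2) d(2) r(3) step.hyps(2)
        by (metis (no_types, lifting) coeff_0 coeff_monom e_def less_trans)
    qed
    ultimately show ?case by blast
  qed
qed

lemma normal_form_zero:
  assumes "normal_form c = 0" "i < q" "j < q\<^sup>2"
  shows "c i j = 0"
proof (rule poly_all_zero_imp_zero)
  fix z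
  show "poly (c i j) z = 0"
  proof (rule fibre_zero[where c = "\<lambda>i j. poly (c i j) z", OF _ assms(2,3)])
    fix P :: "'f gk_point" assume "cz P = z"
    then show "(\<Sum>i<q. \<Sum>j<q\<^sup>2. poly (c i j) z * cx P ^ i * cy P ^ j) = 0"
      using fun_cong[OF assms(1), of P] by (simp add: normal_form_def fn_app)
  qed
qed

text \<open>A basis monomial of weight \<open>w\<close> is not a combination of basis monomials of smaller weight, by uniqueness of
  normal forms. This is what makes weights well defined.\<close>

lemma mon_notin_below: "mon i j l \<notin> below (mon_weight i j l)"
proof
  assume m: "mon i j l \<in> below (mon_weight i j l)"
  obtain i' j' l' where r: "i' < q" "j' < q\<^sup>2" "mon_weight i' j' l' = mon_weight i j l"
    "mon i j l - mon i' j' l' \<in> below (mon_weight i j l)"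
    using reduce_mon by blast
  have "mon i' j' l' \<in> below (mon_weight i j l)" using below_diff[OF m r(4)] by simp
  then obtain c where c: "mon i' j' l' = normal_form c"
    "\<forall>i1 j1 l1. Polynomial.coeff (c i1 j1) l1 \<noteq> 0 \<longrightarrow> mon_weight i1 j1 l1 < mon_weight i j l"
    using below_normal_form by blast
  define e where "e = (\<lambda>i j. if i = i' \<and> j = j' then Polynomial.monom (1 :: 'f alg_closure) l' else 0)"
  have "normal_form c = normal_form e" using c(1) normal_form_mon[OF r(1,2), of l'] by (simp add: e_def)
  then have "normal_form (\<lambda>i j. c i j + Polynomial.smult (-1) (e i j)) = 0"
    unfolding normal_form_add[symmetric] normal_form_scale[symmetric] by (simp add: fun_eq_iff fn_app)
  from normal_form_zero[OF this r(1,2)] have "c i' j' = Polynomial.monom 1 l'" by (simp add: e_def)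
  then have "mon_weight i' j' l' < mon_weight i j l" using c(2) by auto
  with r(3) show False by simp
qed

subsection \<open>Weights\<close>

definition has_weight :: "'f gk_fun \<Rightarrow> nat \<Rightarrow> bool" where
  "has_weight a w \<longleftrightarrow> (\<exists>k i j l. k \<noteq> 0 \<and> mon_weight i j l = w \<and> leading_term a k i j l)"

lemma has_weightI: "k \<noteq> 0 \<Longrightarrow> mon_weight i j l = w \<Longrightarrow> a - cst k * mon i j l \<in> below w \<Longrightarrow> has_weight a w"
  unfolding has_weight_def leading_term_def by blast

text \<open>Any monomial may serve as leading monomial, and the product of the leading monomials is again a monomial.\<close>

lemma has_weight_mult: "has_weight a w \<Longrightarrow> has_weight b w' \<Longrightarrow> has_weight (a * b) (w + w')"
  unfolding has_weight_def using leading_term_mult mon_weight_add by (metis no_zero_divisors)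

lemma has_weight_in_below: assumes "has_weight a w" shows "a \<in> below (Suc w)"
proof -
  obtain k i j l where "mon_weight i j l = w" "a - cst k * mon i j l \<in> below w"
    using assms by (auto simp: has_weight_def leading_term_def)
  then have "(a - cst k * mon i j l) + cst k * mon i j l \<in> below (Suc w)"
    by (intro below_step) (auto elim: below_mono)
  then show ?thesis by simp
qed

lemma has_weight_notin_below: assumes "has_weight a w" shows "a \<notin> below w"
proof
  assume a: "a \<in> below w"
  obtain k i j l where k: "k \<noteq> 0" "mon_weight i j l = w" "a - cst k * mon i j l \<in> below w"
    using assms by (auto simp: has_weight_def leading_term_def)
  have "cst k * mon i j l \<in> below w" using below_diff[OF a k(3)] by simp
  from below_scale[OF this, of "inverse k"] have "mon i j l \<in> below w"
    using k(1) by (simp add: cst_mult[symmetric] mult.assoc[symmetric])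
  then show False using mon_notin_below k(2) by blast
qed

lemma has_weight_nonzero: "has_weight a w \<Longrightarrow> a \<noteq> 0"
  using has_weight_notin_below below_zero by blast

lemma has_weight_unique: assumes "has_weight a w" "has_weight a w'" shows "w = w'"
proof -
  have "\<not> w < w'" if "has_weight a w" "has_weight a w'" for w w'
    using has_weight_in_below[OF that(1)] has_weight_notin_below[OF that(2)] below_mono by (meson Suc_leI)
  then show ?thesis using assms by (meson linorder_neqE_nat)
qed

lemma same_mon_weight_diff: assumes "mon_weight i j l = mon_weight i' j' l'" shows "mon i j l - mon i' j' l' \<in> below (mon_weight i j l)"
proof -
  obtain i1 j1 l1 where r: "i1 < q" "j1 < q\<^sup>2" "mon_weight i1 j1 l1 = mon_weight i j l"
    "mon i j l - mon i1 j1 l1 \<in> below (mon_weight i j l)" using reduce_mon by blast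
  obtain i2 j2 l2 where s: "i2 < q" "j2 < q\<^sup>2" "mon_weight i2 j2 l2 = mon_weight i' j' l'"
    "mon i' j' l' - mon i2 j2 l2 \<in> below (mon_weight i' j' l')" using reduce_mon by blast
  have "i1 = i2 \<and> j1 = j2 \<and> l1 = l2" using r s assms by (intro mon_weight_inj) auto
  then show ?thesis using below_diff[OF r(4) s(4)[folded assms]] by simp
qed

text \<open>All monomials of weight \<open>w\<close> agree modulo lower weights, so their coefficients can be collected.\<close>

lemma below_Suc_cases: "a \<in> below (Suc w) \<Longrightarrow> a \<in> below w \<or> has_weight a w"
proof (induction rule: below_induct)
  case (step a i j l k)
  show ?case
  proof (cases "mon_weight i j l < w")
    case True
    then have s: "cst k * mon i j l \<in> below w" by (rule below_mon)
    from step.IH show ?thesis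
    proof
      assume "has_weight a w"
      then obtain k' i' j' l' where "k' \<noteq> 0" "mon_weight i' j' l' = w" "a - cst k' * mon i' j' l' \<in> below w"
        by (auto simp: has_weight_def leading_term_def)
      moreover from below_add[OF this(3) s]
      have "a + cst k * mon i j l - cst k' * mon i' j' l' \<in> below w" by (simp add: algebra_simps)
      ultimately show ?thesis using has_weightI by blast
    qed (use s below_add in blast)
  next
    case False
    then have w: "mon_weight i j l = w" using step.hyps(2) by simp
    show ?thesis
    proof (cases "k = 0")
      case True
      then show ?thesis using step.IH by simp
    next
      case k: False
      from step.IH show ?thesis
      proof
        assume "a \<in> below w"
        then have "has_weight (a + cst k * mon i j l) w" using k w by (intro has_weightI[OF k w]) simp
        then show ?thesis ..
      next
        assume "has_weight a w"
        then obtain k' i' j' l' where l: "k' \<noteq> 0" "mon_weight i' j' l' = w" "a - cst k' * mon i' j' l' \<in> below w"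
          by (auto simp: has_weight_def leading_term_def)
        have "mon i j l - mon i' j' l' \<in> below w" using same_mon_weight_diff[of i j l i' j' l'] l(2) w by simp
        from below_add[OF l(3) below_scale[OF this, of k]]
        have m: "a + cst k * mon i j l - cst (k' + k) * mon i' j' l' \<in> below w"
          by (simp add: algebra_simps cst_add)
        show ?thesis
        proof (cases "k' + k = 0")
          case True
          then show ?thesis using m by simp
        next
          case False
          then show ?thesis using has_weightI[OF _ l(2) m] by blast
        qed
      qed
    qed
  qed
qed (simp add: below_zero)

text \<open>The coordinate ring of the affine curve, as a ring of functions.\<close>

definition A :: "'f gk_fun set" where "A = (\<Union>w. below w)"

lemma has_weight_exists: assumes "a \<in> A" "a \<noteq> 0" shows "\<exists>w. has_weight a w"
proof -
  have ex: "\<exists>w. a \<in> below w" using assms(1) by (auto simp: A_def)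
  define w where "w = (LEAST w. a \<in> below w)"
  have w: "a \<in> below w" unfolding w_def by (rule LeastI_ex[OF ex])
  have "a = 0" if "a \<in> below 0" for a using that by (induction rule: below_induct) auto
  then have "w \<noteq> 0" using w assms(2) by metis
  then obtain v where v: "w = Suc v" using not0_implies_Suc by blast
  have "a \<notin> below v" using not_less_Least[of v "\<lambda>w. a \<in> below w"] v w_def by auto
  then show ?thesis using below_Suc_cases w v by blast
qed

lemma has_weight_in_A: "has_weight a w \<Longrightarrow> a \<in> A"
  using has_weight_in_below by (auto simp: A_def)

lemma A_0 [intro, simp]: "0 \<in> A" using below_zero by (auto simp: A_def)

lemma A_add [intro]: "a \<in> A \<Longrightarrow> b \<in> A \<Longrightarrow> a + b \<in> A"
proof -
  assume "a \<in> A" "b \<in> A"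
  then obtain w w' where "a \<in> below w" "b \<in> below w'" by (auto simp: A_def)
  then have "a + b \<in> below (max w w')" by (intro below_add) (auto elim: below_mono)
  then show ?thesis by (auto simp: A_def)
qed

lemma A_mult [intro]: "a \<in> A \<Longrightarrow> b \<in> A \<Longrightarrow> a * b \<in> A"
  using below_mult by (fastforce simp: A_def)

lemma A_minus [intro]: "a \<in> A \<Longrightarrow> - a \<in> A"
  using below_minus by (auto simp: A_def)

lemma A_diff [intro]: "a \<in> A \<Longrightarrow> b \<in> A \<Longrightarrow> a - b \<in> A"
  using A_add[of a "- b"] A_minus[of b] by simp

lemma A_mon: "mon i j l \<in> A"
  using has_weight_in_A has_weightI[of 1 i j l "mon_weight i j l" "mon i j l"] below_zero by simp

lemma A_cst [intro, simp]: "cst c \<in> A"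
  using below_mon[of 0 0 0 1 c] by (auto simp: A_def)

lemma A_1 [intro, simp]: "1 \<in> A" using A_cst[of 1] by simp

lemma A_xyz [intro, simp]: "cx \<in> A" "cy \<in> A" "cz \<in> A"
  using A_mon[of 1 0 0] A_mon[of 0 1 0] A_mon[of 0 0 1] by (simp_all add: mon_def)

lemma A_power [intro]: "a \<in> A \<Longrightarrow> a ^ n \<in> A" by (induction n) auto

lemma A_prod [intro]: "(\<And>i. i \<in> I \<Longrightarrow> f i \<in> A) \<Longrightarrow> (\<Prod>i\<in>I. f i) \<in> A"
  by (induction I rule: infinite_finite_induct) auto

lemma A_sum [intro]: "(\<And>i. i \<in> I \<Longrightarrow> f i \<in> A) \<Longrightarrow> (\<Sum>i\<in>I. f i) \<in> A"
  by (induction I rule: infinite_finite_induct) auto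

lemma A_domain: "a \<in> A \<Longrightarrow> b \<in> A \<Longrightarrow> a * b = 0 \<Longrightarrow> a = 0 \<or> b = 0"
  using has_weight_exists has_weight_mult has_weight_nonzero by metis

lemma A_cancel: assumes "c \<in> A" "a \<in> A" "b \<in> A" "c \<noteq> 0" "c * a = c * b" shows "a = b"
proof -
  have "c * (a - b) = 0" using assms(5) by (simp add: algebra_simps)
  then show ?thesis using A_domain[of c "a - b"] assms by auto
qed

lemma A_power_nonzero: "a \<in> A \<Longrightarrow> a \<noteq> 0 \<Longrightarrow> a ^ n \<noteq> 0"
proof (induction n)
  case (Suc n)
  then show ?case using A_domain[of a "a ^ n"] A_power by auto
qed simp

definition zpoly :: "'f alg_closure poly \<Rightarrow> 'f gk_fun" where "zpoly d = (\<lambda>P. poly d (cz P))"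

lemma zpoly_apply: "zpoly d P = poly d (cz P)" by (simp add: zpoly_def)

lemma zpoly_mult: "zpoly (d * e) = zpoly d * zpoly e" by (simp add: zpoly_def fun_eq_iff fn_app)

lemma zpoly_power: "zpoly (d ^ n) = zpoly d ^ n" by (simp add: zpoly_def fun_eq_iff fn_app)

lemma zpoly_linear: "zpoly [:- c, 1:] = cz - cst c" by (simp add: zpoly_def fun_eq_iff fn_app)

lemma zpoly_in_A [intro, simp]: "zpoly d \<in> A"
proof (induction d)
  case (pCons c d)
  have "zpoly (pCons c d) = cst c + cz * zpoly d" by (simp add: zpoly_def fun_eq_iff fn_app)
  then show ?case using pCons by auto
qed (simp add: zpoly_def zero_fun_def[symmetric])

lemma has_weight_zpoly: assumes "d \<noteq> 0" shows "has_weight (zpoly d) (Polynomial.degree d * q ^ 3)"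
proof -
  let ?n = "Polynomial.degree d"
  have "zpoly d = (\<Sum>i<?n. cst (Polynomial.coeff d i) * mon 0 0 i) + cst (Polynomial.lead_coeff d) * mon 0 0 ?n"
    by (simp add: zpoly_def fun_eq_iff fn_app poly_altdef mon_apply lessThan_Suc_atMost[symmetric])
  moreover have "(\<Sum>i<m. cst (Polynomial.coeff d i) * mon 0 0 i) \<in> below (m * q ^ 3)" for m
  proof (induction m)
    case (Suc m)
    have "(\<Sum>i<m. cst (Polynomial.coeff d i) * mon 0 0 i) \<in> below (Suc m * q ^ 3)"
      using Suc by (rule below_mono) simp
    moreover have "cst (Polynomial.coeff d m) * mon 0 0 m \<in> below (Suc m * q ^ 3)"
      using q_gt_1 by (intro below_mon) (simp add: mon_weight_def)
    ultimately show ?case by (simp add: below_add)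
  qed (simp add: below_zero)
  from this[of ?n] have "zpoly d - cst (Polynomial.lead_coeff d) * mon 0 0 ?n \<in> below (mon_weight 0 0 ?n)"
    using calculation by (simp add: mon_weight_def)
  then show ?thesis using assms by (intro has_weightI[of "Polynomial.lead_coeff d" 0 0 ?n]) (simp_all add: mon_weight_def)
qed

lemma zpoly_nonzero: "d \<noteq> 0 \<Longrightarrow> zpoly d \<noteq> 0"
  using has_weight_zpoly has_weight_nonzero by blast

lemma A_normal_form: assumes "a \<in> A" obtains c where "a = normal_form c"
  using assms below_normal_form unfolding A_def by blast

lemma normal_form_in_A: "normal_form c \<in> A"
proof -
  have "normal_form c = (\<Sum>i<q. \<Sum>j<q\<^sup>2. zpoly (c i j) * cx ^ i * cy ^ j)"
    by (simp add: normal_form_def fun_eq_iff fn_app zpoly_apply)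
  moreover have "\<dots> \<in> A" by (intro A_sum A_mult A_power zpoly_in_A A_xyz)
  ultimately show ?thesis by simp
qed

text \<open>On the fibre over \<open>z\<close> all coefficients of the normal form vanish, so each is divisible by the linear factor.\<close>

lemma fibre_vanish_dvd:
  assumes "a \<in> A" "\<And>P. cz P = z \<Longrightarrow> a P = 0"
  obtains b where "b \<in> A" "a = (cz - cst z) * b"
proof -
  obtain c where c: "a = normal_form c" using A_normal_form[OF assms(1)] by blast
  have "[:- z, 1:] dvd c i j" if "i < q" "j < q\<^sup>2" for i j
    unfolding poly_eq_0_iff_dvd[symmetric]
  proof (rule fibre_zero[where c = "\<lambda>i j. poly (c i j) z", OF _ that])
    fix P :: "'f gk_point" assume "cz P = z"
    then show "(\<Sum>i<q. \<Sum>j<q\<^sup>2. poly (c i j) z * cx P ^ i * cy P ^ j) = 0"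
      using assms(2)[of P] by (simp add: c normal_form_def)
  qed
  then have e: "c i j = [:- z, 1:] * (c i j div [:- z, 1:])" if "i < q" "j < q\<^sup>2" for i j
    using that by (metis dvd_mult_div_cancel)
  define d where "d = (\<lambda>i j. c i j div [:- z, 1:])"
  have "a = (cz - cst z) * normal_form d"
  proof
    fix P :: "'f gk_point"
    have "poly (c i j) (cz P) = (cz P - z) * poly (d i j) (cz P)" if "i < q" "j < q\<^sup>2" for i j
      by (subst e[OF that]) (simp add: d_def algebra_simps)
    then show "a P = ((cz - cst z) * normal_form d) P"
      by (simp add: c normal_form_def sum_distrib_left mult.assoc fn_app)
  qed
  with normal_form_in_A show thesis by (intro that)
qed

end

section \<open>Norms and zeros\<close>

context gk
begin

text \<open>The automorphisms \<open>(x, y, z) \<mapsto> (x + b ^ q * y + c, y + b, z)\<close>. The conditions \<open>b ^ q\<^sup>2 = b\<close> and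
  \<open>c ^ q + c = b ^ (q + 1)\<close> say that \<open>(c, b, 0)\<close> is a point of the curve, so these points index the
  automorphisms.\<close>

definition shift :: "'f gk_point \<Rightarrow> 'f gk_point \<Rightarrow> 'f gk_point" where
  "shift Q P = (SOME P'. cx P' = cx P + cy Q ^ q * cy P + cx Q \<and> cy P' = cy P + cy Q \<and> cz P' = cz P)"

lemma shift:
  assumes "Q \<in> rational (q ^ 2)"
  shows "cx (shift Q P) = cx P + cy Q ^ q * cy P + cx Q" "cy (shift Q P) = cy P + cy Q"
    "cz (shift Q P) = cz P"
proof -
  define x y b g where xy: "x = cx P" "y = cy P" "b = cy Q" "g = cx Q"
  have b: "b ^ q\<^sup>2 = b" using assms by (simp add: rational_q2_iff xy)
  have bq: "(b ^ q) ^ q = b" using b frob_steps(1)[of b] by simp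
  have xy1: "y * y ^ q = x ^ q + x" and bg: "b * b ^ q = g ^ q + g"
    using curve_y[of P] curve_y[of Q] by (simp_all add: xy)
  have "(y + b) ^ (q + 1) = (y + b) * (y ^ q + b ^ q)" by (simp add: frob_add1)
  also have "\<dots> = (x + b ^ q * y + g) ^ q + (x + b ^ q * y + g)"
  proof -
    have e: "(x + b ^ q * y + g) ^ q = x ^ q + b * y ^ q + g ^ q"
      by (simp only: frob_add1 power_mult_distrib bq)
    have "(y + b) * (y ^ q + b ^ q) = y * y ^ q + b * b ^ q + (b * y ^ q + b ^ q * y)"
      by (simp add: algebra_simps)
    also have "\<dots> = x ^ q + b * y ^ q + g ^ q + (x + b ^ q * y + g)"
      unfolding xy1 bg by (simp add: algebra_simps)
    finally show ?thesis unfolding e .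
  qed
  finally have 1: "(y + b) ^ (q + 1) = (x + b ^ q * y + g) ^ q + (x + b ^ q * y + g)" .
  have 2: "cz P ^ N = (y + b) ^ q\<^sup>2 - (y + b)"
    using curve_z[of P] by (simp add: xy frob_add b[unfolded xy])
  from curve_point_exists[OF 1 2]
  have "\<exists>P'. cx P' = cx P + cy Q ^ q * cy P + cx Q \<and> cy P' = cy P + cy Q \<and> cz P' = cz P"
    by (simp add: xy)
  from someI_ex[OF this]
  show "cx (shift Q P) = cx P + cy Q ^ q * cy P + cx Q" "cy (shift Q P) = cy P + cy Q"
    "cz (shift Q P) = cz P"
    unfolding shift_def by blast+
qed

text \<open>Two points over the same \<open>z\<close> have \<open>y' - y = b\<close> with \<open>b ^ q\<^sup>2 = b\<close>, and then \<open>c\<close> is determined by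
  \<open>x' = x + b ^ q * y + c\<close>.\<close>

lemma shift_fibre: "bij_betw (\<lambda>Q. shift Q P) (rational (q ^ 2)) {P'. cz P' = cz P}"
proof (rule bij_betwI')
  fix Q Q' assume Q: "Q \<in> rational (q ^ 2)" "Q' \<in> rational (q ^ 2)"
  show "shift Q P = shift Q' P \<longleftrightarrow> Q = Q'"
  proof
    assume "shift Q P = shift Q' P"
    then have "cx P + cy Q ^ q * cy P + cx Q = cx P + cy Q' ^ q * cy P + cx Q'" "cy P + cy Q = cy P + cy Q'"
      using shift[OF Q(1), of P] shift[OF Q(2), of P] by simp_all
    moreover have "cz Q = cz Q'" using Q by (simp add: zero_z_iff[symmetric])
    ultimately show "Q = Q'" by (intro gk_point_eqI) auto
  qed simp
next
  fix P' assume "P' \<in> {P'. cz P' = cz P}"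
  then have z: "cz P' = cz P" by simp
  define x y x' y' where xy: "x = cx P" "y = cy P" "x' = cx P'" "y' = cy P'"
  define b where "b = y' - y"
  define g where "g = x' - x - b ^ q * y"
  have "y' ^ q\<^sup>2 - y' = y ^ q\<^sup>2 - y" using curve_z[of P] curve_z[of P'] z by (simp add: xy)
  then have b2: "b ^ q\<^sup>2 = b" unfolding b_def frob_diff by (simp add: algebra_simps)
  then have bq: "(b ^ q) ^ q = b" using frob_steps(1)[of b] by simp
  have e: "y * y ^ q = x ^ q + x" "y' * y' ^ q = x' ^ q + x'"
    using curve_y[of P] curve_y[of P'] by (simp_all add: xy)
  have y': "y' = y + b" by (simp add: b_def)
  have "g ^ q + g = (x' ^ q + x') - (x ^ q + x) - (b * y ^ q + b ^ q * y)"
    by (simp add: g_def frob_diff1 frob_add1 power_mult_distrib bq algebra_simps)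
  also have "\<dots> = b * b ^ q" unfolding e[symmetric] by (simp add: y' frob_add1 algebra_simps)
  finally have "b ^ (q + 1) = g ^ q + g" by simp
  moreover have "0 ^ N = b ^ q\<^sup>2 - b" using b2 N_pos by (simp add: power_0_left)
  ultimately obtain Q where Q: "cx Q = g" "cy Q = b" "cz Q = 0" using curve_point_exists by blast
  then have QQ: "Q \<in> rational (q ^ 2)" using zero_z_iff by blast
  have "P' = shift Q P" using shift[OF QQ, of P] Q z
    by (intro gk_point_eqI) (simp_all add: b_def g_def xy)
  then show "\<exists>Q\<in>rational (q ^ 2). P' = shift Q P" using QQ by blast
qed (simp add: shift(3))

lemma leading_term_power: "leading_term a k i j l \<Longrightarrow> leading_term (a ^ n) (k ^ n) (n * i) (n * j) (n * l)"
proof (induction n)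
  case 0
  show ?case by (simp add: leading_term_def below_zero)
next
  case (Suc n)
  then show ?case using leading_term_mult[of a k i j l "a ^ n" "k ^ n"] by simp
qed

text \<open>A shift changes \<open>x\<close> and \<open>y\<close> only by terms of smaller weight.\<close>

lemma shift_mon: assumes "Q \<in> rational (q ^ 2)" shows "leading_term (mon i j l \<circ> shift Q) 1 i j l"
proof -
  have x: "leading_term (cx \<circ> shift Q) 1 1 0 0"
  proof -
    have "(cx \<circ> shift Q) - cst 1 * mon 1 0 0 = cst (cy Q ^ q) * mon 0 1 0 + cst (cx Q) * mon 0 0 0"
      by (simp add: fun_eq_iff fn_app mon_apply shift[OF assms])
    moreover have "\<dots> \<in> below (mon_weight 1 0 0)"
      using mon_weight_relations(5) by (intro below_step below_mon) (simp_all add: mon_weight_def)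
    ultimately show ?thesis by (simp add: leading_term_def)
  qed
  have y: "leading_term (cy \<circ> shift Q) 1 0 1 0"
  proof -
    have "(cy \<circ> shift Q) - cst 1 * mon 0 1 0 = cst (cy Q) * mon 0 0 0"
      by (simp add: fun_eq_iff fn_app mon_apply shift[OF assms])
    moreover have "\<dots> \<in> below (mon_weight 0 1 0)"
      using q_gt_1 N_pos by (intro below_mon) (simp_all add: mon_weight_def)
    ultimately show ?thesis by (simp add: leading_term_def)
  qed
  have z: "leading_term (cz \<circ> shift Q) 1 0 0 1"
  proof -
    have "cz \<circ> shift Q = mon 0 0 1" by (simp add: fun_eq_iff fn_app mon_apply shift[OF assms])
    then show ?thesis using leading_term_mon by simp
  qed
  have "mon i j l \<circ> shift Q = (cx \<circ> shift Q) ^ i * (cy \<circ> shift Q) ^ j * (cz \<circ> shift Q) ^ l"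
    by (simp add: fun_eq_iff fn_app mon_apply)
  then show ?thesis
    using leading_term_mult[OF leading_term_mult[OF leading_term_power[OF x, of i] leading_term_power[OF y, of j]] leading_term_power[OF z, of l]] by simp
qed

lemma leading_term_in_below: assumes "leading_term a k i j l" shows "a \<in> below (Suc (mon_weight i j l))"
proof -
  have "(a - cst k * mon i j l) + cst k * mon i j l \<in> below (Suc (mon_weight i j l))"
    using assms unfolding leading_term_def by (intro below_step) (auto elim: below_mono)
  then show ?thesis by simp
qed

lemma shift_below: assumes "Q \<in> rational (q ^ 2)" "a \<in> below w" shows "a \<circ> shift Q \<in> below w"
  using assms(2)
proof (induction rule: below_induct)
  case zero
  have "(0 :: 'f gk_fun) \<circ> shift Q = 0" by (simp add: fun_eq_iff fn_app)
  then show ?case by (simp only: below_zero)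
next
  case (step a i j l c)
  have "mon i j l \<circ> shift Q \<in> below w"
    by (rule below_mono[OF leading_term_in_below[OF shift_mon[OF assms(1)]]]) (use step.hyps(2) in simp)
  then have "(a \<circ> shift Q) + cst c * (mon i j l \<circ> shift Q) \<in> below w" using step.IH by (intro below_add below_scale)
  moreover have "(a + cst c * mon i j l) \<circ> shift Q = (a \<circ> shift Q) + cst c * (mon i j l \<circ> shift Q)"
    by (simp add: fun_eq_iff fn_app)
  ultimately show ?case by (simp only:)
qed

lemma shift_A: "Q \<in> rational (q ^ 2) \<Longrightarrow> a \<in> A \<Longrightarrow> a \<circ> shift Q \<in> A"
  using shift_below unfolding A_def by blast

lemma shift_has_weight: assumes "Q \<in> rational (q ^ 2)" "has_weight a w" shows "has_weight (a \<circ> shift Q) w"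
proof -
  obtain k i j l where k: "k \<noteq> 0" "mon_weight i j l = w" "a - cst k * mon i j l \<in> below w"
    using assms(2) by (auto simp: has_weight_def leading_term_def)
  have 1: "(a - cst k * mon i j l) \<circ> shift Q \<in> below w" using shift_below[OF assms(1) k(3)] .
  have 2: "(mon i j l \<circ> shift Q) - mon i j l \<in> below w" using shift_mon[OF assms(1), of i j l] k(2) by (simp add: leading_term_def)
  have "(a \<circ> shift Q) - cst k * mon i j l
      = ((a - cst k * mon i j l) \<circ> shift Q) + cst k * ((mon i j l \<circ> shift Q) - mon i j l)"
    by (simp add: fun_eq_iff fn_app algebra_simps)
  then have "(a \<circ> shift Q) - cst k * mon i j l \<in> below w" using 1 2 by (simp add: below_add below_scale)
  then show ?thesis using k has_weightI by blast
qed

definition fibre_norm :: "'f gk_fun \<Rightarrow> 'f gk_fun" where "fibre_norm a = (\<Prod>Q\<in>rational (q ^ 2). a \<circ> shift Q)"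

lemma has_weight_1: "has_weight 1 0"
  using has_weightI[of 1 0 0 0 0 1] below_zero by simp

lemma has_weight_prod:
  "finite I \<Longrightarrow> (\<And>i. i \<in> I \<Longrightarrow> has_weight (f i) w) \<Longrightarrow> has_weight (\<Prod>i\<in>I. f i) (card I * w)"
proof (induction I rule: finite_induct)
  case (insert i I)
  then show ?case using has_weight_mult[of "f i" w] by simp
qed (simp add: has_weight_1)

text \<open>The norm is constant on fibres because the shifts permute each fibre simply transitively. Hence its normal
  form has no terms besides \<open>i = j = 0\<close>. Comparing weights gives the degree: the norm is a product of \<open>q ^ 3\<close> functions
  of weight \<open>w\<close>, and \<open>z\<close> has weight \<open>q ^ 3\<close>.\<close>

lemma fibre_norm_poly:
  assumes "has_weight a w"
  obtains d where "d \<noteq> 0" "fibre_norm a = zpoly d" "Polynomial.degree d = w"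
proof -
  have lN: "has_weight (fibre_norm a) (q ^ 3 * w)"
    unfolding fibre_norm_def using has_weight_prod[OF finite_rational_q2] shift_has_weight[OF _ assms] card_rational_q2 by metis
  have const: "fibre_norm a P = fibre_norm a P'" if "cz P = cz P'" for P P'
  proof -
    have "fibre_norm a R = (\<Prod>P\<in>{P. cz P = cz R}. a P)" for R
      using prod.reindex_bij_betw[OF shift_fibre, of a R] by (simp add: fibre_norm_def fn_app)
    then show ?thesis using that by simp
  qed
  obtain c where c: "fibre_norm a = normal_form c" using A_normal_form[OF has_weight_in_A[OF lN]] by blast
  have q2: "q\<^sup>2 > 1" using one_less_power[OF q_gt_1, of 2] by simp
  have cz0: "c i j = 0" if ij: "i < q" "j < q\<^sup>2" "(i, j) \<noteq> (0, 0)" for i j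
  proof (rule poly_all_zero_imp_zero)
    fix z :: "'f alg_closure"
    obtain y where y: "y ^ q\<^sup>2 - y = z ^ N"
      using card_frob2_minus[of "z ^ N"] q2 by (metis (mono_tags, lifting) Collect_empty_eq card.empty not_one_less_zero)
    obtain x where x: "x ^ q + x = y ^ (q + 1)"
      using card_frob_plus[of "y ^ (q + 1)"] q_gt_1 by (metis (mono_tags, lifting) Collect_empty_eq card.empty not_one_less_zero)
    obtain P :: "'f gk_point" where P: "cz P = z" using curve_point_exists[of y x z] x y by metis
    define v where "v = fibre_norm a P"
    \<comment> \<open>Subtracting the constant value \<open>v\<close> of the norm on the fibre gives a combination that vanishes on it.\<close>
    define c' where "c' = (\<lambda>i j. poly (c i j) z - (if i = 0 \<and> j = 0 then v else 0))"
    have "c' i j = 0"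
    proof (rule fibre_zero[where c = c', OF _ ij(1,2)])
      fix P' :: "'f gk_point" assume P': "cz P' = z"
      have "(\<Sum>i<q. \<Sum>j<q\<^sup>2. (if i = 0 \<and> j = 0 then v else 0) * cx P' ^ i * cy P' ^ j)
          = (\<Sum>i<q. \<Sum>j<q\<^sup>2. if j = 0 then (if i = 0 then v else 0) else 0)"
        by (intro sum.cong refl) simp
      also have "\<dots> = v" using q_gt_1 q2 by simp
      also have "v = normal_form c P'" using const[of P P'] P P' by (simp add: v_def c)
      finally show "(\<Sum>i<q. \<Sum>j<q\<^sup>2. c' i j * cx P' ^ i * cy P' ^ j) = 0"
        by (simp add: c'_def normal_form_def P' left_diff_distrib sum_subtractf)
    qed
    then show "poly (c i j) z = 0" using ij(3) by (auto simp: c'_def)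
  qed
  have N: "fibre_norm a = zpoly (c 0 0)"
  proof
    fix P :: "'f gk_point"
    have "poly (c i j) (cz P) * cx P ^ i * cy P ^ j
        = (if j = 0 then (if i = 0 then poly (c 0 0) (cz P) else 0) else 0)"
      if "i < q" "j < q\<^sup>2" for i j
      using cz0[OF that] by auto
    then have "normal_form c P = (\<Sum>i<q. \<Sum>j<q\<^sup>2. if j = 0 then (if i = 0 then poly (c 0 0) (cz P) else 0) else 0)"
      unfolding normal_form_def by (intro sum.cong refl) simp
    also have "\<dots> = zpoly (c 0 0) P" using q_gt_1 q2 by (simp add: zpoly_apply)
    finally show "fibre_norm a P = zpoly (c 0 0) P" by (simp add: c)
  qed
  have "zpoly 0 = 0" by (simp add: fun_eq_iff fn_app zpoly_apply)
  then have nz: "c 0 0 \<noteq> 0" using has_weight_nonzero[OF lN] N by auto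
  have "Polynomial.degree (c 0 0) * q ^ 3 = q ^ 3 * w"
    using has_weight_unique[OF has_weight_zpoly[OF nz]] lN N by metis
  then have "Polynomial.degree (c 0 0) = w" using q_gt_1 by simp
  with N nz show thesis by (intro that)
qed

text \<open>The norm of \<open>a\<close> is a multiple of \<open>a\<close>, since the shift by the origin is the identity.\<close>

lemma multiple_poly:
  assumes "a \<in> A" "a \<noteq> 0"
  obtains b d where "b \<in> A" "d \<noteq> 0" "a * b = zpoly d"
proof -
  obtain w where w: "has_weight a w" using has_weight_exists[OF assms] by blast
  obtain d where d: "d \<noteq> 0" "fibre_norm a = zpoly d" using fibre_norm_poly[OF w] by blast
  obtain R0 where R0: "cx R0 = (0 :: 'f alg_closure)" "cy R0 = 0" "cz R0 = 0"
    using curve_point_exists[of 0 0 0] q_gt_1 N_pos by (auto simp: power_0_left)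
  then have RR: "R0 \<in> rational (q ^ 2)" using zero_z_iff by blast
  have "a \<circ> shift R0 = a" using shift[OF RR] R0 q_gt_1
    by (auto simp: fun_eq_iff power_0_left intro!: arg_cong[of _ _ a] gk_point_eqI)
  then have "fibre_norm a = a * (\<Prod>Q\<in>rational (q ^ 2) - {R0}. a \<circ> shift Q)"
    unfolding fibre_norm_def using prod.remove[OF finite_rational_q2 RR, of "\<lambda>Q. a \<circ> shift Q"] by simp
  moreover have "(\<Prod>Q\<in>rational (q ^ 2) - {R0}. a \<circ> shift Q) \<in> A"
    by (intro A_prod shift_A assms(1)) simp
  ultimately show thesis using d by (intro that[of "\<Prod>Q\<in>rational (q ^ 2) - {R0}. a \<circ> shift Q" d]) simp_all
qed

lemma z_minus_nonzero: "cz - cst c \<noteq> (0 :: 'f gk_fun)"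
  using zpoly_nonzero[of "[:- c, 1:]"] zpoly_linear by simp

lemma z_not_constant [simp]: "cz \<noteq> (cst c :: 'f gk_fun)"
  using z_minus_nonzero[of c] by auto

lemma z_minus_in_A [simp, intro]: "cz - cst c \<in> A" by (intro A_diff) auto

text \<open>Otherwise the factor \<open>(z - c) ^ order\<close> could be cancelled, leaving an equation whose right-hand side
  vanishes at \<open>P\<close> while the left-hand side does not.\<close>

lemma local_order_bound:
  assumes "e \<in> A" "B \<in> A" "e P \<noteq> 0" "d \<noteq> 0" "e * zpoly d = (cz - cst (cz P)) ^ n * B"
  shows "n \<le> Polynomial.order (cz P) d"
proof (rule ccontr)
  define k where "k = Polynomial.order (cz P) d"
  define t where "t = cz - cst (cz P)"
  assume "\<not> n \<le> Polynomial.order (cz P) d"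
  then have n: "n = k + Suc (n - k - 1)" by (simp add: k_def)
  obtain d1 where d1: "d = [:- cz P, 1:] ^ k * d1" "\<not> [:- cz P, 1:] dvd d1"
    using order_decomp[OF assms(4), of "cz P"] by (auto simp: k_def)
  have "t ^ k * (e * zpoly d1) = t ^ k * (t ^ Suc (n - k - 1) * B)"
  proof -
    have "e * zpoly d = t ^ k * (e * zpoly d1)"
      by (subst d1(1)) (simp add: zpoly_mult zpoly_power zpoly_linear t_def ac_simps)
    moreover have "t ^ n * B = t ^ k * (t ^ Suc (n - k - 1) * B)"
      by (subst n) (simp only: power_add mult.assoc)
    ultimately show ?thesis using assms(5) by (simp add: t_def)
  qed
  moreover have "t \<in> A" "t \<noteq> 0" by (simp_all add: t_def z_minus_nonzero)
  ultimately have "e * zpoly d1 = t ^ Suc (n - k - 1) * B"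
    using A_cancel[of "t ^ k" "e * zpoly d1" "t ^ Suc (n - k - 1) * B"] A_power_nonzero[of t k] assms(1,2)
    by (simp add: A_mult A_power)
  from fun_cong[OF this, of P] have "poly d1 (cz P) = 0"
    using assms(3) by (simp add: fn_app zpoly_apply t_def)
  then show False using d1(2) by (simp add: poly_eq_0_iff_dvd)
qed

text \<open>The function \<open>z - c\<close> is a local parameter at every point \<open>P\<close> over \<open>c\<close>. Let \<open>e\<close> be the indicator function
  of \<open>P\<close> on its fibre, written as a polynomial; then \<open>e * a\<close> vanishes on the whole fibre and is divisible by
  \<open>z - c\<close>.\<close>

lemma local_step:
  assumes "a \<in> A" "a P = 0"
  obtains e b where "e \<in> A" "e P \<noteq> 0" "b \<in> A" "e * a = (cz - cst (cz P)) * b"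
proof -
  \<comment> \<open>On the fibre \<open>y\<close> changes by elements of the field with \<open>q\<^sup>2\<close> elements, and for fixed \<open>y\<close> the coordinate \<open>x\<close> changes by roots of \<open>g ^ q + g\<close>.\<close>
  define e where "e = (1 - (cy - cst (cy P)) ^ (q\<^sup>2 - 1)) * (1 + (cx - cst (cx P)) ^ (q - 1))"
  have q2: "q\<^sup>2 > 1" using one_less_power[OF q_gt_1, of 2] by simp
  have eA: "e \<in> A" unfolding e_def by (intro A_mult A_diff A_add A_power) auto
  have eP: "e P \<noteq> 0" using q2 q_gt_1 by (simp add: e_def fn_app power_0_left)
  have "(e * a) P' = 0" if z: "cz P' = cz P" for P'
  proof (cases "P' = P")
    case True
    then show ?thesis using assms(2) by (simp add: fn_app)
  next
    case False
    have "e P' = 0"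
    proof (cases "cy P' = cy P")
      case y: False
      define b where "b = cy P' - cy P"
      have "cy P' ^ q\<^sup>2 - cy P' = cy P ^ q\<^sup>2 - cy P" using curve_z[of P] curve_z[of P'] z by simp
      then have "b ^ q\<^sup>2 = b" unfolding b_def frob_diff by (simp add: algebra_simps)
      moreover have "b ^ q\<^sup>2 = b * b ^ (q\<^sup>2 - 1)"
        using power_minus_mult[of "q\<^sup>2" b] q2 q_gt_1 by (simp add: mult.commute)
      moreover have "b \<noteq> 0" using y by (simp add: b_def)
      ultimately have "b ^ (q\<^sup>2 - 1) = 1" by simp
      then show ?thesis by (simp add: e_def fn_app b_def)
    next
      case y: True
      define g where "g = cx P' - cx P"
      have g0: "g \<noteq> 0" using False y z by (auto simp: g_def intro: gk_point_eqI)
      have "cx P' ^ q + cx P' = cx P ^ q + cx P" using curve_y[of P] curve_y[of P'] y by simp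
      then have "g ^ q + g = 0" unfolding g_def frob_diff1 by (simp add: algebra_simps)
      moreover have "g ^ q = g * g ^ (q - 1)"
        using power_minus_mult[of q g] q_gt_1 by (simp add: mult.commute)
      ultimately have "g * (1 + g ^ (q - 1)) = 0" by (simp add: algebra_simps)
      then have "1 + g ^ (q - 1) = 0" using g0 by simp
      then show ?thesis by (simp add: e_def fn_app g_def)
    qed
    then show ?thesis by (simp add: fn_app)
  qed
  moreover have "e * a \<in> A" using eA assms(1) by auto
  ultimately obtain b where "b \<in> A" "e * a = (cz - cst (cz P)) * b" using fibre_vanish_dvd by metis
  then show thesis using eA eP by (intro that)
qed

text \<open>If \<open>a\<close> has \<open>r\<close> zeros in a fibre and \<open>P\<close> is a point of it, then exactly \<open>r\<close> of the factors
  of the norm vanish at \<open>P\<close>, and each contributes a factor \<open>z - c\<close>.\<close>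

lemma zeros_in_fibre:
  assumes "has_weight a w" "fibre_norm a = zpoly d" "d \<noteq> 0"
  shows "card {P. cz P = z \<and> a P = 0} \<le> Polynomial.order z d"
proof (cases "{P. cz P = z \<and> a P = 0} = {}")
  case True
  show ?thesis unfolding True by simp
next
  case False
  then obtain P where P: "cz P = z" by auto
  have aA: "a \<in> A" using assms(1) has_weight_in_A by blast
  define R where "R = {Q \<in> rational (q ^ 2). a (shift Q P) = 0}"
  have fR: "finite R" using finite_rational_q2 by (simp add: R_def)
  have "bij_betw (\<lambda>Q. shift Q P) R {P'. cz P' = z \<and> a P' = 0}"
    using shift_fibre[of P] P unfolding bij_betw_def R_def inj_on_def by (auto simp: image_iff)
  then have card: "card {P'. cz P' = z \<and> a P' = 0} = card R" by (metis bij_betw_same_card)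
  have "\<exists>e b. e \<in> A \<and> e P \<noteq> 0 \<and> b \<in> A \<and> e * (a \<circ> shift Q) = (cz - cst z) * b" if QR: "Q \<in> R" for Q
  proof -
    have "a \<circ> shift Q \<in> A" "(a \<circ> shift Q) P = 0" using shift_A[OF _ aA] QR by (simp_all add: R_def)
    from local_step[OF this] show ?thesis unfolding P by blast
  qed
  then obtain e b where eb: "\<And>Q. Q \<in> R \<Longrightarrow> e Q \<in> A \<and> e Q P \<noteq> 0 \<and> b Q \<in> A \<and> e Q * (a \<circ> shift Q) = (cz - cst z) * b Q"
    by metis
  define E where "E = (\<Prod>Q\<in>R. e Q)"
  define B where "B = (\<Prod>Q\<in>R. b Q) * (\<Prod>Q\<in>rational (q ^ 2) - R. a \<circ> shift Q)"
  have "E * (\<Prod>Q\<in>R. a \<circ> shift Q) = (cz - cst z) ^ card R * (\<Prod>Q\<in>R. b Q)"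
    unfolding E_def prod.distrib[symmetric] using eb by (simp add: prod.distrib)
  moreover have "fibre_norm a = (\<Prod>Q\<in>R. a \<circ> shift Q) * (\<Prod>Q\<in>rational (q ^ 2) - R. a \<circ> shift Q)"
    unfolding fibre_norm_def by (rule prod.subset_diff[OF _ finite_rational_q2, THEN trans]) (auto simp: R_def ac_simps)
  ultimately have "E * zpoly d = (cz - cst (cz P)) ^ card R * B"
    unfolding assms(2)[symmetric] B_def P by (simp add: mult.assoc[symmetric])
  moreover have "E \<in> A" unfolding E_def using eb by (intro A_prod) auto
  moreover have "E P \<noteq> 0" unfolding E_def using eb fR by (simp add: fn_app)
  moreover have "B \<in> A" unfolding B_def using eb shift_A[OF _ aA] by (intro A_mult A_prod) auto
  ultimately show ?thesis using local_order_bound[of E B P d "card R"] assms(3) card P by simp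
qed

lemma fibre_finite: "finite {P :: 'f gk_point. cz P = z \<and> p P}"
proof (cases "\<exists>P :: 'f gk_point. cz P = z")
  case True
  then obtain P :: "'f gk_point" where "cz P = z" by blast
  then have "finite {P :: 'f gk_point. cz P = z}"
    using bij_betw_finite[OF shift_fibre[of P]] finite_rational_q2 by simp
  then show ?thesis by (rule rev_finite_subset) auto
qed auto

theorem zeros_le_weight:
  assumes "has_weight a w"
  shows "finite {P. a P = 0}" "card {P. a P = 0} \<le> w"
proof -
  obtain d where d: "d \<noteq> 0" "fibre_norm a = zpoly d" "Polynomial.degree d = w" using fibre_norm_poly[OF assms] by blast
  have a0: "poly d (cz P) = 0" if "a P = 0" for P
  proof -
    have "P \<in> (\<lambda>Q. shift Q P) ` rational (q ^ 2)" using shift_fibre[of P] by (simp add: bij_betw_def)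
    then obtain Q where "Q \<in> rational (q ^ 2)" "shift Q P = P" by auto
    then have "fibre_norm a P = 0" unfolding fibre_norm_def fn_app using finite_rational_q2 that
      by (intro prod_zero bexI[of _ Q]) auto
    then show ?thesis by (simp add: d(2) zpoly_apply)
  qed
  define Z where "Z = {z. poly d z = 0}"
  have fZ: "finite Z" unfolding Z_def by (rule poly_roots_finite[OF d(1)])
  have eq: "{P. a P = 0} = (\<Union>z\<in>Z. {P. cz P = z \<and> a P = 0})" using a0 by (auto simp: Z_def)
  show "finite {P. a P = 0}" unfolding eq by (intro finite_UN_I fZ fibre_finite)
  have "card {P. a P = 0} \<le> (\<Sum>z\<in>Z. card {P. cz P = z \<and> a P = 0})"
    unfolding eq by (rule card_UN_le[OF fZ])
  also have "\<dots> \<le> (\<Sum>z\<in>Z. Polynomial.order z d)"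
    by (intro sum_mono zeros_in_fibre[OF assms d(2,1)])
  also have "\<dots> = size (proots d)"
    using d(1) by (simp add: size_multiset_overloaded_eq Z_def)
  also have "\<dots> \<le> w" using size_proots_le[of d] d(3) by simp
  finally show "card {P. a P = 0} \<le> w" .
qed

text \<open>The hypothesis says that \<open>a / d(z)\<close> is regular at every point. At a root \<open>c\<close> of \<open>d\<close> it forces \<open>a\<close> to
  vanish on the fibre over \<open>c\<close>, so a linear factor can be removed from both.\<close>

lemma regular_imp_polynomial:
  assumes "a \<in> A" "d \<noteq> 0"
    and "\<And>P. \<exists>e s. e \<in> A \<and> s \<in> A \<and> e P \<noteq> 0 \<and> e * a = s * zpoly d"
  shows "\<exists>b\<in>A. a = b * zpoly d"
  using assms
proof (induction "Polynomial.degree d" arbitrary: a d rule: less_induct)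
  case less
  show ?case
  proof (cases "Polynomial.degree d = 0")
    case True
    then obtain c where c: "d = [:c:]" by (metis degree_eq_zeroE)
    then have "c \<noteq> 0" using less.prems(2) by auto
    then have "a = (cst (inverse c) * a) * zpoly d" by (simp add: c fun_eq_iff fn_app zpoly_apply)
    moreover have "cst (inverse c) * a \<in> A" using less.prems(1) by auto
    ultimately show ?thesis by blast
  next
    case False
    then obtain z where z: "poly d z = 0" using alg_closed_imp_poly_has_root[of d] by auto
    then obtain d' where d': "d = [:- z, 1:] * d'" by (auto simp: poly_eq_0_iff_dvd)
    have d'0: "d' \<noteq> 0" using less.prems(2) d' by auto
    have deg: "Polynomial.degree d' < Polynomial.degree d" using d'0 unfolding d' by (subst degree_mult_eq) auto
    have pd: "zpoly d = (cz - cst z) * zpoly d'" unfolding d' zpoly_mult zpoly_linear ..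
    have "a P = 0" if "cz P = z" for P
    proof -
      obtain e s where "e P \<noteq> 0" "e * a = s * zpoly d" using less.prems(3)[of P] by blast
      from fun_cong[OF this(2), of P] this(1) show ?thesis using z that by (simp add: fn_app zpoly_apply)
    qed
    from fibre_vanish_dvd[OF less.prems(1) this] obtain a' where a': "a' \<in> A" "a = (cz - cst z) * a'" by blast
    have "\<exists>e s. e \<in> A \<and> s \<in> A \<and> e P \<noteq> 0 \<and> e * a' = s * zpoly d'" for P
    proof -
      obtain e s where es: "e \<in> A" "s \<in> A" "e P \<noteq> 0" "e * a = s * zpoly d" using less.prems(3)[of P] by blast
      have eq: "(cz - cst z) * (e * a') = (cz - cst z) * (s * zpoly d')"
        using es(4) unfolding a'(2) pd by (simp add: ac_simps)
      then have "e * a' = s * zpoly d'"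
        using A_cancel[OF z_minus_in_A _ _ z_minus_nonzero eq] es a'(1) by (simp add: A_mult)
      then show ?thesis using es by blast
    qed
    from less.hyps[OF deg a'(1) d'0 this] obtain b where "b \<in> A" "a' = b * zpoly d'" by blast
    then show ?thesis unfolding a'(2) pd by (auto simp: ac_simps)
  qed
qed

subsection \<open>Orders at affine points\<close>

text \<open>The local ring at \<open>P\<close> is not formed; its units appear as quotients of elements of \<open>A\<close> that do not
  vanish at \<open>P\<close>, with denominators cleared.\<close>

definition has_ord :: "'f gk_point \<Rightarrow> 'f gk_fun \<Rightarrow> nat \<Rightarrow> bool" where
  "has_ord P a n \<longleftrightarrow> (\<exists>e\<in>A. \<exists>b\<in>A. e P \<noteq> 0 \<and> b P \<noteq> 0 \<and> e * a = (cz - cst (cz P)) ^ n * b)"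

text \<open>A multiple of \<open>a\<close> is a polynomial in \<open>z\<close>, whose multiplicity at \<open>c\<close> bounds the powers of \<open>z - c\<close> that
  can be split off. For the largest power the cofactor does not vanish, by \<open>local_step\<close>.\<close>

lemma has_ord_exists: assumes "a \<in> A" "a \<noteq> 0" shows "\<exists>n. has_ord P a n"
proof -
  define t where "t = cz - cst (cz P)"
  define S where "S = {n. \<exists>e\<in>A. \<exists>b\<in>A. e P \<noteq> 0 \<and> e * a = t ^ n * b}"
  obtain a' d where a': "a' \<in> A" "d \<noteq> 0" "a * a' = zpoly d" using multiple_poly[OF assms] by blast
  have "n \<le> Polynomial.order (cz P) d" if "n \<in> S" for n
  proof -
    obtain e b where eb: "e \<in> A" "b \<in> A" "e P \<noteq> 0" "e * a = t ^ n * b" using \<open>n \<in> S\<close> by (auto simp: S_def)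
    have "e * zpoly d = t ^ n * (b * a')" unfolding a'(3)[symmetric] using eb(4) by (simp add: mult.assoc[symmetric])
    then show ?thesis using eb a' unfolding t_def by (intro local_order_bound[of e "b * a'" P d n]) auto
  qed
  then have fS: "finite S" by (meson finite_nat_set_iff_bounded_le)
  have "0 \<in> S" unfolding S_def mem_Collect_eq
    by (rule bexI[of _ 1], rule bexI[of _ a]) (use assms(1) in \<open>auto simp: fn_app\<close>)
  then have "Max S \<in> S" using fS by (intro Max_in) auto
  then obtain e b where eb: "e \<in> A" "b \<in> A" "e P \<noteq> 0" "e * a = t ^ Max S * b" by (auto simp: S_def)
  have "b P \<noteq> 0"
  proof
    assume "b P = 0"
    then obtain e' b' where eb': "e' \<in> A" "e' P \<noteq> 0" "b' \<in> A" "e' * b = t * b'"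
      using local_step[OF eb(2), of P] unfolding t_def by blast
    have "(e' * e) * a = t ^ Suc (Max S) * b'"
    proof -
      have "(e' * e) * a = e' * (e * a)" by (simp only: mult.assoc)
      also have "\<dots> = t ^ Max S * (e' * b)" unfolding eb(4) by (simp only: ac_simps)
      finally show ?thesis unfolding eb'(4) by (simp add: ac_simps)
    qed
    then have "Suc (Max S) \<in> S" unfolding S_def mem_Collect_eq
      by (intro bexI[of _ "e' * e"] bexI[of _ b']) (use eb eb' in \<open>auto simp: fn_app\<close>)
    then show False using Max_ge[OF fS] by fastforce
  qed
  then show ?thesis unfolding has_ord_def using eb t_def by blast
qed

lemma has_ord_mult: assumes "has_ord P a n" "has_ord P b m" shows "has_ord P (a * b) (n + m)"
proof -
  define t where "t = cz - cst (cz P)"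
  obtain e u where 1: "e \<in> A" "u \<in> A" "e P \<noteq> 0" "u P \<noteq> 0" "e * a = t ^ n * u"
    using assms(1) by (auto simp: has_ord_def t_def)
  obtain e' u' where 2: "e' \<in> A" "u' \<in> A" "e' P \<noteq> 0" "u' P \<noteq> 0" "e' * b = t ^ m * u'"
    using assms(2) by (auto simp: has_ord_def t_def)
  have "(e * e') * (a * b) = (e * a) * (e' * b)" by (simp add: ac_simps)
  also have "\<dots> = t ^ (n + m) * (u * u')" unfolding 1 2 by (simp add: power_add ac_simps)
  finally show ?thesis unfolding has_ord_def t_def[symmetric] using 1 2
    by (intro bexI[of _ "e * e'"] bexI[of _ "u * u'"]) (auto simp: fn_app)
qed

lemma has_ord_le: assumes "has_ord P a n" "has_ord P a m" shows "n \<le> m"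
proof (rule ccontr)
  assume "\<not> n \<le> m"
  then have n: "n = m + Suc (n - m - 1)" by simp
  define t where "t = cz - cst (cz P)"
  obtain e u where 1: "e \<in> A" "u \<in> A" "e P \<noteq> 0" "u P \<noteq> 0" "e * a = t ^ n * u"
    using assms(1) by (auto simp: has_ord_def t_def)
  obtain e' u' where 2: "e' \<in> A" "u' \<in> A" "e' P \<noteq> 0" "u' P \<noteq> 0" "e' * a = t ^ m * u'"
    using assms(2) by (auto simp: has_ord_def t_def)
  have tA: "t \<in> A" "t \<noteq> 0" by (simp_all add: t_def z_minus_nonzero)
  have "e' * (e * a) = e * (e' * a)" by (simp add: ac_simps)
  then have "t ^ n * (e' * u) = t ^ m * (e * u')" unfolding 1 2 by (simp add: ac_simps)
  then have eq: "t ^ m * (t ^ Suc (n - m - 1) * (e' * u)) = t ^ m * (e * u')"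
    by (subst (asm) n) (simp only: power_add mult.assoc)
  have "t ^ m \<in> A" "t ^ Suc (n - m - 1) * (e' * u) \<in> A" "e * u' \<in> A" "t ^ m \<noteq> 0"
    using 1(1,2) 2(1,2) tA by (simp_all only: A_mult A_power A_power_nonzero not_False_eq_True)
  from A_cancel[OF this eq] have "t ^ Suc (n - m - 1) * (e' * u) = e * u'" .
  from fun_cong[OF this, of P] show False using 1 2 by (simp add: fn_app t_def)
qed

lemma has_ord_unique: "has_ord P a n \<Longrightarrow> has_ord P a m \<Longrightarrow> n = m"
  using has_ord_le by (simp add: antisym)

definition ord_at :: "'f gk_point \<Rightarrow> 'f gk_fun \<Rightarrow> nat" where "ord_at P a = (THE n. has_ord P a n)"

lemma ord_at_eqI: "has_ord P a n \<Longrightarrow> ord_at P a = n"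
  unfolding ord_at_def using has_ord_unique by blast

lemma has_ord_ord_at: "a \<in> A \<Longrightarrow> a \<noteq> 0 \<Longrightarrow> has_ord P a (ord_at P a)"
  using has_ord_exists ord_at_eqI by metis

lemma ord_at_mult: "a \<in> A \<Longrightarrow> a \<noteq> 0 \<Longrightarrow> b \<in> A \<Longrightarrow> b \<noteq> 0 \<Longrightarrow> ord_at P (a * b) = ord_at P a + ord_at P b"
  by (intro ord_at_eqI has_ord_mult has_ord_ord_at)

lemma ord_at_zero_iff: assumes "a \<in> A" "a \<noteq> 0" shows "ord_at P a = 0 \<longleftrightarrow> a P \<noteq> 0"
proof
  assume "ord_at P a = 0"
  then obtain e b where "e P \<noteq> 0" "b P \<noteq> 0" "e * a = b"
    using has_ord_ord_at[OF assms, of P] by (auto simp: has_ord_def)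
  then show "a P \<noteq> 0" by (auto simp: fn_app)
next
  assume "a P \<noteq> 0"
  then have "has_ord P a 0" unfolding has_ord_def using assms(1)
    by (intro bexI[of _ 1] bexI[of _ a]) (auto simp: fn_app)
  then show "ord_at P a = 0" by (rule ord_at_eqI)
qed

lemma ord_at_z: "ord_at P (cz - cst (cz P)) = 1"
  by (rule ord_at_eqI, unfold has_ord_def, rule bexI[of _ 1], rule bexI[of _ 1]) (auto simp: fn_app)

text \<open>A quotient of non-negative order has a representation whose denominator \<open>e\<close> does not vanish at \<open>P\<close>.\<close>

lemma local_quotient:
  assumes "a \<in> A" "b \<in> A" "a \<noteq> 0" "b \<noteq> 0" "ord_at P b \<le> ord_at P a"
  obtains e s where "e \<in> A" "s \<in> A" "e P \<noteq> 0" "e * a = s * b"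
proof -
  define t where "t = cz - cst (cz P)"
  obtain e u where 1: "e \<in> A" "u \<in> A" "e P \<noteq> 0" "u P \<noteq> 0" "e * a = t ^ ord_at P a * u"
    using has_ord_ord_at[OF assms(1,3), of P] by (auto simp: has_ord_def t_def)
  obtain e' u' where 2: "e' \<in> A" "u' \<in> A" "e' P \<noteq> 0" "u' P \<noteq> 0" "e' * b = t ^ ord_at P b * u'"
    using has_ord_ord_at[OF assms(2,4), of P] by (auto simp: has_ord_def t_def)
  have tt: "t ^ ord_at P a = t ^ (ord_at P a - ord_at P b) * t ^ ord_at P b"
    using assms(5) by (simp flip: power_add)
  have "(e * u') * a = u' * (e * a)" by (simp only: ac_simps)
  also have "\<dots> = (t ^ (ord_at P a - ord_at P b) * u) * (t ^ ord_at P b * u')"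
    unfolding 1(5) tt by (simp only: ac_simps)
  also have "\<dots> = (t ^ (ord_at P a - ord_at P b) * u * e') * b"
    unfolding 2(5)[symmetric] by (simp only: ac_simps)
  finally have "(e * u') * a = (t ^ (ord_at P a - ord_at P b) * u * e') * b" .
  moreover have "t \<in> A" by (simp add: t_def)
  ultimately show thesis using 1 2 by (intro that[of "e * u'" "t ^ (ord_at P a - ord_at P b) * u * e'"]) (auto simp: fn_app)
qed

end

section \<open>Multivariate polynomials\<close>

abbreviation "lkp \<equiv> Poly_Mapping.lookup"
abbreviation "keyset \<equiv> Poly_Mapping.keys"

definition mval :: "('n::finite \<Rightarrow>\<^sub>0 nat) \<Rightarrow> 'a::comm_semiring_1 ^ 'n \<Rightarrow> 'a" where
  "mval e v = (\<Prod>i\<in>UNIV. v $ i ^ lkp e i)"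

definition mdeg :: "('n::finite \<Rightarrow>\<^sub>0 nat) \<Rightarrow> nat" where "mdeg e = (\<Sum>i\<in>UNIV. lkp e i)"

lemma mval_add: "mval (e + e') v = mval e v * mval e' v"
  by (simp add: mval_def lookup_add power_add prod.distrib)

lemma mval_0 [simp]: "mval 0 v = 1" by (simp add: mval_def)

lemma mdeg_0 [simp]: "mdeg 0 = 0" by (simp add: mdeg_def)

lemma mval_single: "mval (Poly_Mapping.single i n) v = v $ i ^ n"
proof -
  have "(\<Prod>j\<in>UNIV. v $ j ^ (n when i = j)) = (\<Prod>j\<in>UNIV. if i = j then v $ j ^ n else 1)"
    by (intro prod.cong refl) (simp add: when_def)
  then show ?thesis by (simp add: mval_def lookup_single)
qed

lemma mdeg_single: "mdeg (Poly_Mapping.single i n) = n"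
  by (simp add: mdeg_def lookup_single when_def)

lemma mval_scale: "mval e (c *s v) = c ^ mdeg e * mval e v"
  by (simp add: mval_def mdeg_def power_mult_distrib prod.distrib power_sum)

lemma poly_value_superset:
  assumes "finite S" "keyset g \<subseteq> S"
  shows "poly_value g v = (\<Sum>e\<in>S. lkp g e * mval e v)"
  unfolding poly_value_def mval_def[symmetric]
  by (rule sum.mono_neutral_left) (use assms in \<open>auto simp: in_keys_iff\<close>)

lemma poly_value_keys: "poly_value g v = (\<Sum>e\<in>keyset g. lkp g e * mval e v)"
  by (rule poly_value_superset) auto

lemma poly_value_0 [simp]: "poly_value 0 v = 0" by (simp add: poly_value_keys)

lemma poly_value_single: "poly_value (Poly_Mapping.single e c) v = c * mval e v"
  by (subst poly_value_superset[of "{e}"]) auto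

lemma poly_value_1 [simp]: "poly_value 1 v = 1"
  using poly_value_single[of 0 1 v] by simp

lemma poly_value_add: "poly_value (g + h) v = poly_value g v + poly_value h v"
proof -
  let ?S = "keyset g \<union> keyset h"
  have "keyset (g + h) \<subseteq> ?S" by (rule keys_add)
  then show ?thesis
    by (simp add: poly_value_superset[of ?S] lookup_add sum.distrib distrib_right)
qed

lemma poly_value_minus: "poly_value (- g) v = - poly_value g v" for g :: "('n::finite, 'a::comm_ring_1) mpoly"
  by (simp add: poly_value_keys sum_negf)

lemma poly_value_diff: "poly_value (g - h) v = poly_value g v - poly_value h v"
  for g :: "('n::finite, 'a::comm_ring_1) mpoly"
  using poly_value_add[of g "- h" v] by (simp add: poly_value_minus)

lemma poly_value_sum: "poly_value (\<Sum>i\<in>I. f i) v = (\<Sum>i\<in>I. poly_value (f i) v)"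
  by (induction I rule: infinite_finite_induct) (auto simp: poly_value_add)

lemma mpoly_expand: "g = (\<Sum>e\<in>keyset g. Poly_Mapping.single e (lkp g e))"
proof (rule poly_mapping_eqI)
  fix e
  have "lkp (\<Sum>e\<in>keyset g. Poly_Mapping.single e (lkp g e)) e = (\<Sum>e'\<in>keyset g. if e' = e then lkp g e' else 0)"
    by (simp add: lookup_sum lookup_single when_def)
  also have "\<dots> = lkp g e" by (simp add: in_keys_iff)
  finally show "lkp g e = lkp (\<Sum>e\<in>keyset g. Poly_Mapping.single e (lkp g e)) e" by simp
qed

lemma poly_value_mult: "poly_value (g * h) v = poly_value g v * poly_value h v"
proof -
  have "g * h = (\<Sum>e\<in>keyset g. \<Sum>e'\<in>keyset h. Poly_Mapping.single (e + e') (lkp g e * lkp h e'))"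
    by (subst (1) mpoly_expand[of g], subst (1) mpoly_expand[of h]) (simp add: sum_product mult_single)
  then have "poly_value (g * h) v = (\<Sum>e\<in>keyset g. \<Sum>e'\<in>keyset h. (lkp g e * mval e v) * (lkp h e' * mval e' v))"
    by (simp add: poly_value_sum poly_value_single mval_add ac_simps)
  then show ?thesis by (simp add: poly_value_keys sum_product)
qed

lemma poly_value_power: "poly_value (g ^ n) v = poly_value g v ^ n"
  by (induction n) (auto simp: poly_value_mult)

lemma homogeneous_iff: "homogeneous d g \<longleftrightarrow> (\<forall>e. lkp g e \<noteq> 0 \<longrightarrow> mdeg e = d)"
  by (auto simp: homogeneous_def mdeg_def in_keys_iff)

lemma homogeneous_0: "homogeneous d 0" by (simp add: homogeneous_iff)

lemma homogeneous_single: "mdeg e = d \<Longrightarrow> homogeneous d (Poly_Mapping.single e c)"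
  by (auto simp: homogeneous_iff lookup_single when_def)

lemma homogeneous_1: "homogeneous 0 1"
  by (simp add: homogeneous_iff lookup_one when_def)

lemma homogeneous_add: "homogeneous d g \<Longrightarrow> homogeneous d h \<Longrightarrow> homogeneous d (g + h)"
  unfolding homogeneous_iff lookup_add by (metis add.right_neutral)

lemma homogeneous_minus: "homogeneous d g \<Longrightarrow> homogeneous d (- g)"
  for g :: "('n::finite, 'a::comm_ring_1) mpoly"
  by (simp add: homogeneous_iff)

lemma homogeneous_diff: "homogeneous d g \<Longrightarrow> homogeneous d h \<Longrightarrow> homogeneous d (g - h)"
  for g :: "('n::finite, 'a::comm_ring_1) mpoly"
  using homogeneous_add[of d g "- h"] homogeneous_minus[of d h] by simp

lemma homogeneous_mult: "homogeneous d g \<Longrightarrow> homogeneous e h \<Longrightarrow> homogeneous (d + e) (g * h)"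
  unfolding homogeneous_def using keys_mult[of g h]
  by (auto simp: lookup_add sum.distrib subset_iff)

lemma homogeneous_power: "homogeneous d g \<Longrightarrow> homogeneous (n * d) (g ^ n)"
  by (induction n) (auto simp: homogeneous_1 homogeneous_mult)

lemma poly_value_scale:
  assumes "homogeneous d g" shows "poly_value g (c *s v) = c ^ d * poly_value g v"
proof -
  have "lkp g e * mval e (c *s v) = c ^ d * (lkp g e * mval e v)" if "e \<in> keyset g" for e
    using assms that by (simp add: homogeneous_iff in_keys_iff mval_scale ac_simps)
  then show ?thesis by (simp add: poly_value_keys sum_distrib_left)
qed

lemma vanishes_at_proj_point:
  assumes "homogeneous d g"
  shows "vanishes_at g (proj_point v) \<longleftrightarrow> poly_value g v = 0"
proof
  assume "vanishes_at g (proj_point v)"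
  moreover have "v \<in> proj_point v" unfolding proj_point_def
    by (rule CollectI, rule exI[of _ 1]) simp
  ultimately show "poly_value g v = 0" by (simp add: vanishes_at_def)
qed (auto simp: vanishes_at_def proj_point_def poly_value_scale[OF assms])

lemma proj_point_scale: assumes "c \<noteq> 0" shows "proj_point (c *s v) = proj_point v"
proof -
  have "\<exists>d. b *s v = d *s (c *s v) \<and> d \<noteq> 0" if "b \<noteq> 0" for b
    using that assms by (intro exI[of _ "b / c"]) (simp add: vector_smult_assoc)
  moreover have "\<exists>d. b *s (c *s v) = d *s v \<and> d \<noteq> 0" if "b \<noteq> 0" for b
    using that assms by (intro exI[of _ "b * c"]) (simp add: vector_smult_assoc)
  ultimately show ?thesis unfolding proj_point_def by blast
qed

lemma mem_proj_point: "v \<in> proj_point v"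
  unfolding proj_point_def by (rule CollectI, rule exI[of _ 1]) simp

lemma vec4_nth [simp]:
  fixes a b c d :: "'a::zero"
  shows "vec_nth (vector [a, b, c, d] :: 'a ^ 4) 1 = a"
    "vec_nth (vector [a, b, c, d] :: 'a ^ 4) 2 = b"
    "vec_nth (vector [a, b, c, d] :: 'a ^ 4) 3 = c"
    "vec_nth (vector [a, b, c, d] :: 'a ^ 4) 4 = d"
  unfolding vector_def by simp_all

lemma mval_4: "mval e v = v $ 1 ^ lkp e 1 * v $ 2 ^ lkp e 2 * v $ 3 ^ lkp e 3 * v $ (4::4) ^ lkp e 4"
  unfolding mval_def UNIV_4 by (simp add: ac_simps)

lemma mdeg_4: "mdeg e = lkp e 1 + lkp e 2 + lkp e 3 + lkp e (4::4)"
  unfolding mdeg_def by (rule sum_4)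

definition mvar :: "'n \<Rightarrow> ('n, 'a::comm_ring_1) mpoly" where
  "mvar i = Poly_Mapping.single (Poly_Mapping.single i 1) 1"

definition mconst :: "'a \<Rightarrow> ('n, 'a::comm_ring_1) mpoly" where
  "mconst c = Poly_Mapping.single 0 c"

lemma poly_value_mvar [simp]: "poly_value (mvar i) v = v $ i"
  by (simp add: mvar_def poly_value_single mval_single)

lemma poly_value_mconst [simp]: "poly_value (mconst c) v = c"
  by (simp add: mconst_def poly_value_single)

lemma homogeneous_mvar: "homogeneous 1 (mvar i)"
  unfolding mvar_def by (intro homogeneous_single mdeg_single)

lemma homogeneous_mconst: "homogeneous 0 (mconst c)"
  unfolding mconst_def by (intro homogeneous_single mdeg_0)

section \<open>Homogeneous forms on the curve\<close>

context gk
begin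

definition cvec :: "'f gk_point \<Rightarrow> 'f alg_closure ^ 4" where
  "cvec P = vector [cx P, cy P, cz P, 1]"

definition ivec :: "'f alg_closure ^ 4" where "ivec = vector [1, 0, 0, 0]"

text \<open>Dehomogenisation: the value of a form at the coordinate vectors \<open>(x, y, z, 1)\<close>.\<close>

definition dehom :: "(4, 'f alg_closure) mpoly \<Rightarrow> 'f gk_fun" where
  "dehom g = (\<lambda>P. poly_value g (cvec P))"

lemma dehom_apply: "dehom g P = poly_value g (cvec P)" by (simp add: dehom_def)

lemma dehom_simps:
  "dehom (g + h) = dehom g + dehom h" "dehom (g - h) = dehom g - dehom h" "dehom (g * h) = dehom g * dehom h"
  "dehom (g ^ n) = dehom g ^ n" "dehom 0 = 0" "dehom 1 = 1" "dehom (mconst c) = cst c"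
  "dehom (mvar 1) = cx" "dehom (mvar 2) = cy" "dehom (mvar 3) = cz" "dehom (mvar 4) = 1"
  by (simp_all add: fun_eq_iff fn_app dehom_def poly_value_add poly_value_diff poly_value_mult
      poly_value_power cvec_def)

definition forms :: "nat \<Rightarrow> 'f gk_fun set" where
  "forms d = {dehom g | g. homogeneous d g}"

lemma formsI: "homogeneous d g \<Longrightarrow> dehom g \<in> forms d" by (auto simp: forms_def)

lemma forms_add: "a \<in> forms d \<Longrightarrow> b \<in> forms d \<Longrightarrow> a + b \<in> forms d"
  unfolding forms_def by (auto simp: dehom_simps(1)[symmetric] intro: homogeneous_add)

lemma forms_diff: "a \<in> forms d \<Longrightarrow> b \<in> forms d \<Longrightarrow> a - b \<in> forms d"
  unfolding forms_def by (auto simp: dehom_simps(2)[symmetric] intro: homogeneous_diff)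

lemma forms_mult: "a \<in> forms d \<Longrightarrow> b \<in> forms e \<Longrightarrow> a * b \<in> forms (d + e)"
  unfolding forms_def by (auto simp: dehom_simps(3)[symmetric] intro: homogeneous_mult)

lemma forms_power: "a \<in> forms d \<Longrightarrow> a ^ n \<in> forms (n * d)"
  unfolding forms_def by (auto simp: dehom_simps(4)[symmetric] intro: homogeneous_power)

lemma forms_basic: "0 \<in> forms d" "1 \<in> forms 0" "cst c \<in> forms 0" "cx \<in> forms 1" "cy \<in> forms 1"
  "cz \<in> forms 1" "1 \<in> forms 1"
  using formsI[OF homogeneous_0] formsI[OF homogeneous_1] formsI[OF homogeneous_mconst[of c]]
    formsI[OF homogeneous_mvar[of 1]] formsI[OF homogeneous_mvar[of 2]]
    formsI[OF homogeneous_mvar[of 3]] formsI[OF homogeneous_mvar[of 4]]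
  by (simp_all add: dehom_simps)

text \<open>Multiplying a form by powers of the fourth variable does not change the function.\<close>

lemma forms_mono: assumes "a \<in> forms d" "d \<le> e" shows "a \<in> forms e"
  using forms_mult[OF assms(1) forms_power[OF forms_basic(7), of "e - d"]] assms(2) by simp

lemma forms_cmult: "a \<in> forms d \<Longrightarrow> cst c * a \<in> forms d"
  using forms_mult[OF forms_basic(3)] by fastforce

lemma forms_sum: "(\<And>i. i \<in> I \<Longrightarrow> f i \<in> forms d) \<Longrightarrow> (\<Sum>i\<in>I. f i) \<in> forms d"
  by (induction I rule: infinite_finite_induct) (auto intro: forms_add forms_basic(1))

lemma forms_mon: assumes "i + j + l \<le> d" shows "mon i j l \<in> forms d"
proof -
  have "mon i j l \<in> forms (i * 1 + j * 1 + l * 1)"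
    unfolding mon_def by (intro forms_mult forms_power forms_basic)
  then show ?thesis using forms_mono assms by simp
qed

lemma dehom_sum:
  "dehom g = (\<Sum>e\<in>keyset g. cst (lkp g e) * mon (lkp e 1) (lkp e 2) (lkp e 3))"
  by (simp add: fun_eq_iff fn_app dehom_apply poly_value_keys mval_4 cvec_def mon_apply)

lemma forms_in_A: "a \<in> forms d \<Longrightarrow> a \<in> A"
  unfolding forms_def by (auto simp: dehom_sum intro!: A_sum A_mult A_cst A_mon)

lemma A_in_forms: assumes "a \<in> A" shows "\<exists>d. a \<in> forms d"
proof -
  obtain w where "a \<in> below w" using assms by (auto simp: A_def)
  then show ?thesis
  proof (induction rule: below_induct)
    case zero
    show ?case using forms_basic(1) by blast
  next
    case (step a i j l c)
    then obtain d where "a \<in> forms d" by blast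
    then have "a \<in> forms (d + (i + j + l))" by (rule forms_mono) simp
    moreover have "cst c * mon i j l \<in> forms (d + (i + j + l))" by (intro forms_cmult forms_mon) simp
    ultimately show ?case using forms_add by blast
  qed
qed

subsection \<open>The point at infinity\<close>

lemma mval_ivec: "mval e ivec = (if lkp e 2 = 0 \<and> lkp e 3 = 0 \<and> lkp e 4 = 0 then 1 else 0)"
  by (auto simp: mval_4 ivec_def)

text \<open>Among \<open>x\<close>, \<open>y\<close>, \<open>z\<close> and \<open>1\<close> the heaviest is \<open>x\<close>, so \<open>x ^ d\<close> is the only monomial of degree \<open>d\<close>
  that attains the largest weight.\<close>

lemma mon_weight_le_degree:
  assumes "i + j + l + t = d" "\<not> (j = 0 \<and> l = 0 \<and> t = 0)"
  shows "mon_weight i j l < d * (q ^ 3 + 1)"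
proof -
  have y: "q * N < q ^ 3 + 1" using mon_weight_relations(5) by (simp add: mon_weight_def)
  have "j * (q * N) \<le> j * (q ^ 3 + 1)" "l * q ^ 3 \<le> l * (q ^ 3 + 1)"
    by (rule mult_le_mono2, use y in simp)+
  moreover have "j * (q * N) < j * (q ^ 3 + 1) \<or> l * q ^ 3 < l * (q ^ 3 + 1) \<or> 0 < t * (q ^ 3 + 1)"
  proof -
    have "j > 0 \<or> l > 0 \<or> t > 0" using assms(2) by auto
    moreover have "l * q ^ 3 < l * (q ^ 3 + 1)" if "l > 0" using that by simp
    moreover have "0 < t * (q ^ 3 + 1)" if "t > 0" using that by simp
    ultimately show ?thesis using mult_less_mono2[OF y, of j] by (elim disjE) simp_all
  qed
  moreover have "d * (q ^ 3 + 1) = i * (q ^ 3 + 1) + j * (q ^ 3 + 1) + l * (q ^ 3 + 1) + t * (q ^ 3 + 1)"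
    unfolding assms(1)[symmetric] by (simp only: distrib_right)
  ultimately show ?thesis unfolding mon_weight_def by linarith
qed

lemma below_sum: "(\<And>i. i \<in> I \<Longrightarrow> f i \<in> below w) \<Longrightarrow> (\<Sum>i\<in>I. f i) \<in> below w"
  by (induction I rule: infinite_finite_induct) (auto intro: below_add below_zero)

lemma value_at_infinity_below:
  assumes "homogeneous d g"
  shows "dehom g - cst (poly_value g ivec) * mon d 0 0 \<in> below (d * (q ^ 3 + 1))"
proof -
  define t where "t = (\<lambda>e. cst (lkp g e) * (mon (lkp e 1) (lkp e 2) (lkp e 3) - cst (mval e ivec) * mon d 0 0))"
  have "cst (poly_value g ivec) = (\<Sum>e\<in>keyset g. cst (lkp g e) * cst (mval e ivec))"
    by (simp add: fun_eq_iff fn_app poly_value_keys)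
  then have "dehom g - cst (poly_value g ivec) * mon d 0 0 = (\<Sum>e\<in>keyset g. t e)"
    unfolding dehom_sum t_def by (simp add: sum_distrib_right right_diff_distrib sum_subtractf mult.assoc)
  moreover have "t e \<in> below (d * (q ^ 3 + 1))" if "e \<in> keyset g" for e
  proof -
    have deg: "lkp e 1 + lkp e 2 + lkp e 3 + lkp e 4 = d"
      using assms that by (simp add: homogeneous_iff in_keys_iff mdeg_4)
    show ?thesis
    proof (cases "lkp e 2 = 0 \<and> lkp e 3 = 0 \<and> lkp e 4 = 0")
      case True
      then have "t e = 0" using deg by (simp add: t_def mval_ivec)
      then show ?thesis using below_zero by simp
    next
      case False
      then have m0: "mval e ivec = 0" by (auto simp: mval_ivec)
      have "t e = cst (lkp g e) * mon (lkp e 1) (lkp e 2) (lkp e 3)"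
        by (simp add: t_def m0)
      moreover have "mon_weight (lkp e 1) (lkp e 2) (lkp e 3) < d * (q ^ 3 + 1)"
        using mon_weight_le_degree[OF deg False] .
      ultimately show ?thesis using below_mon by simp
    qed
  qed
  then have "(\<Sum>e\<in>keyset g. t e) \<in> below (d * (q ^ 3 + 1))" by (rule below_sum)
  ultimately show ?thesis by simp
qed

lemma mon_weight_x: "mon_weight d 0 0 = d * (q ^ 3 + 1)" by (simp add: mon_weight_def)

text \<open>The value at \<open>(1, 0, 0, 0)\<close> is the coefficient of \<open>x ^ d\<close>, the unique monomial of degree \<open>d\<close> of
  largest weight.\<close>

lemma infinity_iff_has_weight:
  assumes "homogeneous d g"
  shows "poly_value g ivec \<noteq> 0 \<longleftrightarrow> has_weight (dehom g) (d * (q ^ 3 + 1))"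
proof
  assume "poly_value g ivec \<noteq> 0"
  then show "has_weight (dehom g) (d * (q ^ 3 + 1))"
    by (rule has_weightI[OF _ mon_weight_x value_at_infinity_below[OF assms]])
next
  assume l: "has_weight (dehom g) (d * (q ^ 3 + 1))"
  show "poly_value g ivec \<noteq> 0"
  proof
    assume "poly_value g ivec = 0"
    then show False using value_at_infinity_below[OF assms] has_weight_notin_below[OF l] by simp
  qed
qed

lemma form_weight_le:
  assumes "a \<in> forms d" "has_weight a w"
  shows "w \<le> d * (q ^ 3 + 1)"
proof -
  obtain g where g: "a = dehom g" "homogeneous d g" using assms(1) by (auto simp: forms_def)
  have "(a - cst (poly_value g ivec) * mon d 0 0) + cst (poly_value g ivec) * mon d 0 0 \<in> below (Suc (d * (q ^ 3 + 1)))"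
    using value_at_infinity_below[OF g(2)] g(1) by (intro below_step) (auto simp: mon_weight_x elim: below_mono)
  then have "a \<in> below (Suc (d * (q ^ 3 + 1)))" by simp
  then show ?thesis using has_weight_notin_below[OF assms(2)] below_mono by (metis not_less_eq_eq)
qed

text \<open>In homogeneous coordinates with \<open>x = 1\<close> this equation says that \<open>y\<close> is \<open>z ^ N\<close> times a unit at infinity. For
  \<open>y \<noteq> 0\<close> it is obtained by cancelling \<open>y ^ q\<close> from \<open>y ^ q * z ^ N = x ^ q\<^sup>2 - x\<close>, multiplied by
  \<open>x ^ (q - 1) + 1\<close>.\<close>

lemma curve_relation_xyz: "cy * (cx ^ (q\<^sup>2 - 1) - 1) = (cx ^ (q - 1) + 1) * (cz :: 'f gk_fun) ^ N"
proof
  fix P :: "'f gk_point"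
  define x y z where xyz: "x = cx P" "y = cy P" "z = cz P"
  have q2: "q\<^sup>2 > 1" using one_less_power[OF q_gt_1, of 2] by simp
  have "y * (x ^ (q\<^sup>2 - 1) - 1) = (x ^ (q - 1) + 1) * z ^ N"
  proof (cases "y = 0")
    case True
    then have "z ^ N = 0" using curve_z[of P] q_gt_1 by (simp add: xyz power_0_left)
    then show ?thesis using True by simp
  next
    case False
    have yq: "y ^ q * y = x * (x ^ (q - 1) + 1)"
      using curve_y[of P] power_minus_mult[of q x] q_gt_1 by (simp add: xyz algebra_simps)
    have w: "y ^ q * z ^ N = x * (x ^ (q\<^sup>2 - 1) - 1)"
    proof -
      have "(y ^ q * y) ^ q = (x ^ q + x) ^ q" using curve_y[of P] by (simp add: xyz mult.commute)
      then have "y ^ q\<^sup>2 * y ^ q = x ^ q\<^sup>2 + x ^ q"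
        by (simp only: power_mult_distrib frob_add1 frob_steps)
      moreover have zN: "z ^ N = y ^ q\<^sup>2 - y" using curve_z[of P] by (simp add: xyz)
      have "y ^ q * z ^ N = y ^ q\<^sup>2 * y ^ q - y * y ^ q" unfolding zN by (simp add: algebra_simps)
      ultimately have "y ^ q * z ^ N = x ^ q\<^sup>2 + x ^ q - y * y ^ q" by simp
      also have "\<dots> = x ^ q\<^sup>2 - x" using curve_y[of P] by (simp add: xyz)
      also have "\<dots> = x * (x ^ (q\<^sup>2 - 1) - 1)"
        using power_minus_mult[of "q\<^sup>2" x] q2 q_gt_1 by (simp add: algebra_simps)
      finally show ?thesis .
    qed
    have "y ^ q * (y * (x ^ (q\<^sup>2 - 1) - 1)) = (y ^ q * y) * (x ^ (q\<^sup>2 - 1) - 1)" by (simp only: mult.assoc)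
    also have "\<dots> = (x ^ (q - 1) + 1) * (x * (x ^ (q\<^sup>2 - 1) - 1))" unfolding yq by (simp only: ac_simps)
    also have "\<dots> = y ^ q * ((x ^ (q - 1) + 1) * z ^ N)" unfolding w[symmetric] by (simp only: ac_simps)
    finally show ?thesis using False by simp
  qed
  then show "(cy * (cx ^ (q\<^sup>2 - 1) - 1)) P = ((cx ^ (q - 1) + 1) * (cz :: 'f gk_fun) ^ N) P"
    by (simp add: fn_app xyz)
qed

text \<open>The function \<open>z / x\<close> is a local parameter at infinity. A form vanishing there has only monomials
  divisible by \<open>y\<close>, by \<open>z\<close>, or by the fourth variable, and after multiplication with the form \<open>E\<close>, which does not
  vanish at infinity, each of these becomes divisible by \<open>z\<close>: for \<open>y\<close> by
  \<open>curve_relation_xyz\<close>, and for the fourth variable because \<open>x ^ q + x = y ^ (q + 1)\<close> is a form of degree \<open>q\<close> on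
  the left and one of degree \<open>q + 1\<close>, divisible by \<open>y\<close>, on the right.\<close>

lemma infinity_step:
  assumes "a \<in> forms d" "\<not> has_weight a (d * (q ^ 3 + 1))" "d > 0"
  shows "\<exists>D e b. e \<in> forms D \<and> has_weight e (D * (q ^ 3 + 1)) \<and> b \<in> forms (D + d - 1) \<and> e * a = cz * b"
proof -
  have q2: "q\<^sup>2 > 1" using one_less_power[OF q_gt_1, of 2] by simp
  have qq: "q \<le> q\<^sup>2" by (simp add: power2_eq_square)
  \<comment> \<open>\<open>E1\<close> and \<open>E2\<close> stand for \<open>x ^ (q\<^sup>2 - 1) - t ^ (q\<^sup>2 - 1)\<close> and \<open>x ^ q + x * t ^ (q - 1)\<close>, with \<open>t\<close> the fourth variable.\<close>
  define E1 E2 M :: "'f gk_fun" where "E1 = cx ^ (q\<^sup>2 - 1) - 1" and "E2 = cx ^ q + cx"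
    and "M = (cx ^ (q - 1) + 1) * cz ^ (N - 1)"
  define E where "E = E1 * E2"
  define D where "D = q\<^sup>2 - 1 + q"
  have m: "cx ^ i \<in> forms i" "cy ^ i \<in> forms i" "cz ^ i \<in> forms i" for i
    using forms_power[OF forms_basic(4), of i] forms_power[OF forms_basic(5), of i]
      forms_power[OF forms_basic(6), of i] by simp_all
  have one: "1 \<in> forms d" for d using forms_mono[OF forms_basic(2)] by simp
  have E1f: "E1 \<in> forms (q\<^sup>2 - 1)" unfolding E1_def by (intro forms_diff m one)
  have E2f: "E2 \<in> forms q" unfolding E2_def
    by (intro forms_add m forms_mono[OF forms_basic(4)]) (use q_gt_1 in simp)
  have Ef: "E \<in> forms D" unfolding E_def D_def by (intro forms_mult E1f E2f)
  have Mf: "M \<in> forms (q - 1 + (N - 1))" unfolding M_def by (intro forms_mult forms_add m one)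
  \<comment> \<open>The cofactors of \<open>z\<close> have the same degree as \<open>E\<close>, so that dividing by \<open>z\<close> lowers the total degree by one.\<close>
  have deg: "q + (q - 1 + (N - 1)) = D" unfolding D_def N_def using qq q_gt_1 q2 by simp
  have E2M: "E2 * M \<in> forms D" and yM: "cy ^ q * M \<in> forms D"
    using forms_mult[OF E2f Mf] forms_mult[OF m(2)[of q] Mf] unfolding deg by simp_all
  have zN: "(cz :: 'f gk_fun) ^ N = cz * cz ^ (N - 1)" using N_pos by (metis Suc_pred' power_Suc)
  have yE1: "cy * E1 = cz * M" using curve_relation_xyz unfolding E1_def M_def zN by (simp add: ac_simps)
  have "E * cy = E2 * (cy * E1)" unfolding E_def by (simp only: ac_simps)
  also have "\<dots> = cz * (E2 * M)" unfolding yE1 by (simp only: ac_simps)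
  finally have Ey: "E * cy = cz * (E2 * M)" .
  have E2y: "E2 = cy ^ q * cy" unfolding E2_def curve_fun_x by (simp add: mult.commute)
  have "E = cy ^ q * (cy * E1)" unfolding E_def E2y by (simp only: ac_simps)
  also have "\<dots> = cz * (cy ^ q * M)" unfolding yE1 by (simp only: ac_simps)
  finally have E_1: "E = cz * (cy ^ q * M)" .
  have weight_E: "has_weight E (D * (q ^ 3 + 1))"
  proof -
    have "has_weight E1 (mon_weight (q\<^sup>2 - 1) 0 0)"
    proof (rule has_weightI[of 1 "q\<^sup>2 - 1" 0 0])
      have "E1 - cst 1 * mon (q\<^sup>2 - 1) 0 0 = cst (-1) * mon 0 0 0"
        by (simp add: E1_def mon_def fun_eq_iff fn_app)
      then show "E1 - cst 1 * mon (q\<^sup>2 - 1) 0 0 \<in> below (mon_weight (q\<^sup>2 - 1) 0 0)"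
        using q2 by (simp only:) (intro below_mon, simp add: mon_weight_def)
    qed simp_all
    moreover have "has_weight E2 (mon_weight q 0 0)"
    proof (rule has_weightI[of 1 q 0 0])
      have "E2 - cst 1 * mon q 0 0 = cst 1 * mon 1 0 0"
        by (simp add: E2_def mon_def fun_eq_iff fn_app)
      then show "E2 - cst 1 * mon q 0 0 \<in> below (mon_weight q 0 0)"
        using mon_weight_relations(2) by (simp only:) (intro below_mon, simp)
    qed simp_all
    ultimately have "has_weight E (mon_weight (q\<^sup>2 - 1) 0 0 + mon_weight q 0 0)" unfolding E_def by (rule has_weight_mult)
    then show ?thesis by (simp only: mon_weight_x D_def distrib_right)
  qed
  have mono: "\<exists>b \<in> forms (D + d - 1). E * mon i j l = cz * b"
    if ijl: "i + j + l \<le> d" "\<not> (i = d)" for i j l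
  proof -
    have z1: "(cz :: 'f gk_fun) ^ l = cz * cz ^ (l - 1)" if "l > 0"
      using that by (metis Suc_pred' power_Suc)
    have y1: "(cy :: 'f gk_fun) ^ j = cy * cy ^ (j - 1)" if "j > 0"
      using that by (metis Suc_pred' power_Suc)
    consider "l > 0" | "l = 0" "j > 0" | "l = 0" "j = 0" by auto
    then show ?thesis
    proof cases
      case 1
      have "E * mon i j (l - 1) \<in> forms (D + (d - 1))"
        by (intro forms_mult Ef forms_mon) (use ijl 1 in simp)
      moreover have "E * mon i j l = cz * (E * mon i j (l - 1))"
        unfolding mon_def z1[OF 1] by (simp add: ac_simps)
      ultimately show ?thesis using assms(3) by auto
    next
      case 2
      have "(E2 * M) * mon i (j - 1) 0 \<in> forms (D + (d - 1))"
        by (intro forms_mult E2M forms_mon) (use ijl 2 in simp)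
      moreover have "E * mon i j l = cz * ((E2 * M) * mon i (j - 1) 0)"
      proof -
        have "E * mon i j l = (E * cy) * mon i (j - 1) 0" unfolding mon_def y1[OF 2(2)] 2(1) by (simp add: ac_simps)
        then show ?thesis unfolding Ey by (simp only: mult.assoc)
      qed
      ultimately show ?thesis using assms(3) by auto
    next
      case 3
      have "(cy ^ q * M) * mon i 0 0 \<in> forms (D + (d - 1))"
        by (intro forms_mult yM forms_mon) (use ijl 3 in simp)
      moreover have "E * mon i j l = cz * ((cy ^ q * M) * mon i 0 0)"
        unfolding 3 by (subst E_1) (simp only: mult.assoc)
      ultimately show ?thesis using assms(3) by auto
    qed
  qed
  obtain g where g: "a = dehom g" "homogeneous d g" using assms(1) by (auto simp: forms_def)
  have g0: "poly_value g ivec = 0" using infinity_iff_has_weight[OF g(2)] assms(2) g(1) by auto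
  have "cst (poly_value g ivec) = (\<Sum>e\<in>keyset g. cst (lkp g e) * cst (mval e ivec))"
    by (simp add: fun_eq_iff fn_app poly_value_keys)
  then have s0: "(\<Sum>e\<in>keyset g. cst (lkp g e) * cst (mval e ivec)) = 0" using g0 by simp
  have "\<exists>b. b \<in> forms (D + d - 1) \<and>
      E * (cst (lkp g e) * (mon (lkp e 1) (lkp e 2) (lkp e 3) - cst (mval e ivec) * mon d 0 0)) = cz * b"
    if e: "e \<in> keyset g" for e
  proof -
    have dg: "lkp e 1 + lkp e 2 + lkp e 3 + lkp e 4 = d"
      using g(2) e by (simp add: homogeneous_iff in_keys_iff mdeg_4)
    show ?thesis
    proof (cases "lkp e 2 = 0 \<and> lkp e 3 = 0 \<and> lkp e 4 = 0")
      case True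
      then show ?thesis using dg forms_basic(1) by (intro exI[of _ 0]) (simp add: mval_ivec)
    next
      case False
      then obtain b where b: "b \<in> forms (D + d - 1)" "E * mon (lkp e 1) (lkp e 2) (lkp e 3) = cz * b"
        using mono[of "lkp e 1" "lkp e 2" "lkp e 3"] dg by auto
      have m0: "mval e ivec = 0" using False by (auto simp: mval_ivec)
      have "E * (cst (lkp g e) * mon (lkp e 1) (lkp e 2) (lkp e 3)) = cst (lkp g e) * (E * mon (lkp e 1) (lkp e 2) (lkp e 3))"
        by (simp only: ac_simps)
      also have "\<dots> = cz * (cst (lkp g e) * b)" unfolding b(2) by (simp only: ac_simps)
      finally show ?thesis using forms_cmult[OF b(1)] m0 by (intro exI[of _ "cst (lkp g e) * b"]) simp
    qed
  qed
  then obtain b where b: "\<And>e. e \<in> keyset g \<Longrightarrow> b e \<in> forms (D + d - 1) \<and>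
      E * (cst (lkp g e) * (mon (lkp e 1) (lkp e 2) (lkp e 3) - cst (mval e ivec) * mon d 0 0)) = cz * b e"
    by metis
  have "a = (\<Sum>e\<in>keyset g. cst (lkp g e) * (mon (lkp e 1) (lkp e 2) (lkp e 3) - cst (mval e ivec) * mon d 0 0))"
  proof -
    have "(\<Sum>e\<in>keyset g. cst (lkp g e) * (mon (lkp e 1) (lkp e 2) (lkp e 3) - cst (mval e ivec) * mon d 0 0))
        = dehom g - (\<Sum>e\<in>keyset g. cst (lkp g e) * cst (mval e ivec)) * mon d 0 0"
      unfolding dehom_sum by (simp add: sum_distrib_right right_diff_distrib sum_subtractf mult.assoc)
    then show ?thesis unfolding s0 g(1) by simp
  qed
  then have "E * a = (\<Sum>e\<in>keyset g. cz * b e)"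
    using b by (simp add: sum_distrib_left)
  then have "E * a = cz * (\<Sum>e\<in>keyset g. b e)" by (simp add: sum_distrib_left)
  moreover have "(\<Sum>e\<in>keyset g. b e) \<in> forms (D + d - 1)" using b by (intro forms_sum) auto
  ultimately show ?thesis using Ef weight_E by blast
qed

text \<open>Each application of \<open>infinity_step\<close> lowers the defect \<open>d * (q ^ 3 + 1) - w\<close> of the weight by one. The
  degrees have to be recorded because the fourth variable is not a unit at infinity.\<close>

lemma infinity_expansion:
  assumes "a \<in> forms d" "has_weight a w" "d * (q ^ 3 + 1) = w + n"
  shows "\<exists>D D' e b. e \<in> forms D \<and> has_weight e (D * (q ^ 3 + 1)) \<and> b \<in> forms D' \<and> has_weight b (D' * (q ^ 3 + 1)) \<and>
    D' + n = D + d \<and> e * a = cz ^ n * b"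
  using assms
proof (induction n arbitrary: a d w)
  case 0
  have "1 \<in> forms 0 \<and> has_weight 1 (0 * (q ^ 3 + 1)) \<and> a \<in> forms d \<and> has_weight a (d * (q ^ 3 + 1)) \<and>
    d + 0 = 0 + d \<and> 1 * a = cz ^ 0 * a"
    using 0 forms_basic(2) has_weight_1 by simp
  then show ?case by blast
next
  case (Suc n)
  have "\<not> has_weight a (d * (q ^ 3 + 1))"
  proof
    assume "has_weight a (d * (q ^ 3 + 1))"
    then have "w = d * (q ^ 3 + 1)" by (rule has_weight_unique[OF Suc.prems(2)])
    with Suc.prems(3) show False by linarith
  qed
  moreover have d0: "d > 0" using Suc.prems(3) by (cases d) auto
  ultimately obtain D e b where 1: "e \<in> forms D" "has_weight e (D * (q ^ 3 + 1))" "b \<in> forms (D + d - 1)" "e * a = cz * b"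
    using infinity_step[OF Suc.prems(1)] by blast
  have ea: "has_weight (e * a) (D * (q ^ 3 + 1) + w)" using has_weight_mult[OF 1(2) Suc.prems(2)] .
  from has_weight_nonzero[OF ea] have "b \<noteq> 0" unfolding 1(4) by auto
  then obtain v where v: "has_weight b v" using has_weight_exists forms_in_A[OF 1(3)] by blast
  have "has_weight (cz :: 'f gk_fun) (q ^ 3)" using has_weight_zpoly[of "[:0, 1:]"] by (simp add: zpoly_def)
  from has_weight_mult[OF this v] have "q ^ 3 + v = D * (q ^ 3 + 1) + w"
    using has_weight_unique[OF ea] 1(4) by simp
  moreover have "(D + d) * (q ^ 3 + 1) = (D + d - 1) * (q ^ 3 + 1) + (q ^ 3 + 1)"
    using d0 by (cases "D + d") auto
  moreover have "(D + d) * (q ^ 3 + 1) = D * (q ^ 3 + 1) + d * (q ^ 3 + 1)" by (rule distrib_right)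
  ultimately have "(D + d - 1) * (q ^ 3 + 1) = v + n" using Suc.prems(3) by linarith
  from Suc.IH[OF 1(3) v this] obtain D2 D' e' b' where 2: "e' \<in> forms D2" "has_weight e' (D2 * (q ^ 3 + 1))"
    "b' \<in> forms D'" "has_weight b' (D' * (q ^ 3 + 1))" "D' + n = D2 + (D + d - 1)" "e' * b = cz ^ n * b'"
    by blast
  have "(e' * e) * a = e' * (e * a)" by (simp only: mult.assoc)
  also have "\<dots> = cz * (e' * b)" unfolding 1(4) by (simp only: ac_simps)
  also have "\<dots> = cz ^ Suc n * b'" unfolding 2(6) by (simp only: power_Suc mult.assoc)
  finally have "(e' * e) * a = cz ^ Suc n * b'" .
  moreover have "has_weight (e' * e) ((D2 + D) * (q ^ 3 + 1))" using has_weight_mult[OF 2(2) 1(2)] by (simp only: distrib_right)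
  moreover have "e' * e \<in> forms (D2 + D)" by (rule forms_mult[OF 2(1) 1(1)])
  moreover have "D' + Suc n = D2 + D + d" using 2(5) d0 by simp
  ultimately show ?case using 2(3,4) by blast
qed

end

section \<open>Points of the curve\<close>

context gk
begin

abbreviation GK :: "('f alg_closure ^ 4) set set" where "GK \<equiv> gk_curve q"

definition aff_point :: "'f gk_point \<Rightarrow> ('f alg_closure ^ 4) set" where "aff_point P = proj_point (cvec P)"

definition inf_point :: "('f alg_closure ^ 4) set" where "inf_point = proj_point ivec"

lemma affine_points_eq: "gk_affine_points q = range aff_point"
proof (intro equalityI subsetI)
  fix p :: "('f alg_closure ^ 4) set" assume "p \<in> gk_affine_points q"
  then obtain x y z where p: "p = proj_point (vector [x, y, z, 1])"
    and e: "y ^ (q + 1) = x ^ q + x" "z ^ N = y ^ q\<^sup>2 - y"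
    unfolding gk_affine_points_def N_def by blast
  obtain P where "cx P = x" "cy P = y" "cz P = z" using curve_point_exists[OF e] by blast
  then have "p = aff_point P" by (simp add: p aff_point_def cvec_def)
  then show "p \<in> range aff_point" by blast
next
  fix p assume "p \<in> range aff_point"
  then obtain P where p: "p = aff_point P" by blast
  show "p \<in> gk_affine_points q" unfolding p gk_affine_points_def mem_Collect_eq
    by (rule exI[of _ "cx P"], rule exI[of _ "cy P"], rule exI[of _ "cz P"])
      (use curve_y[of P] curve_z[of P] in \<open>simp add: aff_point_def cvec_def N_def\<close>)
qed

lemma vec4_eqI:
  fixes v w :: "'a ^ 4"
  assumes "vec_nth v 1 = vec_nth w 1" "vec_nth v 2 = vec_nth w 2" "vec_nth v 3 = vec_nth w 3"
    "vec_nth v 4 = vec_nth w 4"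
  shows "v = w"
  using assms by (simp add: vec_eq_iff forall_4)

lemma cvec_nonzero: "cvec P \<noteq> 0" and ivec_nonzero: "ivec \<noteq> 0"
proof -
  show "cvec P \<noteq> 0"
  proof
    assume "cvec P = 0"
    then have "vec_nth (cvec P) 4 = 0" by simp
    then show False by (simp add: cvec_def)
  qed
  show "ivec \<noteq> 0"
  proof
    assume "ivec = 0"
    then have "vec_nth ivec 1 = 0" by simp
    then show False by (simp add: ivec_def)
  qed
qed

lemma vanishes_at_aff_point: "homogeneous d g \<Longrightarrow> vanishes_at g (aff_point P) \<longleftrightarrow> dehom g P = 0"
  by (simp add: aff_point_def vanishes_at_proj_point dehom_apply)

lemma affine_vanishing: "homogeneous d g \<Longrightarrow> (\<forall>Q\<in>gk_affine_points q. vanishes_at g Q) \<longleftrightarrow> dehom g = 0"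
  unfolding affine_points_eq by (auto simp: vanishes_at_aff_point fun_eq_iff fn_app)

lemma infinity_vanishing: assumes "homogeneous d g" "dehom g = 0" shows "poly_value g ivec = 0"
  using infinity_iff_has_weight[OF assms(1)] has_weight_nonzero assms(2) by blast

text \<open>The affine curve lies on the Hermitian surface of the field with \<open>q ^ 6\<close> elements, because
  \<open>z ^ (q ^ 3 + 1) = w ^ (q + 1)\<close> with \<open>w = y ^ q\<^sup>2 - y\<close>.\<close>

lemma hermitian_relation: "cz P ^ (q ^ 3 + 1) = cx P ^ q ^ 3 + cx P - cy P ^ (q ^ 3 + 1)" for P :: "'f gk_point"
proof -
  define x y z where xyz: "x = cx P" "y = cy P" "z = cz P"
  have e: "y * y ^ q = x ^ q + x" using curve_y[of P] by (simp add: xyz)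
  have f: "y ^ q ^ i * y ^ q ^ (Suc i) = x ^ q ^ (Suc i) + x ^ q ^ i" for i
  proof -
    have "(y * y ^ q) ^ q ^ i = (x ^ q + x) ^ q ^ i" by (simp only: e)
    then show ?thesis using frob_frob[of y 1 i] frob_frob[of x 1 i]
      by (simp add: power_mult_distrib frob_add)
  qed
  have f1: "y ^ q * y ^ q\<^sup>2 = x ^ q\<^sup>2 + x ^ q" and f2: "y ^ q\<^sup>2 * y ^ q ^ 3 = x ^ q ^ 3 + x ^ q\<^sup>2"
    using f[of 1] f[of 2] by (simp_all add: numeral_2_eq_2 numeral_3_eq_3)
  have "z ^ (N * (q + 1)) = (y ^ q\<^sup>2 - y) * (y ^ q\<^sup>2 - y) ^ q"
    using curve_z[of P] by (simp add: power_mult power_add xyz)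
  also have "\<dots> = (y ^ q\<^sup>2 - y) * (y ^ q ^ 3 - y ^ q)" by (simp only: frob_diff1 frob_steps)
  also have "\<dots> = y ^ q\<^sup>2 * y ^ q ^ 3 - y ^ q * y ^ q\<^sup>2 - y ^ q ^ 3 * y + y * y ^ q"
    by (simp add: algebra_simps)
  also have "\<dots> = x ^ q ^ 3 + x - y ^ q ^ 3 * y" unfolding f1 f2 e by simp
  finally show ?thesis unfolding q_cubed by (simp add: xyz mult.commute)
qed

text \<open>Points with last coordinate \<open>t \<noteq> 0\<close> are affine by the two equations of the curve. If \<open>t = 0\<close>, the first
  equation gives \<open>y = 0\<close> and the Hermitian equation gives \<open>z = 0\<close>. Conversely, a form vanishing on the affine
  curve has no weight and so cannot contain \<open>x ^ d\<close>.\<close>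

lemma gk_curve_eq: "GK = insert inf_point (range aff_point)"
proof (intro equalityI subsetI)
  fix p assume "p \<in> insert inf_point (range aff_point)"
  then show "p \<in> GK"
  proof
    assume p: "p = inf_point"
    have "p \<in> proj_space" using ivec_nonzero by (auto simp: p inf_point_def proj_space_def)
    moreover have "vanishes_at g p" if "homogeneous d g" "\<forall>Q\<in>gk_affine_points q. vanishes_at g Q" for d g
      using infinity_vanishing[OF that(1)] that affine_vanishing[OF that(1)]
      by (simp add: p inf_point_def vanishes_at_proj_point[OF that(1)])
    ultimately show ?thesis by (auto simp: gk_curve_def proj_closure_def)
  next
    assume "p \<in> range aff_point"
    then have "p \<in> proj_space" "p \<in> gk_affine_points q"
      using cvec_nonzero unfolding affine_points_eq by (auto simp: aff_point_def proj_space_def)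
    then show ?thesis by (auto simp: gk_curve_def proj_closure_def)
  qed
next
  fix p assume p: "p \<in> GK"
  then obtain v where v: "p = proj_point v" "v \<noteq> 0" by (auto simp: gk_curve_def proj_closure_def proj_space_def)
  have van: "poly_value g v = 0" if "homogeneous d g" "dehom g = 0" for d g
    using p that affine_vanishing[OF that(1)] vanishes_at_proj_point[OF that(1), of v]
    unfolding gk_curve_def proj_closure_def v(1) by blast
  define a b c t where abc: "a = vec_nth v 1" "b = vec_nth v 2" "c = vec_nth v 3" "t = vec_nth v 4"
  let ?X = "mvar 1 :: (4, 'f alg_closure) mpoly" and ?Y = "mvar 2 :: (4, 'f alg_closure) mpoly"
  let ?Z = "mvar 3 :: (4, 'f alg_closure) mpoly" and ?T = "mvar 4 :: (4, 'f alg_closure) mpoly"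
  have h: "homogeneous n (mvar i ^ n :: (4, 'f alg_closure) mpoly)" for i n
    using homogeneous_power[OF homogeneous_mvar, of n i] by simp
  have hm: "homogeneous k (mvar i ^ m * mvar j ^ n :: (4, 'f alg_closure) mpoly)" if "k = m + n" for i j m n k
    unfolding that by (intro homogeneous_mult h)
  have q2: "q\<^sup>2 > 1" using one_less_power[OF q_gt_1, of 2] by simp
  have qq: "q \<le> q\<^sup>2" by (simp add: power2_eq_square)
  have e1: "b ^ (q + 1) = a ^ q * t + a * t ^ q"
  proof -
    let ?g = "?Y ^ (q + 1) - (?X ^ q * ?T ^ 1 + ?X ^ 1 * ?T ^ q)"
    have "homogeneous (q + 1) ?g" by (intro homogeneous_diff homogeneous_add h hm) simp_all
    moreover have "dehom ?g = 0"
      using curve_fun_x by (simp add: dehom_simps algebra_simps)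
    ultimately show ?thesis using van[of "q + 1" ?g]
      by (simp add: poly_value_diff poly_value_add poly_value_mult poly_value_power abc)
  qed
  have e2: "c ^ N * t ^ (q - 1) = b ^ q\<^sup>2 - b * t ^ (q\<^sup>2 - 1)"
  proof -
    let ?g = "?Z ^ N * ?T ^ (q - 1) - (?Y ^ q\<^sup>2 - ?Y ^ 1 * ?T ^ (q\<^sup>2 - 1))"
    have "homogeneous (q\<^sup>2) ?g"
      by (intro homogeneous_diff h hm) (use q2 qq q_gt_1 in \<open>simp_all add: N_def\<close>)
    moreover have "dehom ?g = 0"
      using curve_fun_y by (simp add: dehom_simps algebra_simps)
    ultimately show ?thesis using van[of "q\<^sup>2" ?g]
      by (simp add: poly_value_diff poly_value_add poly_value_mult poly_value_power abc)
  qed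
  show "p \<in> insert inf_point (range aff_point)"
  proof (cases "t = 0")
    case True
    have b0: "b = 0" using e1 True q_gt_1 by (simp add: power_0_left)
    \<comment> \<open>The homogeneous form of the Hermitian equation.\<close>
    let ?g = "?Z ^ (q ^ 3 + 1) - ((?X ^ q ^ 3 * ?T ^ 1 + ?X ^ 1 * ?T ^ (q ^ 3)) - ?Y ^ (q ^ 3 + 1))"
    have "homogeneous (q ^ 3 + 1) ?g" by (intro homogeneous_diff homogeneous_add h hm) simp_all
    moreover have "dehom ?g = 0"
    proof
      fix P :: "'f gk_point"
      show "dehom ?g P = 0 P" unfolding dehom_simps fn_app hermitian_relation by simp
    qed
    ultimately have "c ^ (q ^ 3 + 1) = (a ^ q ^ 3 * t + a * t ^ q ^ 3) - b ^ (q ^ 3 + 1)"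
      using van[of "q ^ 3 + 1" ?g]
      by (simp add: poly_value_diff poly_value_add poly_value_mult poly_value_power abc)
    then have c0: "c = 0" using True b0 q_gt_1 by (simp add: power_0_left)
    have va: "v = a *s ivec"
      by (rule vec4_eqI) (use True b0 c0 in \<open>simp_all add: abc[symmetric] ivec_def\<close>)
    then have "a \<noteq> 0" using v(2) by auto
    then have "p = inf_point" unfolding v(1) inf_point_def va by (rule proj_point_scale)
    then show ?thesis by simp
  next
    case t0: False
    define x y z where xyz: "x = a / t" "y = b / t" "z = c / t"
    have abt: "a = x * t" "b = y * t" "c = z * t" using t0 by (simp_all add: xyz)
    have tq: "t ^ (q + 1) \<noteq> 0" "t ^ q\<^sup>2 \<noteq> 0" using t0 by simp_all
    have "t ^ (q + 1) * y ^ (q + 1) = t ^ (q + 1) * (x ^ q + x)"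
      using e1 unfolding abt by (simp add: power_mult_distrib algebra_simps)
    then have c1: "y ^ (q + 1) = x ^ q + x" using tq(1) by (simp only: mult_cancel_left) simp
    have nq: "N + (q - 1) = q\<^sup>2" using qq q_gt_1 by (simp add: N_def)
    have p1: "t ^ N * t ^ (q - 1) = t ^ q\<^sup>2" by (simp only: power_add[symmetric] nq)
    have p2: "t * t ^ (q\<^sup>2 - 1) = t ^ q\<^sup>2" using power_minus_mult[of "q\<^sup>2" t] q2 q_gt_1 by (simp add: mult.commute)
    have "t ^ q\<^sup>2 * z ^ N = z ^ N * (t ^ N * t ^ (q - 1))" unfolding p1 by (rule mult.commute)
    also have "\<dots> = c ^ N * t ^ (q - 1)" unfolding abt by (simp only: power_mult_distrib mult.assoc)
    also have "\<dots> = y ^ q\<^sup>2 * t ^ q\<^sup>2 - y * (t * t ^ (q\<^sup>2 - 1))" unfolding e2 unfolding abt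
      by (simp only: power_mult_distrib mult.assoc)
    also have "\<dots> = t ^ q\<^sup>2 * (y ^ q\<^sup>2 - y)" unfolding p2 by (simp add: algebra_simps)
    finally have c2: "z ^ N = y ^ q\<^sup>2 - y" using tq(2) by (simp only: mult_cancel_left) simp
    obtain P where P: "cx P = x" "cy P = y" "cz P = z" using curve_point_exists[OF c1 c2] by blast
    have "v = t *s cvec P"
      by (rule vec4_eqI) (simp_all add: abc[symmetric] cvec_def P abt mult.commute)
    then have "p = aff_point P" unfolding v(1) aff_point_def using proj_point_scale[OF t0] by simp
    then show ?thesis by simp
  qed
qed

lemma curve_vanishing: assumes "homogeneous d g" shows "(\<forall>P\<in>GK. vanishes_at g P) \<longleftrightarrow> dehom g = 0"
proof -
  have "(\<forall>P\<in>GK. vanishes_at g P) \<longleftrightarrow> vanishes_at g inf_point \<and> (\<forall>P\<in>range aff_point. vanishes_at g P)"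
    unfolding gk_curve_eq by blast
  also have "\<dots> \<longleftrightarrow> dehom g = 0"
    using affine_vanishing[OF assms] infinity_vanishing[OF assms]
    unfolding affine_points_eq inf_point_def vanishes_at_proj_point[OF assms] by blast
  finally show ?thesis .
qed

section \<open>The function field\<close>

abbreviation K where "K \<equiv> function_field GK"

definition frac_class :: "(4, 'f alg_closure) mpoly \<Rightarrow> (4, 'f alg_closure) mpoly \<Rightarrow>
    ((4, 'f alg_closure) mpoly \<times> (4, 'f alg_closure) mpoly) set" where
  "frac_class g h = fraction_rel GK `` {(g, h)}"

text \<open>The degree is kept explicit, since the multiplicity of a form at infinity depends on it.\<close>

definition is_frac :: "nat \<Rightarrow> (4, 'f alg_closure) mpoly \<Rightarrow> (4, 'f alg_closure) mpoly \<Rightarrow> bool" where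
  "is_frac d g h \<longleftrightarrow> homogeneous d g \<and> homogeneous d h \<and> dehom h \<noteq> 0"

lemma fractions_iff: "(g, h) \<in> fractions GK \<longleftrightarrow> (\<exists>d. is_frac d g h)"
  unfolding fractions_def is_frac_def using curve_vanishing by auto

lemma dehom_in_A: "homogeneous d g \<Longrightarrow> dehom g \<in> A"
  using forms_in_A formsI by blast

lemma is_frac_in_A: "is_frac d g h \<Longrightarrow> dehom g \<in> A" "is_frac d g h \<Longrightarrow> dehom h \<in> A"
  using dehom_in_A unfolding is_frac_def by blast+

lemma rel_iff: "((g, h), (g', h')) \<in> fraction_rel GK \<longleftrightarrow>
   (\<exists>d. is_frac d g h) \<and> (\<exists>d. is_frac d g' h') \<and> dehom g * dehom h' = dehom g' * dehom h"
proof -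
  have "(\<forall>P\<in>GK. vanishes_at (g * h' - g' * h) P) \<longleftrightarrow> dehom g * dehom h' = dehom g' * dehom h"
    if "is_frac d g h" "is_frac d' g' h'" for d d'
  proof -
    have "homogeneous (d + d') (g * h' - g' * h)"
      using that homogeneous_mult[of d g d' h'] homogeneous_mult[of d' g' d h]
      by (intro homogeneous_diff) (auto simp: is_frac_def add.commute)
    from curve_vanishing[OF this] show ?thesis by (simp add: dehom_simps)
  qed
  then show ?thesis unfolding fraction_rel_def fractions_iff by auto
qed

lemma equiv_rel: "equiv (fractions GK) (fraction_rel GK)"
proof (rule equivI)
  show "fraction_rel GK \<subseteq> fractions GK \<times> fractions GK" by (auto simp: fraction_rel_def)
  show "refl_on (fractions GK) (fraction_rel GK)"
    by (rule refl_onI) (metis surj_pair rel_iff fractions_iff)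
  show "sym (fraction_rel GK)" by (auto simp: sym_def rel_iff)
  show "trans (fraction_rel GK)"
  proof (rule transI, clarify)
    fix g1 h1 g2 h2 g3 h3
    assume "((g1, h1), (g2, h2)) \<in> fraction_rel GK" "((g2, h2), (g3, h3)) \<in> fraction_rel GK"
    then obtain d1 d2 d3 where f: "is_frac d1 g1 h1" "is_frac d2 g2 h2" "is_frac d3 g3 h3"
      and e: "dehom g1 * dehom h2 = dehom g2 * dehom h1" "dehom g2 * dehom h3 = dehom g3 * dehom h2"
      by (auto simp: rel_iff)
    have "dehom h2 * (dehom g1 * dehom h3) = (dehom g1 * dehom h2) * dehom h3" by (simp only: ac_simps)
    also have "\<dots> = (dehom g2 * dehom h3) * dehom h1" unfolding e(1) by (simp only: ac_simps)
    also have "\<dots> = dehom h2 * (dehom g3 * dehom h1)" unfolding e(2) by (simp only: ac_simps)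
    finally have eq: "dehom h2 * (dehom g1 * dehom h3) = dehom h2 * (dehom g3 * dehom h1)" .
    have "dehom h2 \<in> A" "dehom g1 * dehom h3 \<in> A" "dehom g3 * dehom h1 \<in> A" "dehom h2 \<noteq> 0"
      using is_frac_in_A[OF f(1)] is_frac_in_A[OF f(2)] is_frac_in_A[OF f(3)] f(2)
      by (simp_all only: A_mult is_frac_def not_False_eq_True)
    from A_cancel[OF this eq] have "dehom g1 * dehom h3 = dehom g3 * dehom h1" .
    then show "((g1, h1), (g3, h3)) \<in> fraction_rel GK" using f by (auto simp: rel_iff)
  qed
qed

lemma frac_class_mem: "(g', h') \<in> frac_class g h \<longleftrightarrow> (\<exists>d. is_frac d g h) \<and> (\<exists>d. is_frac d g' h') \<and> dehom g * dehom h' = dehom g' * dehom h"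
  by (simp add: frac_class_def rel_iff)

lemma frac_class_eq_iff:
  assumes "is_frac d g h" "is_frac d' g' h'"
  shows "frac_class g h = frac_class g' h' \<longleftrightarrow> dehom g * dehom h' = dehom g' * dehom h"
proof -
  have "frac_class g h = frac_class g' h' \<longleftrightarrow> ((g, h), (g', h')) \<in> fraction_rel GK"
    unfolding frac_class_def by (rule eq_equiv_class_iff[OF equiv_rel]) (use assms in \<open>auto simp: fractions_iff\<close>)
  then show ?thesis using assms by (auto simp: rel_iff)
qed

lemma frac_class_carrier: "is_frac d g h \<Longrightarrow> frac_class g h \<in> carrier K"
  unfolding function_field_def frac_class_def by (auto intro!: quotientI simp: fractions_iff)

lemma carrierE:
  assumes "f \<in> carrier K" obtains d g h where "is_frac d g h" "f = frac_class g h"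
proof -
  have "f \<in> fractions GK // fraction_rel GK" using assms by (simp add: function_field_def)
  then obtain p where "p \<in> fractions GK" "f = fraction_rel GK `` {p}" by (elim quotientE)
  then show thesis using that by (cases p) (auto simp: frac_class_def fractions_iff)
qed

lemma is_frac_mult: "is_frac d g h \<Longrightarrow> is_frac d' g' h' \<Longrightarrow> is_frac (d + d') (g * g') (h * h')"
  unfolding is_frac_def dehom_simps using A_domain[of "dehom h" "dehom h'"] dehom_in_A homogeneous_mult by blast

text \<open>The product in the function field is the saturation of the set of all products of representatives; all of
  them are equivalent.\<close>

lemma frac_class_mult:
  assumes "is_frac d g h" "is_frac d' g' h'"
  shows "frac_class g h \<otimes>\<^bsub>K\<^esub> frac_class g' h' = frac_class (g * g') (h * h')"
proof -
  define S where "S = {(a * a', b * b') | a b a' b'. (a, b) \<in> frac_class g h \<and> (a', b') \<in> frac_class g' h'}"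
  have m: "frac_class g h \<otimes>\<^bsub>K\<^esub> frac_class g' h' = fraction_rel GK `` S" by (simp add: function_field_def S_def)
  have "(g, h) \<in> frac_class g h" "(g', h') \<in> frac_class g' h'" using assms by (auto simp: frac_class_mem)
  then have "(g * g', h * h') \<in> S" unfolding S_def by blast
  moreover have "fraction_rel GK `` {s} = frac_class (g * g') (h * h')" if sS: "s \<in> S" for s
  proof -
    obtain a b a' b' where s: "s = (a * a', b * b')" "(a, b) \<in> frac_class g h" "(a', b') \<in> frac_class g' h'"
      using sS unfolding S_def by blast
    obtain e e' where e: "is_frac e a b" "is_frac e' a' b'" "dehom g * dehom b = dehom a * dehom h" "dehom g' * dehom b' = dehom a' * dehom h'"
      using s by (auto simp: frac_class_mem)
    have "(dehom a * dehom a') * (dehom h * dehom h') = (dehom g * dehom b) * (dehom g' * dehom b')"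
      unfolding e by (simp only: ac_simps)
    also have "\<dots> = (dehom g * dehom g') * (dehom b * dehom b')" by (simp only: ac_simps)
    finally show ?thesis using frac_class_eq_iff[OF is_frac_mult[OF e(1,2)] is_frac_mult[OF assms]]
      by (simp add: s(1) frac_class_def dehom_simps)
  qed
  then have "fraction_rel GK `` S = frac_class (g * g') (h * h')"
    using calculation by (subst Image_eq_UN) auto
  then show ?thesis using m by simp
qed

lemma one_frac_class: "\<one>\<^bsub>K\<^esub> = frac_class 1 1" and zero_frac_class: "\<zero>\<^bsub>K\<^esub> = frac_class 0 1"
  by (simp_all add: function_field_def frac_class_def)

lemma is_frac_1: "is_frac 0 1 1" "is_frac 0 0 1"
  by (simp_all add: is_frac_def homogeneous_1 homogeneous_0 dehom_simps)

lemma frac_class_zero_iff: "is_frac d g h \<Longrightarrow> frac_class g h = \<zero>\<^bsub>K\<^esub> \<longleftrightarrow> dehom g = 0"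
  unfolding zero_frac_class using frac_class_eq_iff[of d g h 0 0 1] is_frac_1 by (simp add: dehom_simps)

lemma is_frac_inverse: "is_frac d g h \<Longrightarrow> dehom g \<noteq> 0 \<Longrightarrow> is_frac d h g"
  by (simp add: is_frac_def)

lemma frac_class_inv: assumes "is_frac d g h" "dehom g \<noteq> 0" shows "inv\<^bsub>K\<^esub> (frac_class g h) = frac_class h g"
proof -
  have i: "is_frac d h g" using is_frac_inverse[OF assms] .
  have *: "frac_class g h \<otimes>\<^bsub>K\<^esub> frac_class h g = \<one>\<^bsub>K\<^esub>" "frac_class h g \<otimes>\<^bsub>K\<^esub> frac_class g h = \<one>\<^bsub>K\<^esub>"
    unfolding frac_class_mult[OF assms(1) i] frac_class_mult[OF i assms(1)] one_frac_class
    using frac_class_eq_iff[OF is_frac_mult[OF assms(1) i] is_frac_1(1)] frac_class_eq_iff[OF is_frac_mult[OF i assms(1)] is_frac_1(1)]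
    by (simp_all add: dehom_simps mult.commute)
  show ?thesis unfolding m_inv_def
  proof (rule the_equality)
    show "frac_class h g \<in> carrier K \<and> frac_class g h \<otimes>\<^bsub>K\<^esub> frac_class h g = \<one>\<^bsub>K\<^esub> \<and> frac_class h g \<otimes>\<^bsub>K\<^esub> frac_class g h = \<one>\<^bsub>K\<^esub>"
      using * frac_class_carrier[OF i] by blast
    fix y assume y: "y \<in> carrier K \<and> frac_class g h \<otimes>\<^bsub>K\<^esub> y = \<one>\<^bsub>K\<^esub> \<and> y \<otimes>\<^bsub>K\<^esub> frac_class g h = \<one>\<^bsub>K\<^esub>"
    then obtain e a b where ab: "is_frac e a b" "y = frac_class a b" by (elim conjE carrierE)
    have "frac_class (g * a) (h * b) = frac_class 1 1" using y frac_class_mult[OF assms(1) ab(1)] by (simp add: ab(2) one_frac_class)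
    then have "dehom g * dehom a = dehom h * dehom b"
      using frac_class_eq_iff[OF is_frac_mult[OF assms(1) ab(1)] is_frac_1(1)] by (simp add: dehom_simps)
    then show "y = frac_class h g" unfolding ab(2) frac_class_eq_iff[OF ab(1) i] by (simp add: mult.commute)
  qed
qed

end

section \<open>Places\<close>

text \<open>
  A discrete valuation centred at the point with coordinate vector \<open>v\<close>, given on forms: \<open>\<nu> d a\<close> is the multiplicity at
  the point of the form \<open>a\<close> of degree \<open>d\<close>. The assumption \<open>quotient\<close> says that the local ring is all of
  the valuation ring, that is, that the point is non-singular.
\<close>

locale gk_place = gk q F for q :: nat and F :: "'f::{field,finite} itself" +
  fixes v :: "'f alg_closure ^ 4" and \<nu> :: "nat \<Rightarrow> 'f gk_fun \<Rightarrow> int"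
  assumes vanishing: "\<And>d g. homogeneous d g \<Longrightarrow> dehom g = 0 \<Longrightarrow> poly_value g v = 0"
    and nonneg: "\<And>d a. a \<in> forms d \<Longrightarrow> a \<noteq> 0 \<Longrightarrow> \<nu> d a \<ge> 0"
    and unit_iff: "\<And>d g. homogeneous d g \<Longrightarrow> dehom g \<noteq> 0 \<Longrightarrow> \<nu> d (dehom g) = 0 \<longleftrightarrow> poly_value g v \<noteq> 0"
    and mult: "\<And>d e a b. a \<in> forms d \<Longrightarrow> a \<noteq> 0 \<Longrightarrow> b \<in> forms e \<Longrightarrow> b \<noteq> 0 \<Longrightarrow>
      \<nu> (d + e) (a * b) = \<nu> d a + \<nu> e b"
    and parameter: "\<exists>l\<in>forms 1. \<exists>l'\<in>forms 1. l \<noteq> 0 \<and> l' \<noteq> 0 \<and> \<nu> 1 l = 1 \<and> \<nu> 1 l' = 0"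
    and quotient: "\<And>d a b. a \<in> forms d \<Longrightarrow> b \<in> forms d \<Longrightarrow> a \<noteq> 0 \<Longrightarrow> b \<noteq> 0 \<Longrightarrow> \<nu> d b \<le> \<nu> d a \<Longrightarrow>
      \<exists>D. \<exists>a'\<in>forms D. \<exists>b'\<in>forms D. b' \<noteq> 0 \<and> \<nu> D b' = 0 \<and> a * b' = a' * b"
begin

definition pt where "pt = proj_point v"

text \<open>
  A relation instead of a function, so that nothing needs to be said about the zero function and no
  representative has to be chosen.
\<close>

definition has_val where
  "has_val f n \<longleftrightarrow> (\<exists>d g h. is_frac d g h \<and> dehom g \<noteq> 0 \<and> f = frac_class g h \<and> n = \<nu> d (dehom g) - \<nu> d (dehom h))"

lemma dehom_mult_nonzero: "homogeneous d g \<Longrightarrow> homogeneous e h \<Longrightarrow> dehom g \<noteq> 0 \<Longrightarrow> dehom h \<noteq> 0 \<Longrightarrow> dehom g * dehom h \<noteq> 0"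
  using A_domain dehom_in_A by blast

lemma nu_mult:
  assumes "homogeneous d g" "homogeneous e h" "dehom g \<noteq> 0" "dehom h \<noteq> 0"
  shows "\<nu> (d + e) (dehom g * dehom h) = \<nu> d (dehom g) + \<nu> e (dehom h)"
  by (intro mult formsI assms)

lemma has_val_unique: assumes "has_val f n" "has_val f m" shows "n = m"
proof -
  obtain d g h where 1: "is_frac d g h" "dehom g \<noteq> 0" "f = frac_class g h" "n = \<nu> d (dehom g) - \<nu> d (dehom h)"
    using assms(1) unfolding has_val_def by blast
  obtain d' g' h' where 2: "is_frac d' g' h'" "dehom g' \<noteq> 0" "f = frac_class g' h'" "m = \<nu> d' (dehom g') - \<nu> d' (dehom h')"
    using assms(2) unfolding has_val_def by blast
  have e: "dehom g * dehom h' = dehom g' * dehom h" using frac_class_eq_iff[OF 1(1) 2(1)] 1(3) 2(3) by simp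
  have "\<nu> d (dehom g) + \<nu> d' (dehom h') = \<nu> (d + d') (dehom g * dehom h')"
    using nu_mult 1 2 by (simp add: is_frac_def)
  also have "\<dots> = \<nu> (d' + d) (dehom g' * dehom h)" unfolding e by (simp add: add.commute)
  also have "\<dots> = \<nu> d' (dehom g') + \<nu> d (dehom h)" using nu_mult 1 2 by (simp add: is_frac_def)
  finally show ?thesis using 1(4) 2(4) by simp
qed

lemma has_val_frac_class: "is_frac d g h \<Longrightarrow> dehom g \<noteq> 0 \<Longrightarrow> has_val (frac_class g h) (\<nu> d (dehom g) - \<nu> d (dehom h))"
  unfolding has_val_def by blast

lemma has_val_exists: assumes "f \<in> carrier K" "f \<noteq> \<zero>\<^bsub>K\<^esub>" shows "\<exists>n. has_val f n"
proof -
  obtain d g h where gh: "is_frac d g h" "f = frac_class g h" using carrierE[OF assms(1)] by blast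
  then have "dehom g \<noteq> 0" using frac_class_zero_iff[OF gh(1)] assms(2) by simp
  then show ?thesis using has_val_frac_class gh by blast
qed

lemma has_val_carrier: "has_val f n \<Longrightarrow> f \<in> carrier K"
  using frac_class_carrier unfolding has_val_def by blast

lemma has_val_nonzero: "has_val f n \<Longrightarrow> f \<noteq> \<zero>\<^bsub>K\<^esub>"
  using frac_class_zero_iff unfolding has_val_def by blast

lemma has_val_mult: assumes "has_val f n" "has_val f' m" shows "has_val (f \<otimes>\<^bsub>K\<^esub> f') (n + m)"
proof -
  obtain d g h where 1: "is_frac d g h" "dehom g \<noteq> 0" "f = frac_class g h" "n = \<nu> d (dehom g) - \<nu> d (dehom h)"
    using assms(1) unfolding has_val_def by blast
  obtain d' g' h' where 2: "is_frac d' g' h'" "dehom g' \<noteq> 0" "f' = frac_class g' h'" "m = \<nu> d' (dehom g') - \<nu> d' (dehom h')"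
    using assms(2) unfolding has_val_def by blast
  have "dehom (g * g') \<noteq> 0" using dehom_mult_nonzero[of d g d' g'] 1 2 by (simp add: dehom_simps is_frac_def)
  note val = has_val_frac_class[OF is_frac_mult[OF 1(1) 2(1)] this]
  have "\<nu> (d + d') (dehom g * dehom g') = \<nu> d (dehom g) + \<nu> d' (dehom g')"
    "\<nu> (d + d') (dehom h * dehom h') = \<nu> d (dehom h) + \<nu> d' (dehom h')"
    using nu_mult 1 2 by (simp_all add: is_frac_def)
  with val show ?thesis unfolding 1(3,4) 2(3,4) frac_class_mult[OF 1(1) 2(1)] dehom_simps
    by (simp add: add_diff_add)
qed

lemma has_val_one: "has_val \<one>\<^bsub>K\<^esub> 0"
  using has_val_frac_class[OF is_frac_1(1)] by (simp add: one_frac_class dehom_simps)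

lemma has_val_inverse: assumes "has_val f n" shows "has_val (inv\<^bsub>K\<^esub> f) (- n)"
proof -
  obtain d g h where 1: "is_frac d g h" "dehom g \<noteq> 0" "f = frac_class g h" "n = \<nu> d (dehom g) - \<nu> d (dehom h)"
    using assms(1) unfolding has_val_def by blast
  have "has_val (frac_class h g) (\<nu> d (dehom h) - \<nu> d (dehom g))"
    using has_val_frac_class[OF is_frac_inverse[OF 1(1,2)]] 1(1) by (simp add: is_frac_def)
  then show ?thesis using 1 frac_class_inv[OF 1(1,2)] by simp
qed

lemma has_val_nat_pow: assumes "has_val f n" shows "has_val (f [^]\<^bsub>K\<^esub> (k::nat)) (int k * n)"
proof (induction k)
  case 0
  show ?case using has_val_one by (simp add: nat_pow_def)
next
  case (Suc k)
  have "f [^]\<^bsub>K\<^esub> Suc k = f [^]\<^bsub>K\<^esub> k \<otimes>\<^bsub>K\<^esub> f" by (simp add: nat_pow_def)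
  then show ?case using has_val_mult[OF Suc assms] by (simp add: algebra_simps)
qed

lemma has_val_int_pow: assumes "has_val f n" shows "has_val (f [^]\<^bsub>K\<^esub> (k::int)) (k * n)"
proof (cases "k < 0")
  case True
  then have "f [^]\<^bsub>K\<^esub> k = inv\<^bsub>K\<^esub> (f [^]\<^bsub>K\<^esub> nat (- k))"
    by (simp only: int_pow_def2 if_True)
  moreover have "- (int (nat (- k)) * n) = k * n" using True by simp
  ultimately show ?thesis using has_val_inverse[OF has_val_nat_pow[OF assms, of "nat (- k)"]] by (simp only:)
next
  case False
  then have "f [^]\<^bsub>K\<^esub> k = f [^]\<^bsub>K\<^esub> nat k"
    by (simp only: int_pow_def2 if_False)
  moreover have "int (nat k) * n = k * n" using False by simp
  ultimately show ?thesis using has_val_nat_pow[OF assms, of "nat k"] by (simp only:)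
qed

lemma K_mult_inverse:
  assumes "has_val f n" "a \<in> carrier K"
  shows "f \<otimes>\<^bsub>K\<^esub> (inv\<^bsub>K\<^esub> f \<otimes>\<^bsub>K\<^esub> a) = a" "inv\<^bsub>K\<^esub> f \<otimes>\<^bsub>K\<^esub> a \<in> carrier K"
proof -
  obtain d g h where 1: "is_frac d g h" "dehom g \<noteq> 0" "f = frac_class g h"
    using assms(1) unfolding has_val_def by blast
  obtain e b c where 2: "is_frac e b c" "a = frac_class b c" using carrierE[OF assms(2)] by blast
  have i: "is_frac d h g" by (rule is_frac_inverse[OF 1(1,2)])
  have m: "inv\<^bsub>K\<^esub> f \<otimes>\<^bsub>K\<^esub> a = frac_class (h * b) (g * c)" using frac_class_mult[OF i 2(1)] frac_class_inv[OF 1(1,2)] 1(3) 2(2) by simp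
  show "inv\<^bsub>K\<^esub> f \<otimes>\<^bsub>K\<^esub> a \<in> carrier K" unfolding m by (rule frac_class_carrier[OF is_frac_mult[OF i 2(1)]])
  show "f \<otimes>\<^bsub>K\<^esub> (inv\<^bsub>K\<^esub> f \<otimes>\<^bsub>K\<^esub> a) = a"
    unfolding m unfolding 1(3) 2(2) frac_class_mult[OF 1(1) is_frac_mult[OF i 2(1)]]
      frac_class_eq_iff[OF is_frac_mult[OF 1(1) is_frac_mult[OF i 2(1)]] 2(1)] dehom_simps by (simp only: ac_simps)
qed

text \<open>Changing the coordinate vector multiplies numerator and denominator by the same power, and two
  representatives have the same cross product on the curve, hence at \<open>v\<close>.\<close>

lemma value_at_frac_class:
  assumes "is_frac d g h" "poly_value h v \<noteq> 0"
  shows "value_at (frac_class g h) pt = poly_value g v / poly_value h v"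
  unfolding value_at_def
proof (rule the_equality)
  have "(g, h) \<in> frac_class g h" using assms(1) by (auto simp: frac_class_mem)
  then show "\<exists>(g', h')\<in>frac_class g h. \<exists>w\<in>pt. poly_value h' w \<noteq> 0 \<and>
      poly_value g v / poly_value h v = poly_value g' w / poly_value h' w"
    using assms(2) mem_proj_point[of v] unfolding pt_def by blast
next
  fix c assume "\<exists>(g', h')\<in>frac_class g h. \<exists>w\<in>pt. poly_value h' w \<noteq> 0 \<and> c = poly_value g' w / poly_value h' w"
  then obtain g' h' w where 1: "(g', h') \<in> frac_class g h" "w \<in> pt" "poly_value h' w \<noteq> 0"
    "c = poly_value g' w / poly_value h' w" by blast
  obtain s where s: "w = s *s v" "s \<noteq> 0" using 1(2) by (auto simp: pt_def proj_point_def)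
  obtain d' where f: "is_frac d' g' h'" and e: "dehom g * dehom h' = dehom g' * dehom h" using 1(1) by (auto simp: frac_class_mem)
  have sc: "poly_value g' w = s ^ d' * poly_value g' v" "poly_value h' w = s ^ d' * poly_value h' v"
    using f poly_value_scale by (auto simp: s is_frac_def)
  then have h'0: "poly_value h' v \<noteq> 0" using 1(3) by auto
  have "homogeneous (d + d') (g * h' - g' * h)"
    using f assms(1) homogeneous_mult[of d g d' h'] homogeneous_mult[of d' g' d h]
    by (intro homogeneous_diff) (auto simp: is_frac_def add.commute)
  moreover have "dehom (g * h' - g' * h) = 0" using e by (simp add: dehom_simps)
  ultimately have "poly_value g v * poly_value h' v = poly_value g' v * poly_value h v"
    using vanishing by (fastforce simp: poly_value_diff poly_value_mult)
  then have "poly_value g v / poly_value h v = poly_value g' v / poly_value h' v"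
    using assms(2) h'0 by (simp add: frac_eq_eq)
  then show "c = poly_value g v / poly_value h v" using s(2) unfolding 1(4) sc by simp
qed

lemma local_ringE:
  assumes "f \<in> local_ring GK pt"
  obtains d g h where "is_frac d g h" "f = frac_class g h" "poly_value h v \<noteq> 0"
proof -
  obtain g h where 1: "f \<in> carrier K" "(g, h) \<in> f" "\<not> vanishes_at h pt"
    using assms unfolding local_ring_def by blast
  obtain d' g' h' where 2: "is_frac d' g' h'" "f = frac_class g' h'" using carrierE[OF 1(1)] by blast
  obtain d where d: "is_frac d g h" "dehom g' * dehom h = dehom g * dehom h'" using 1(2) 2(2) by (auto simp: frac_class_mem)
  have "f = frac_class g h" unfolding 2(2) frac_class_eq_iff[OF 2(1) d(1)] by (rule d(2))
  moreover have "poly_value h v \<noteq> 0"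
    using 1(3) d(1) vanishes_at_proj_point[of d h v] by (simp add: is_frac_def pt_def)
  ultimately show thesis using d(1) by (intro that)
qed

lemma local_ringI: assumes "is_frac d g h" "poly_value h v \<noteq> 0" shows "frac_class g h \<in> local_ring GK pt"
proof -
  have "(g, h) \<in> frac_class g h" using assms(1) by (auto simp: frac_class_mem)
  moreover have "\<not> vanishes_at h pt"
    using assms vanishes_at_proj_point[of d h v] by (simp add: is_frac_def pt_def)
  ultimately show ?thesis unfolding local_ring_def using frac_class_carrier[OF assms(1)] by blast
qed

text \<open>A representative whose denominator does not vanish at the point has a denominator of value zero.
  Conversely the assumption \<open>quotient\<close> supplies such a representative.\<close>

lemma has_val_local_ring: assumes "has_val f n" shows "f \<in> local_ring GK pt \<longleftrightarrow> n \<ge> 0"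
proof
  assume "f \<in> local_ring GK pt"
  then obtain d g h where 1: "is_frac d g h" "f = frac_class g h" "poly_value h v \<noteq> 0" by (rule local_ringE)
  have g0: "dehom g \<noteq> 0" using has_val_nonzero[OF assms] frac_class_zero_iff[OF 1(1)] 1(2) by simp
  have "\<nu> d (dehom h) = 0" using unit_iff[of d h] 1 by (simp add: is_frac_def)
  then have "n = \<nu> d (dehom g)" using has_val_unique[OF assms] has_val_frac_class[OF 1(1) g0] 1(2) by simp
  then show "n \<ge> 0" using nonneg[of "dehom g" d] formsI 1(1) g0 by (simp add: is_frac_def)
next
  assume n: "n \<ge> 0"
  obtain d g h where 1: "is_frac d g h" "dehom g \<noteq> 0" "f = frac_class g h" "n = \<nu> d (dehom g) - \<nu> d (dehom h)"
    using assms(1) unfolding has_val_def by blast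
  have "dehom g \<in> forms d" "dehom h \<in> forms d" "dehom h \<noteq> 0" "\<nu> d (dehom h) \<le> \<nu> d (dehom g)"
    using 1 n formsI by (auto simp: is_frac_def)
  from quotient[OF this(1,2) 1(2) this(3,4)] obtain D a' b' where 2: "a' \<in> forms D" "b' \<in> forms D" "b' \<noteq> 0"
    "\<nu> D b' = 0" "dehom g * b' = a' * dehom h" by blast
  obtain g' h' where 3: "a' = dehom g'" "homogeneous D g'" "b' = dehom h'" "homogeneous D h'"
    using 2(1,2) by (auto simp: forms_def)
  have f': "is_frac D g' h'" using 2 3 by (simp add: is_frac_def)
  have "f = frac_class g' h'" unfolding 1(3) frac_class_eq_iff[OF 1(1) f'] using 2(5) 3 by simp
  moreover have "poly_value h' v \<noteq> 0" using unit_iff[OF 3(4)] 2 3 by simp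
  ultimately show "f \<in> local_ring GK pt" using local_ringI[OF f'] by simp
qed

lemma zero_local: "\<zero>\<^bsub>K\<^esub> \<in> local_ring GK pt" "value_at \<zero>\<^bsub>K\<^esub> pt = 0"
  using local_ringI[OF is_frac_1(2)] value_at_frac_class[OF is_frac_1(2)] unfolding zero_frac_class by simp_all

lemma has_val_maximal: assumes "has_val f n" shows "f \<in> local_maximal_ideal GK pt \<longleftrightarrow> n > 0"
proof (cases "n \<ge> 0")
  case False
  then show ?thesis using has_val_local_ring[OF assms] by (simp add: local_maximal_ideal_def)
next
  case True
  then have l: "f \<in> local_ring GK pt" using has_val_local_ring[OF assms] by simp
  then obtain d g h where 1: "is_frac d g h" "f = frac_class g h" "poly_value h v \<noteq> 0" by (rule local_ringE)
  have g0: "dehom g \<noteq> 0" using has_val_nonzero[OF assms] frac_class_zero_iff[OF 1(1)] 1(2) by simp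
  have "\<nu> d (dehom h) = 0" using unit_iff[of d h] 1 by (simp add: is_frac_def)
  then have n: "n = \<nu> d (dehom g)" using has_val_unique[OF assms] has_val_frac_class[OF 1(1) g0] 1(2) by simp
  have "f \<in> local_maximal_ideal GK pt \<longleftrightarrow> poly_value g v = 0"
    using l value_at_frac_class[OF 1(1,3)] 1(2,3) by (simp add: local_maximal_ideal_def)
  also have "\<dots> \<longleftrightarrow> n \<noteq> 0" using unit_iff[of d g] 1(1) g0 n by (simp add: is_frac_def)
  finally show ?thesis using True by auto
qed

lemma zero_maximal: "\<zero>\<^bsub>K\<^esub> \<in> local_maximal_ideal GK pt"
  using zero_local by (simp add: local_maximal_ideal_def)

lemma local_carrier: "f \<in> local_ring GK pt \<Longrightarrow> f \<in> carrier K"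
  by (simp add: local_ring_def)

lemma K_mult_zero: assumes "has_val f n" shows "f \<otimes>\<^bsub>K\<^esub> \<zero>\<^bsub>K\<^esub> = \<zero>\<^bsub>K\<^esub>"
proof -
  obtain d g h where 1: "is_frac d g h" "f = frac_class g h"
    using assms(1) unfolding has_val_def by blast
  show ?thesis unfolding 1(2) zero_frac_class frac_class_mult[OF 1(1) is_frac_1(2)]
    using frac_class_eq_iff[OF is_frac_mult[OF 1(1) is_frac_1(2)] is_frac_1(2)] by (simp add: dehom_simps)
qed

lemma exists_has_val_1: "\<exists>t. has_val t 1"
proof -
  obtain l l' where l: "l \<in> forms 1" "l' \<in> forms 1" "l \<noteq> 0" "l' \<noteq> 0" "\<nu> 1 l = 1" "\<nu> 1 l' = 0"
    using parameter by blast
  then obtain g h where "l = dehom g" "homogeneous 1 g" "l' = dehom h" "homogeneous 1 h" by (auto simp: forms_def)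
  then show ?thesis using has_val_frac_class[of 1 g h] l by (auto simp: is_frac_def)
qed

text \<open>If \<open>t\<close> generates the maximal ideal, then it divides a function of value one, and its own value is positive.\<close>

lemma uniformizer_iff: "uniformizer GK pt t \<longleftrightarrow> has_val t 1"
proof
  assume t: "has_val t 1"
  have "local_maximal_ideal GK pt = {t \<otimes>\<^bsub>K\<^esub> a | a. a \<in> local_ring GK pt}"
  proof (intro equalityI subsetI)
    fix f assume f: "f \<in> local_maximal_ideal GK pt"
    then have fc: "f \<in> carrier K" using local_carrier by (simp add: local_maximal_ideal_def)
    show "f \<in> {t \<otimes>\<^bsub>K\<^esub> a | a. a \<in> local_ring GK pt}"
    proof (cases "f = \<zero>\<^bsub>K\<^esub>")
      case True
      then show ?thesis using K_mult_zero[OF t] zero_local by (metis (mono_tags, lifting) mem_Collect_eq)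
    next
      case False
      then obtain n where n: "has_val f n" using has_val_exists fc by blast
      then have n1: "n > 0" using has_val_maximal f by simp
      define a where "a = inv\<^bsub>K\<^esub> t \<otimes>\<^bsub>K\<^esub> f"
      have "has_val a (- 1 + n)" unfolding a_def by (rule has_val_mult[OF has_val_inverse[OF t] n])
      then have "a \<in> local_ring GK pt" using has_val_local_ring n1 by simp
      moreover have "f = t \<otimes>\<^bsub>K\<^esub> a" using K_mult_inverse[OF t fc] by (simp add: a_def)
      ultimately show ?thesis by blast
    qed
  next
    fix f assume "f \<in> {t \<otimes>\<^bsub>K\<^esub> a | a. a \<in> local_ring GK pt}"
    then obtain a where a: "f = t \<otimes>\<^bsub>K\<^esub> a" "a \<in> local_ring GK pt" by blast
    show "f \<in> local_maximal_ideal GK pt"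
    proof (cases "a = \<zero>\<^bsub>K\<^esub>")
      case True
      then show ?thesis using a K_mult_zero[OF t] zero_maximal by simp
    next
      case False
      then obtain n where n: "has_val a n" using has_val_exists local_carrier[OF a(2)] by blast
      then have "n \<ge> 0" using has_val_local_ring a(2) by simp
      then show ?thesis using has_val_maximal[OF has_val_mult[OF t n]] a(1) by simp
    qed
  qed
  then show "uniformizer GK pt t" unfolding uniformizer_def using has_val_local_ring[OF t] by simp
next
  assume u: "uniformizer GK pt t"
  then have tl: "t \<in> local_ring GK pt"
    and m: "local_maximal_ideal GK pt = {t \<otimes>\<^bsub>K\<^esub> a | a. a \<in> local_ring GK pt}"
    by (simp_all add: uniformizer_def)
  obtain t0 where t0: "has_val t0 1" using exists_has_val_1 by blast
  then have "t0 \<in> local_maximal_ideal GK pt" using has_val_maximal by simp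
  then obtain a where a: "t0 = t \<otimes>\<^bsub>K\<^esub> a" "a \<in> local_ring GK pt" unfolding m by blast
  have z1: "\<zero>\<^bsub>K\<^esub> \<otimes>\<^bsub>K\<^esub> f = \<zero>\<^bsub>K\<^esub>" if fc: "f \<in> carrier K" for f
  proof -
    obtain d g h where 1: "is_frac d g h" "f = frac_class g h" using carrierE[OF fc] by blast
    show ?thesis unfolding 1(2) zero_frac_class frac_class_mult[OF is_frac_1(2) 1(1)]
      using frac_class_eq_iff[OF is_frac_mult[OF is_frac_1(2) 1(1)] is_frac_1(2)] by (simp add: dehom_simps)
  qed
  have tnz: "t \<noteq> \<zero>\<^bsub>K\<^esub>" using z1[OF local_carrier[OF a(2)]] a(1) has_val_nonzero[OF t0] by auto
  then obtain n where n: "has_val t n" using has_val_exists local_carrier[OF tl] by blast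
  have anz: "a \<noteq> \<zero>\<^bsub>K\<^esub>" using K_mult_zero[OF n] a(1) has_val_nonzero[OF t0] by auto
  then obtain k where k: "has_val a k" using has_val_exists local_carrier[OF a(2)] by blast
  have "1 = n + k" using has_val_unique[OF t0] has_val_mult[OF n k] a(1) by simp
  moreover have "k \<ge> 0" using has_val_local_ring[OF k] a(2) by simp
  moreover have "n > 0"
  proof -
    have "\<one>\<^bsub>K\<^esub> \<in> local_ring GK pt" using has_val_local_ring[OF has_val_one] by simp
    then have "t \<otimes>\<^bsub>K\<^esub> \<one>\<^bsub>K\<^esub> \<in> local_maximal_ideal GK pt" unfolding m by blast
    then show ?thesis using has_val_maximal[OF has_val_mult[OF n has_val_one]] by simp
  qed
  ultimately show "has_val t 1" using n by (metis add_cancel_right_right add_le_cancel_left dual_order.antisym zless_imp_add1_zle add_0 add.commute)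
qed

text \<open>A function of value \<open>n\<close> is \<open>t ^ n\<close> times a unit for any \<open>t\<close> of value one, and every uniformizer has
  value one.\<close>

theorem order_at_eq: assumes "has_val f n" shows "order_at GK pt f = n"
  unfolding order_at_def
proof (rule the_equality)
  obtain t where t: "has_val t 1" using exists_has_val_1 by blast
  have tn: "has_val (t [^]\<^bsub>K\<^esub> n) n" using has_val_int_pow[OF t, of n] by simp
  define u where "u = inv\<^bsub>K\<^esub> (t [^]\<^bsub>K\<^esub> n) \<otimes>\<^bsub>K\<^esub> f"
  have "has_val u (- n + n)" unfolding u_def by (rule has_val_mult[OF has_val_inverse[OF tn] assms])
  then have u: "u \<in> local_ring GK pt - local_maximal_ideal GK pt" using has_val_local_ring has_val_maximal by simp
  have "f = (t [^]\<^bsub>K\<^esub> n) \<otimes>\<^bsub>K\<^esub> u" using K_mult_inverse[OF tn has_val_carrier[OF assms]] by (simp add: u_def)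
  then show "\<exists>t u. uniformizer GK pt t \<and> u \<in> local_ring GK pt - local_maximal_ideal GK pt \<and>
      f = (t [^]\<^bsub>K\<^esub> n) \<otimes>\<^bsub>K\<^esub> u"
    using u t uniformizer_iff by blast
next
  fix k :: int
  assume "\<exists>t u. uniformizer GK pt t \<and> u \<in> local_ring GK pt - local_maximal_ideal GK pt \<and>
      f = (t [^]\<^bsub>K\<^esub> k) \<otimes>\<^bsub>K\<^esub> u"
  then obtain t u where t: "has_val t 1" and u: "u \<in> local_ring GK pt" "u \<notin> local_maximal_ideal GK pt"
    and f: "f = (t [^]\<^bsub>K\<^esub> k) \<otimes>\<^bsub>K\<^esub> u" using uniformizer_iff by blast
  have "u \<noteq> \<zero>\<^bsub>K\<^esub>" using u(2) zero_maximal by auto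
  then obtain j where j: "has_val u j" using has_val_exists local_carrier[OF u(1)] by blast
  then have "j = 0" using has_val_local_ring has_val_maximal u by fastforce
  then have "has_val f k" using has_val_mult[OF has_val_int_pow[OF t, of k] j] f by simp
  then show "k = n" using has_val_unique assms by blast
qed

end

context gk
begin

lemma affine_place: "gk_place q (cvec P) (\<lambda>d a. int (ord_at P a))"
proof unfold_locales
  fix d g assume "homogeneous d g" "dehom g = 0"
  then show "poly_value g (cvec P) = 0" by (simp add: dehom_apply[symmetric] fn_app)
next
  fix d g assume "homogeneous d g" "dehom g \<noteq> 0"
  then show "int (ord_at P (dehom g)) = 0 \<longleftrightarrow> poly_value g (cvec P) \<noteq> 0"
    using ord_at_zero_iff dehom_in_A by (simp add: dehom_apply)
next
  fix d e a b assume "a \<in> forms d" "a \<noteq> 0" "b \<in> forms e" "b \<noteq> 0"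
  then show "int (ord_at P (a * b)) = int (ord_at P a) + int (ord_at P b)"
    using ord_at_mult forms_in_A by simp
next
  have "cz - cst (cz P) \<in> forms 1" by (intro forms_diff forms_basic forms_mono[OF forms_basic(3)]) simp
  moreover have "ord_at P 1 = 0" using ord_at_zero_iff[of 1 P] by (simp add: fn_app)
  ultimately show "\<exists>l\<in>forms 1. \<exists>l'\<in>forms 1. l \<noteq> 0 \<and> l' \<noteq> 0 \<and> int (ord_at P l) = 1 \<and> int (ord_at P l') = 0"
    using forms_basic(7) ord_at_z z_minus_nonzero by (metis int_ops(2) of_nat_0 zero_neq_one)
next
  fix d a b assume ab: "a \<in> forms d" "b \<in> forms d" "a \<noteq> 0" "b \<noteq> 0" "int (ord_at P b) \<le> int (ord_at P a)"
  then obtain e s where es: "e \<in> A" "s \<in> A" "e P \<noteq> 0" "e * a = s * b"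
    using local_quotient[of a b P] forms_in_A by auto
  obtain d1 d2 where "e \<in> forms d1" "s \<in> forms d2" using A_in_forms es by blast
  then have f: "e \<in> forms (d1 + d2)" "s \<in> forms (d1 + d2)" using forms_mono by simp_all
  have e0: "e \<noteq> 0" using es(3) by (auto simp: fn_app)
  then have "ord_at P e = 0" using ord_at_zero_iff[OF es(1)] es(3) by simp
  then show "\<exists>D. \<exists>a'\<in>forms D. \<exists>b'\<in>forms D. b' \<noteq> 0 \<and> int (ord_at P b') = 0 \<and> a * b' = a' * b"
    using f e0 es(4) by (metis mult.commute of_nat_0)
qed simp

definition weight :: "'f gk_fun \<Rightarrow> nat" where "weight a = (THE w. has_weight a w)"

lemma weight_eqI: "has_weight a w \<Longrightarrow> weight a = w"
  unfolding weight_def using has_weight_unique by blast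

lemma has_weight_weight: "a \<in> A \<Longrightarrow> a \<noteq> 0 \<Longrightarrow> has_weight a (weight a)"
  using has_weight_exists weight_eqI by metis

text \<open>The pole order at infinity of a form of degree \<open>d\<close> is at most that of \<open>x ^ d\<close>; its multiplicity there is the defect.\<close>

definition inf_ord :: "nat \<Rightarrow> 'f gk_fun \<Rightarrow> int" where
  "inf_ord d a = int (d * (q ^ 3 + 1)) - int (weight a)"

text \<open>For the quotient of two forms both are multiplied by forms not vanishing at infinity so that powers of \<open>z\<close>
  split off (\<open>infinity_expansion\<close>), and the power in the denominator is cancelled.\<close>

lemma infinite_place: "gk_place q ivec inf_ord"
proof unfold_locales
  fix d g assume "homogeneous d g" "dehom g = 0"
  then show "poly_value g ivec = 0" by (rule infinity_vanishing)
next
  fix d a assume "a \<in> forms d" "a \<noteq> 0"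
  then have "weight a \<le> d * (q ^ 3 + 1)" using form_weight_le has_weight_weight forms_in_A by blast
  then show "0 \<le> inf_ord d a" unfolding inf_ord_def diff_ge_0_iff_ge of_nat_le_iff .
next
  fix d g assume g: "homogeneous d g" "dehom g \<noteq> 0"
  have w: "has_weight (dehom g) (weight (dehom g))" by (rule has_weight_weight[OF dehom_in_A[OF g(1)] g(2)])
  have "inf_ord d (dehom g) = 0 \<longleftrightarrow> weight (dehom g) = d * (q ^ 3 + 1)"
    unfolding inf_ord_def right_minus_eq of_nat_eq_iff by (rule eq_commute)
  also have "\<dots> \<longleftrightarrow> has_weight (dehom g) (d * (q ^ 3 + 1))" using w weight_eqI by metis
  finally have "inf_ord d (dehom g) = 0 \<longleftrightarrow> has_weight (dehom g) (d * (q ^ 3 + 1))" .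
  then show "inf_ord d (dehom g) = 0 \<longleftrightarrow> poly_value g ivec \<noteq> 0" using infinity_iff_has_weight[OF g(1)] by simp
next
  fix d e a b assume "a \<in> forms d" "a \<noteq> 0" "b \<in> forms e" "b \<noteq> 0"
  then have "weight (a * b) = weight a + weight b" using forms_in_A by (intro weight_eqI has_weight_mult has_weight_weight) auto
  then show "inf_ord (d + e) (a * b) = inf_ord d a + inf_ord e b" by (simp add: inf_ord_def algebra_simps)
next
  have "has_weight (cz :: 'f gk_fun) (q ^ 3)" using has_weight_zpoly[of "[:0, 1:]"] by (simp add: zpoly_def)
  then have z: "weight (cz :: 'f gk_fun) = q ^ 3" "(cz :: 'f gk_fun) \<noteq> 0" using weight_eqI has_weight_nonzero by blast+
  have "has_weight (mon 1 0 0) (mon_weight 1 0 0)" by (intro has_weightI[of 1 1 0 0]) (simp_all add: below_zero)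
  then have "has_weight (cx :: 'f gk_fun) (q ^ 3 + 1)" by (simp add: mon_def mon_weight_def)
  then have x: "weight (cx :: 'f gk_fun) = q ^ 3 + 1" "(cx :: 'f gk_fun) \<noteq> 0" using weight_eqI has_weight_nonzero by blast+
  show "\<exists>l\<in>forms 1. \<exists>l'\<in>forms 1. l \<noteq> 0 \<and> l' \<noteq> 0 \<and> inf_ord 1 l = 1 \<and> inf_ord 1 l' = 0"
    by (rule bexI[of _ cz], rule bexI[of _ cx]) (use x z forms_basic in \<open>simp_all add: inf_ord_def\<close>)
next
  fix d a b assume ab: "a \<in> forms d" "b \<in> forms d" "a \<noteq> 0" "b \<noteq> 0" "inf_ord d b \<le> inf_ord d a"
  have la: "has_weight a (weight a)" "has_weight b (weight b)" using has_weight_weight ab forms_in_A by blast+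
  have le: "weight a \<le> weight b" "weight a \<le> d * (q ^ 3 + 1)" "weight b \<le> d * (q ^ 3 + 1)"
    using ab(5) form_weight_le[OF ab(1) la(1)] form_weight_le[OF ab(2) la(2)] by (simp_all add: inf_ord_def)
  define n m where "n = d * (q ^ 3 + 1) - weight b" and "m = d * (q ^ 3 + 1) - weight a"
  have nm: "n \<le> m" "d * (q ^ 3 + 1) = weight b + n" "d * (q ^ 3 + 1) = weight a + m" using le by (auto simp: n_def m_def)
  obtain D D' e b1 where 1: "e \<in> forms D" "has_weight e (D * (q ^ 3 + 1))" "b1 \<in> forms D'"
    "has_weight b1 (D' * (q ^ 3 + 1))" "D' + n = D + d" "e * b = cz ^ n * b1"
    using infinity_expansion[OF ab(2) la(2) nm(2)] by blast
  obtain E E' f a1 where 2: "f \<in> forms E" "has_weight f (E * (q ^ 3 + 1))" "a1 \<in> forms E'"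
    "has_weight a1 (E' * (q ^ 3 + 1))" "E' + m = E + d" "f * a = cz ^ m * a1"
    using infinity_expansion[OF ab(1) la(1) nm(3)] by blast
  have lb: "has_weight (f * b1) ((E + D') * (q ^ 3 + 1))" using has_weight_mult[OF 2(2) 1(4)] by (simp only: distrib_right)
  have fb: "f * b1 \<in> forms (E + D')" by (rule forms_mult[OF 2(1) 1(3)])
  have z: "(cz :: 'f gk_fun) ^ (m - n) \<in> forms (m - n)" using forms_power[OF forms_basic(6), of "m - n"] by simp
  have deg: "m - n + E' + D = E + D'" using 1(5) 2(5) nm(1) by simp
  have fa: "cz ^ (m - n) * a1 * e \<in> forms (E + D')"
    using forms_mult[OF forms_mult[OF z 2(3)] 1(1)] unfolding deg .
  have zz: "(cz :: 'f gk_fun) ^ m = cz ^ (m - n) * cz ^ n" using nm(1) by (simp flip: power_add)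
  have "a * (f * b1) = (f * a) * b1" by (simp only: ac_simps)
  also have "\<dots> = (cz ^ (m - n) * a1) * (cz ^ n * b1)" unfolding 2(6) zz by (simp only: ac_simps)
  also have "\<dots> = (cz ^ (m - n) * a1 * e) * b" unfolding 1(6)[symmetric] by (simp only: ac_simps)
  finally have eq: "a * (f * b1) = (cz ^ (m - n) * a1 * e) * b" .
  have "inf_ord (E + D') (f * b1) = 0" unfolding inf_ord_def weight_eqI[OF lb] by simp
  then show "\<exists>D. \<exists>a'\<in>forms D. \<exists>b'\<in>forms D. b' \<noteq> 0 \<and> inf_ord D b' = 0 \<and> a * b' = a' * b"
    using fa fb has_weight_nonzero[OF lb] eq by blast
qed

end

section \<open>The code\<close>

context gk
begin

lemma aff_point_inj: assumes "aff_point P = aff_point Q" shows "P = Q"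
proof -
  have "cvec P \<in> aff_point Q" using mem_proj_point[of "cvec P"] assms by (simp add: aff_point_def)
  then obtain c where c: "cvec P = c *s cvec Q" by (auto simp: aff_point_def proj_point_def)
  have e: "vec_nth (cvec P) i = c * vec_nth (cvec Q) i" for i by (simp add: c)
  have "c = 1" using e[of 4] by (simp add: cvec_def)
  then show ?thesis using e[of 1] e[of 2] e[of 3] by (intro gk_point_eqI) (simp_all add: cvec_def)
qed

lemma aff_point_not_inf: "aff_point P \<noteq> inf_point"
proof
  assume "aff_point P = inf_point"
  then have "cvec P \<in> inf_point" using mem_proj_point[of "cvec P"] by (simp add: aff_point_def)
  then obtain c where c: "cvec P = c *s ivec" by (auto simp: inf_point_def proj_point_def)
  have "vec_nth (cvec P) 4 = c * vec_nth ivec 4" by (simp add: c)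
  then show False by (simp add: cvec_def ivec_def)
qed

abbreviation Fq :: "nat \<Rightarrow> 'f alg_closure set" where "Fq j \<equiv> finite_subfield (q ^ j)"

lemma Fq_closed:
  "0 \<in> Fq j" "1 \<in> Fq j" "a \<in> Fq j \<Longrightarrow> b \<in> Fq j \<Longrightarrow> a + b \<in> Fq j"
  "a \<in> Fq j \<Longrightarrow> b \<in> Fq j \<Longrightarrow> a * b \<in> Fq j" "a \<in> Fq j \<Longrightarrow> - a \<in> Fq j"
  "a \<in> Fq j \<Longrightarrow> b \<in> Fq j \<Longrightarrow> a / b \<in> Fq j"
  using q_gt_1 by (simp_all add: finite_subfield_def frob_add frob_minus power_mult_distrib power_divide power_0_left)

lemma rational_points_eq: "rational_points (Fq j) GK = insert inf_point (aff_point ` rational (q ^ j))"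
proof -
  have "(\<exists>v\<in>inf_point. \<forall>i. vec_nth v i \<in> Fq j)"
    using Fq_closed mem_proj_point[of ivec] by (intro bexI[of _ ivec]) (simp_all add: ivec_def forall_4 inf_point_def)
  moreover have "(\<exists>v\<in>aff_point P. \<forall>i. vec_nth v i \<in> Fq j) \<longleftrightarrow> P \<in> rational (q ^ j)" for P
  proof
    assume "\<exists>v\<in>aff_point P. \<forall>i. vec_nth v i \<in> Fq j"
    then obtain c where c: "c \<noteq> 0" "\<forall>i. vec_nth (c *s cvec P) i \<in> Fq j"
      by (auto simp: aff_point_def proj_point_def)
    then have 1: "c * cx P \<in> Fq j" "c * cy P \<in> Fq j" "c * cz P \<in> Fq j" "c \<in> Fq j"
      by (simp_all add: forall_4 cvec_def)
    show "P \<in> rational (q ^ j)"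
      using Fq_closed(6)[OF 1(1,4)] Fq_closed(6)[OF 1(2,4)] Fq_closed(6)[OF 1(3,4)] c(1)
      by (simp add: rational_def)
  next
    assume "P \<in> rational (q ^ j)"
    then show "\<exists>v\<in>aff_point P. \<forall>i. vec_nth v i \<in> Fq j"
      using Fq_closed mem_proj_point[of "cvec P"]
      by (intro bexI[of _ "cvec P"]) (simp_all add: cvec_def forall_4 rational_def aff_point_def)
  qed
  ultimately show ?thesis unfolding rational_points_def gk_curve_eq by auto
qed

lemma code_points_eq: "rational_points (Fq 6) GK - rational_points (Fq 2) GK = aff_point ` (rational (q ^ 6) - rational (q ^ 2))"
  unfolding rational_points_eq using aff_point_inj aff_point_not_inf by (auto simp: image_iff)

lemma finite_rational_points_q2: "finite (rational_points (Fq 2) GK)"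
  and card_rational_points_q2: "card (rational_points (Fq 2) GK) = q ^ 3 + 1"
proof -
  show "finite (rational_points (Fq 2) GK)" unfolding rational_points_eq using finite_rational_q2 by simp
  have "inf_point \<notin> aff_point ` rational (q ^ 2)" using aff_point_not_inf by (metis imageE)
  moreover have "card (aff_point ` rational (q ^ 2)) = q ^ 3"
    using card_image[of aff_point "rational (q ^ 2)"] aff_point_inj card_rational_q2 by (simp add: inj_on_def)
  ultimately show "card (rational_points (Fq 2) GK) = q ^ 3 + 1"
    unfolding rational_points_eq using finite_rational_q2 by simp
qed

lemma ord_at_power: "a \<in> A \<Longrightarrow> a \<noteq> 0 \<Longrightarrow> ord_at P (a ^ n) = n * ord_at P a"
proof (induction n)
  case 0
  have "ord_at P 1 = 0" using ord_at_zero_iff[of 1 P] by (simp add: fn_app)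
  then show ?case by (simp only: power_0 mult_0)
next
  case (Suc n)
  then show ?case using ord_at_mult[of a "a ^ n" P] A_power_nonzero[of a n] by (simp add: A_power)
qed

lemma cz_nonzero: "(cz :: 'f gk_fun) \<noteq> 0"
  using z_not_constant[of 0] by simp

lemma ord_at_cz: "ord_at P cz = (if P \<in> rational (q ^ 2) then 1 else 0)"
proof (cases "P \<in> rational (q ^ 2)")
  case True
  then have "cz P = 0" using zero_z_iff by blast
  then show ?thesis using True ord_at_z[of P] by simp
next
  case False
  then have "cz P \<noteq> 0" using zero_z_iff by blast
  then show ?thesis using False ord_at_zero_iff[of cz P] cz_nonzero by simp
qed

lemma weight_mult: "a \<in> A \<Longrightarrow> a \<noteq> 0 \<Longrightarrow> b \<in> A \<Longrightarrow> b \<noteq> 0 \<Longrightarrow> weight (a * b) = weight a + weight b"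
  by (intro weight_eqI has_weight_mult has_weight_weight)

lemma has_weight_cz: "has_weight (cz :: 'f gk_fun) (q ^ 3)"
  using has_weight_zpoly[of "[:0, 1:]"] by (simp add: zpoly_def)

lemma has_weight_power: "has_weight a w \<Longrightarrow> has_weight (a ^ n) (n * w)"
proof (induction n)
  case (Suc n)
  then show ?case using has_weight_mult[of a w "a ^ n" "n * w"] by simp
qed (simp add: has_weight_1)

lemma order_at_affine:
  assumes "is_frac d g h" "dehom g \<noteq> 0"
  shows "order_at GK (aff_point P) (frac_class g h) = int (ord_at P (dehom g)) - int (ord_at P (dehom h))"
proof -
  interpret pl: gk_place q F "cvec P" "\<lambda>d a. int (ord_at P a)" by (rule affine_place)
  show ?thesis using pl.order_at_eq[OF pl.has_val_frac_class[OF assms]] by (simp add: pl.pt_def aff_point_def)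
qed

lemma order_at_infinity:
  assumes "is_frac d g h" "dehom g \<noteq> 0"
  shows "order_at GK inf_point (frac_class g h) = int (weight (dehom h)) - int (weight (dehom g))"
proof -
  interpret pl: gk_place q F ivec inf_ord by (rule infinite_place)
  show ?thesis using pl.order_at_eq[OF pl.has_val_frac_class[OF assms]] by (simp add: pl.pt_def inf_point_def inf_ord_def)
qed

lemma value_at_affine:
  assumes "is_frac d g h" "dehom h P \<noteq> 0"
  shows "value_at (frac_class g h) (aff_point P) = dehom g P / dehom h P"
proof -
  interpret pl: gk_place q F "cvec P" "\<lambda>d a. int (ord_at P a)" by (rule affine_place)
  show ?thesis using pl.value_at_frac_class[OF assms(1)] assms(2) by (simp add: pl.pt_def aff_point_def dehom_apply)
qed

lemma regular_at_affine:
  assumes "is_frac d g h" "dehom g \<noteq> 0" "ord_at P (dehom h) \<le> ord_at P (dehom g)"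
  obtains d' g' h' where "is_frac d' g' h'" "frac_class g h = frac_class g' h'" "dehom h' P \<noteq> 0"
proof -
  interpret pl: gk_place q F "cvec P" "\<lambda>d a. int (ord_at P a)" by (rule affine_place)
  have "frac_class g h \<in> local_ring GK pl.pt" using pl.has_val_local_ring[OF pl.has_val_frac_class[OF assms(1,2)]] assms(3) by simp
  then show thesis using pl.local_ringE that unfolding dehom_apply by metis
qed

definition code_divisor :: "nat \<Rightarrow> ('f alg_closure ^ 4) set divisor" where
  "code_divisor m = (\<Sum>P \<in> rational_points (Fq 2) GK. frag_cmul (int m) (frag_of P))"

lemma lookup_code_divisor: "lkp (code_divisor m) P = (if P \<in> rational_points (Fq 2) GK then int m else 0)"
proof -
  have "lkp (code_divisor m) P = (\<Sum>Q \<in> rational_points (Fq 2) GK. if P = Q then int m else 0)"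
    unfolding code_divisor_def lookup_sum by (intro sum.cong) auto
  then show ?thesis using finite_rational_points_q2 by simp
qed

lemma degree_code_divisor: "divisor_degree (code_divisor m) = int m * (int q ^ 3 + 1)"
proof -
  have "divisor_degree (code_divisor m) = (\<Sum>P\<in>rational_points (Fq 2) GK. lkp (code_divisor m) P)"
    unfolding divisor_degree_def
    by (rule sum.mono_neutral_left) (auto simp: finite_rational_points_q2 lookup_code_divisor in_keys_iff split: if_splits)
  also have "\<dots> = int (card (rational_points (Fq 2) GK)) * int m" by (simp add: lookup_code_divisor)
  finally show ?thesis unfolding card_rational_points_q2 by (simp add: algebra_simps)
qed

lemma lookup_code_divisor_aff_point: "lkp (code_divisor m) (aff_point P) = (if P \<in> rational (q ^ 2) then int m else 0)"
  unfolding lookup_code_divisor rational_points_eq using aff_point_inj aff_point_not_inf by (auto simp: image_iff)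

lemma lookup_code_divisor_inf: "lkp (code_divisor m) inf_point = int m"
  unfolding lookup_code_divisor rational_points_eq by simp

text \<open>At the affine points in the support of \<open>G\<close> the function \<open>z\<close> has order one, so \<open>f * z ^ m\<close> is regular at
  all affine points and therefore a polynomial \<open>a\<close>. The condition at infinity bounds the weight of \<open>a\<close>. Expressing this by
  membership in \<open>below\<close> includes the zero function.\<close>

lemma riemann_roch_polynomial:
  assumes "f \<in> riemann_roch_space k GK (code_divisor m)"
  shows "\<exists>a. a \<in> below (Suc (m * (q ^ 3 + 1))) \<and>
    (\<forall>P. P \<notin> rational (q ^ 2) \<longrightarrow> value_at f (aff_point P) * cz P ^ m = a P)"
proof (cases "f = \<zero>\<^bsub>K\<^esub>")
  case True
  have "value_at f (aff_point P) = 0" for P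
    using value_at_affine[OF is_frac_1(2), of P] unfolding True zero_frac_class by (simp add: dehom_simps fn_app)
  then show ?thesis using below_zero by (intro exI[of _ 0]) (simp add: fn_app)
next
  case False
  then have fK: "f \<in> carrier K" and ord: "\<And>P. P \<in> GK \<Longrightarrow> order_at GK P f + lkp (code_divisor m) P \<ge> 0"
    using assms by (auto simp: riemann_roch_space_def function_field_over_def)
  obtain d g h where gh: "is_frac d g h" "f = frac_class g h" using carrierE[OF fK] by blast
  have g0: "dehom g \<noteq> 0" using False frac_class_zero_iff[OF gh(1)] gh(2) by simp
  have h0: "dehom h \<noteq> 0" using gh(1) by (simp add: is_frac_def)
  have gA: "dehom g \<in> A" "dehom h \<in> A" using is_frac_in_A[OF gh(1)] by auto
  have zm: "(cz :: 'f gk_fun) ^ m \<in> A" "(cz :: 'f gk_fun) ^ m \<noteq> 0"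
    using A_power_nonzero[OF _ cz_nonzero] by (auto intro: A_power)
  define b where "b = dehom g * cz ^ m"
  have bA: "b \<in> A" "b \<noteq> 0" unfolding b_def using A_mult[OF gA(1) zm(1)] A_domain[OF gA(1) zm(1)] g0 zm(2) by auto
  have oaff: "int (ord_at P (dehom g)) - int (ord_at P (dehom h)) + (if P \<in> rational (q ^ 2) then int m else 0) \<ge> 0" for P
    using ord[of "aff_point P"] order_at_affine[OF gh(1) g0, of P] lookup_code_divisor_aff_point[of m P]
    unfolding gh(2) gk_curve_eq by simp
  have ob: "ord_at P (dehom h) \<le> ord_at P b" for P
    using oaff[of P] unfolding b_def ord_at_mult[OF gA(1) g0 zm] ord_at_power[OF A_xyz(3) cz_nonzero] ord_at_cz
    by (simp split: if_splits)
  obtain c dd where c: "c \<in> A" "dd \<noteq> 0" "dehom h * c = zpoly dd" using multiple_poly[OF gA(2) h0] by blast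
  have c0: "c \<noteq> 0" using c(3) zpoly_nonzero[OF c(2)] by auto
  have "\<exists>e s. e \<in> A \<and> s \<in> A \<and> e P \<noteq> 0 \<and> e * (b * c) = s * zpoly dd" for P
  proof -
    obtain e s where es: "e \<in> A" "s \<in> A" "e P \<noteq> 0" "e * b = s * dehom h"
      using local_quotient[OF bA(1) gA(2) bA(2) h0 ob] by blast
    have "e * (b * c) = (e * b) * c" by (simp only: mult.assoc)
    also have "\<dots> = s * zpoly dd" unfolding es(4) c(3)[symmetric] by (simp only: mult.assoc)
    finally show ?thesis using es by blast
  qed
  from regular_imp_polynomial[OF A_mult[OF bA(1) c(1)] c(2) this]
  obtain a where a: "a \<in> A" "b * c = a * zpoly dd" by blast
  have "c * b = c * (a * dehom h)" using a(2) unfolding c(3)[symmetric] by (simp only: ac_simps)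
  from A_cancel[OF c(1) bA(1) A_mult[OF a(1) gA(2)] c0 this] have bah: "dehom g * cz ^ m = a * dehom h"
    unfolding b_def .
  have a0: "a \<noteq> 0" using bah bA(2) unfolding b_def by auto
  have "weight (dehom g) + m * q ^ 3 = weight a + weight (dehom h)"
    using weight_mult[OF gA(1) g0 zm] weight_mult[OF a(1) a0 gA(2) h0] bah weight_eqI[OF has_weight_power[OF has_weight_cz, of m]] by simp
  moreover have "int (weight (dehom h)) - int (weight (dehom g)) + int m \<ge> 0"
    using ord[of inf_point] order_at_infinity[OF gh(1) g0] lookup_code_divisor_inf[of m] unfolding gh(2) gk_curve_eq by simp
  ultimately have "weight a \<le> m * (q ^ 3 + 1)" by simp
  then have "a \<in> below (Suc (m * (q ^ 3 + 1)))" using has_weight_in_below[OF has_weight_weight[OF a(1) a0]] below_mono by (meson Suc_le_mono)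
  moreover have "value_at f (aff_point P) * cz P ^ m = a P" if P: "P \<notin> rational (q ^ 2)" for P
  proof -
    have "ord_at P (dehom h) \<le> ord_at P (dehom g)" using oaff[of P] P by simp
    then obtain d' g' h' where 1: "is_frac d' g' h'" "frac_class g h = frac_class g' h'" "dehom h' P \<noteq> 0"
      using regular_at_affine[OF gh(1) g0] by blast
    have e: "dehom g * dehom h' = dehom g' * dehom h" using frac_class_eq_iff[OF gh(1) 1(1)] 1(2) by simp
    have "dehom h * (a * dehom h') = (dehom g * cz ^ m) * dehom h'" unfolding bah by (simp only: ac_simps)
    also have "\<dots> = (dehom g * dehom h') * cz ^ m" by (simp only: ac_simps)
    also have "\<dots> = dehom h * (dehom g' * cz ^ m)" unfolding e by (simp only: ac_simps)
    finally have eq: "dehom h * (a * dehom h') = dehom h * (dehom g' * cz ^ m)" .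
    from A_cancel[OF gA(2) A_mult[OF a(1) is_frac_in_A(2)[OF 1(1)]] A_mult[OF is_frac_in_A(1)[OF 1(1)] zm(1)] h0 eq]
    have "a P * dehom h' P = dehom g' P * cz P ^ m" by (simp add: fun_eq_iff fn_app)
    moreover have "value_at f (aff_point P) = dehom g' P / dehom h' P"
      unfolding gh(2) 1(2) by (rule value_at_affine[OF 1(1,3)])
    ultimately show ?thesis using 1(3) by (simp only:) (simp add: field_simps)
  qed
  ultimately show ?thesis by blast
qed

subsection \<open>Lower bound\<close>

text \<open>The difference is formed of the polynomials that belong to \<open>f\<close> and \<open>f'\<close> by
  \<open>riemann_roch_polynomial\<close>. Agreement at a point of \<open>D\<close> means a zero of the difference because \<open>z\<close> does not
  vanish there.\<close>

lemma few_agreements: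
  assumes "f \<in> riemann_roch_space k GK (code_divisor m)" "f' \<in> riemann_roch_space k GK (code_divisor m)"
    and "P0 \<notin> rational (q ^ 2)" "value_at f (aff_point P0) \<noteq> value_at f' (aff_point P0)"
  shows "card {P \<in> rational (q ^ 6) - rational (q ^ 2). value_at f (aff_point P) = value_at f' (aff_point P)} \<le> m * (q ^ 3 + 1)"
proof -
  obtain a where a: "a \<in> below (Suc (m * (q ^ 3 + 1)))"
    "\<And>P. P \<notin> rational (q ^ 2) \<Longrightarrow> value_at f (aff_point P) * cz P ^ m = a P"
    using riemann_roch_polynomial[OF assms(1)] by blast
  obtain a' where a': "a' \<in> below (Suc (m * (q ^ 3 + 1)))"
    "\<And>P. P \<notin> rational (q ^ 2) \<Longrightarrow> value_at f' (aff_point P) * cz P ^ m = a' P"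
    using riemann_roch_polynomial[OF assms(2)] by blast
  have b: "a - a' \<in> below (Suc (m * (q ^ 3 + 1)))" by (rule below_diff[OF a(1) a'(1)])
  have "cz P0 \<noteq> 0" using assms(3) zero_z_iff by blast
  then have "value_at f (aff_point P0) * cz P0 ^ m \<noteq> value_at f' (aff_point P0) * cz P0 ^ m" using assms(4) by simp
  then have "(a - a') P0 \<noteq> 0" unfolding a(2)[OF assms(3)] a'(2)[OF assms(3)] by (simp add: fn_app)
  then have b0: "a - a' \<noteq> 0" by (auto simp: fun_eq_iff fn_app)
  then obtain w where w: "has_weight (a - a') w" using has_weight_exists[of "a - a'"] b unfolding A_def by blast
  have "w < Suc (m * (q ^ 3 + 1))" using has_weight_notin_below[OF w] b below_mono by (meson not_le_imp_less)
  have "{P \<in> rational (q ^ 6) - rational (q ^ 2). value_at f (aff_point P) = value_at f' (aff_point P)} \<subseteq> {P. (a - a') P = 0}"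
  proof
    fix P assume "P \<in> {P \<in> rational (q ^ 6) - rational (q ^ 2). value_at f (aff_point P) = value_at f' (aff_point P)}"
    then have P: "P \<notin> rational (q ^ 2)" "value_at f (aff_point P) = value_at f' (aff_point P)" by auto
    show "P \<in> {P. (a - a') P = 0}" using a(2)[OF P(1)] a'(2)[OF P(1)] P(2) by (simp add: fn_app)
  qed
  from card_mono[OF zeros_le_weight(1)[OF w] this] zeros_le_weight(2)[OF w]
  show ?thesis using \<open>w < Suc (m * (q ^ 3 + 1))\<close> by linarith
qed

subsection \<open>Upper bound\<close>

lemma Fq_sum: "(\<And>i. i \<in> I \<Longrightarrow> f i \<in> Fq j) \<Longrightarrow> (\<Sum>i\<in>I. f i) \<in> Fq j"
  by (induction I rule: infinite_finite_induct) (auto intro: Fq_closed)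

lemma coeffs_in_single: "c \<in> Fq j \<Longrightarrow> coeffs_in (Fq j) (Poly_Mapping.single e c)"
  by (auto simp: coeffs_in_def lookup_single when_def Fq_closed)

lemma coeffs_in_sum: "(\<And>i. i \<in> I \<Longrightarrow> coeffs_in (Fq j) (g i)) \<Longrightarrow> coeffs_in (Fq j) (\<Sum>i\<in>I. g i)"
  unfolding coeffs_in_def lookup_sum by (intro allI Fq_sum) blast

lemma coeffs_in_mult:
  assumes "coeffs_in (Fq j) g" "coeffs_in (Fq j) h"
  shows "coeffs_in (Fq j) (g * h)"
proof -
  have "g * h = (\<Sum>e\<in>keyset g. \<Sum>e'\<in>keyset h. Poly_Mapping.single (e + e') (lkp g e * lkp h e'))"
    by (subst (1) mpoly_expand[of g], subst (1) mpoly_expand[of h]) (simp add: sum_product mult_single)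
  moreover have "coeffs_in (Fq j) \<dots>"
    using assms by (intro coeffs_in_sum coeffs_in_single Fq_closed(4)) (auto simp: coeffs_in_def)
  ultimately show ?thesis by simp
qed

lemma coeffs_in_1: "coeffs_in (Fq j) 1"
  using coeffs_in_single[OF Fq_closed(2), of j 0] by simp

lemma coeffs_in_power: "coeffs_in (Fq j) g \<Longrightarrow> coeffs_in (Fq j) (g ^ n)"
  by (induction n) (auto intro: coeffs_in_mult coeffs_in_1)

lemma coeffs_in_prod: "(\<And>i. i \<in> I \<Longrightarrow> coeffs_in (Fq j) (g i)) \<Longrightarrow> coeffs_in (Fq j) (\<Prod>i\<in>I. g i)"
  by (induction I rule: infinite_finite_induct) (auto intro: coeffs_in_mult coeffs_in_1)

lemma coeffs_in_diff: "coeffs_in (Fq j) g \<Longrightarrow> coeffs_in (Fq j) h \<Longrightarrow> coeffs_in (Fq j) (g - h)"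
  unfolding coeffs_in_def lookup_minus using Fq_closed(3)[of _ j "- _"] Fq_closed(5) by force

lemma code_xs_rational: assumes "x \<in> code_xs" shows "x \<in> Fq 6"
proof -
  have "card {P :: 'f gk_point. cx P = x} \<noteq> 0" using card_section(1)[OF assms] by simp
  then have "{P :: 'f gk_point. cx P = x} \<noteq> {}" by (metis card.empty)
  then obtain P :: "'f gk_point" where "cx P = x" by auto
  then have "P \<in> rational (q ^ 6)" using assms rational_diff_eq by auto
  then show ?thesis using \<open>cx P = x\<close> by (auto simp: rational_def)
qed

text \<open>The function is the product of \<open>x - a\<close> for \<open>a \<in> T\<close>, divided by a power of \<open>z\<close>. Its pole order at infinity is the weight of
  the numerator minus that of the denominator, \<open>card T * (q ^ 3 + 1) - card T * q ^ 3\<close>.\<close>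

lemma minimal_function:
  assumes "T \<subseteq> code_xs"
  shows "\<exists>f\<in>riemann_roch_space (Fq 6) GK (code_divisor (card T)). \<forall>P \<in> rational (q ^ 6) - rational (q ^ 2).
    value_at f (aff_point P) = 0 \<longleftrightarrow> cx P \<in> T"
proof -
  define m where "m = card T"
  have fT: "finite T" using finite_subset[OF assms finite_code_xs] .
  define g where "g = (\<Prod>x\<in>T. mvar 1 - mconst x * mvar 4 :: (4, 'f alg_closure) mpoly)"
  define h where "h = (mvar 3 ^ m :: (4, 'f alg_closure) mpoly)"
  have lin: "homogeneous 1 (mvar 1 - mconst x * mvar 4 :: (4, 'f alg_closure) mpoly)" for x
    using homogeneous_mult[OF homogeneous_mconst[of x] homogeneous_mvar[of 4]]
    by (intro homogeneous_diff homogeneous_mvar) simp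
  have hom_prod: "homogeneous (card T) (\<Prod>x\<in>T. mvar 1 - mconst x * mvar 4 :: (4, 'f alg_closure) mpoly)"
    using fT
  proof (induction T rule: finite_induct)
    case (insert x T)
    then show ?case using homogeneous_mult[OF lin[of x] insert.IH] by simp
  qed (simp add: homogeneous_1)
  have dg: "dehom g = (\<Prod>x\<in>T. cx - cst x)"
    unfolding g_def using fT by (induction T rule: finite_induct) (simp_all add: dehom_simps)
  have dhh: "dehom h = cz ^ m" by (simp add: h_def dehom_simps)
  have zm: "(cz :: 'f gk_fun) ^ m \<noteq> 0" using A_power_nonzero[OF _ cz_nonzero] by auto
  have gh: "is_frac m g h"
    using hom_prod homogeneous_power[OF homogeneous_mvar, of m 3] zm dhh
    by (simp add: is_frac_def g_def m_def) (simp add: h_def m_def)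
  have lx: "has_weight (cx - cst x :: 'f gk_fun) (q ^ 3 + 1)" for x
  proof (rule has_weightI[of 1 1 0 0])
    have "cx - cst x - cst 1 * mon 1 0 0 = cst (- x) * mon 0 0 0"
      by (simp add: fun_eq_iff fn_app mon_apply)
    then show "cx - cst x - cst 1 * mon 1 0 0 \<in> below (q ^ 3 + 1)"
      by (simp only:) (intro below_mon, simp add: mon_weight_def)
  qed (simp_all add: mon_weight_def)
  have lg: "has_weight (dehom g) (m * (q ^ 3 + 1))" unfolding dg m_def by (rule has_weight_prod[OF fT lx])
  then have g0: "dehom g \<noteq> 0" by (rule has_weight_nonzero)
  define f where "f = frac_class g h"
  have "f \<in> function_field_over (Fq 6) GK"
  proof -
    have "coeffs_in (Fq 6) (mvar i :: (4, 'f alg_closure) mpoly)" for i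
      unfolding mvar_def by (intro coeffs_in_single Fq_closed)
    then have "coeffs_in (Fq 6) g" "coeffs_in (Fq 6) h"
      unfolding g_def h_def mconst_def using code_xs_rational assms
      by (intro coeffs_in_prod coeffs_in_diff coeffs_in_mult coeffs_in_single coeffs_in_power; blast)+
    moreover have "(g, h) \<in> f" using gh by (auto simp: f_def frac_class_mem)
    ultimately show ?thesis unfolding function_field_over_def using frac_class_carrier[OF gh] f_def by auto
  qed
  moreover have "f \<noteq> \<zero>\<^bsub>K\<^esub>" using frac_class_zero_iff[OF gh] g0 by (simp add: f_def)
  moreover have "order_at GK P f + lkp (code_divisor m) P \<ge> 0" if "P \<in> GK" for P
  proof -
    consider "P = inf_point" | Q where "P = aff_point Q" using \<open>P \<in> GK\<close> unfolding gk_curve_eq by auto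
    then show ?thesis
    proof cases
      case 1
      have "order_at GK inf_point f = int (m * q ^ 3) - int (m * (q ^ 3 + 1))"
        unfolding f_def order_at_infinity[OF gh g0] dhh weight_eqI[OF lg] weight_eqI[OF has_weight_power[OF has_weight_cz]] ..
      then show ?thesis unfolding 1 lookup_code_divisor_inf by (simp add: algebra_simps)
    next
      case 2
      have "order_at GK (aff_point Q) f = int (ord_at Q (dehom g)) - int (m * (if Q \<in> rational (q ^ 2) then 1 else 0))"
        unfolding f_def order_at_affine[OF gh g0] dhh ord_at_power[OF A_xyz(3) cz_nonzero] ord_at_cz ..
      then show ?thesis unfolding 2 lookup_code_divisor_aff_point by simp
    qed
  qed
  ultimately have rr: "f \<in> riemann_roch_space (Fq 6) GK (code_divisor m)" unfolding riemann_roch_space_def by blast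
  have "value_at f (aff_point P) = 0 \<longleftrightarrow> cx P \<in> T" if P: "P \<in> rational (q ^ 6) - rational (q ^ 2)" for P
  proof -
    have nz: "cz P \<noteq> 0" using P zero_z_iff by blast
    have "value_at f (aff_point P) = dehom g P / dehom h P"
      unfolding f_def by (rule value_at_affine[OF gh]) (simp add: dhh fn_app nz)
    also have "\<dots> = 0 \<longleftrightarrow> (\<Prod>x\<in>T. cx P - x) = 0" by (simp add: dhh dg fn_app nz)
    also have "\<dots> \<longleftrightarrow> cx P \<in> T" using fT by (auto simp: prod_zero_iff)
    finally show ?thesis .
  qed
  then show ?thesis using rr unfolding m_def by blast
qed

text \<open>The smallest distance is attained between the word of \<open>minimal_function\<close> and the zero word.\<close>

lemma minimum_distance_eq:
  fixes Ps :: "('f alg_closure ^ 4) set list"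
  assumes "distinct Ps" "set Ps = aff_point ` (rational (q ^ 6) - rational (q ^ 2))"
    and M: "m * (q ^ 3 + 1) < length Ps"
  shows "minimum_distance (functional_code (Fq 6) GK Ps (code_divisor m)) = length Ps - m * (q ^ 3 + 1)"
proof -
  define S where "S = rational (q ^ 6) - rational (q ^ 2)"
  define n where "n = length Ps"
  have nS: "n = card S"
    unfolding n_def S_def distinct_card[OF assms(1), symmetric] assms(2)
    by (rule card_image) (auto simp: inj_on_def dest: aff_point_inj)
  have ham: "hamming_distance (map (value_at f) Ps) (map (value_at f') Ps)
      = card {P \<in> S. value_at f (aff_point P) \<noteq> value_at f' (aff_point P)}" for f f'
  proof -
    let ?I = "{i. i < n \<and> value_at f (Ps ! i) \<noteq> value_at f' (Ps ! i)}"
    have "hamming_distance (map (value_at f) Ps) (map (value_at f') Ps) = card ?I"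
      unfolding hamming_distance_def n_def by (intro arg_cong[of _ _ card]) auto
    also have "\<dots> = card ((\<lambda>i. Ps ! i) ` ?I)"
      by (rule card_image[symmetric]) (use assms(1) in \<open>auto simp: inj_on_def n_def nth_eq_iff_index_eq\<close>)
    also have "(\<lambda>i. Ps ! i) ` ?I = {p \<in> set Ps. value_at f p \<noteq> value_at f' p}"
      by (auto simp: n_def in_set_conv_nth)
    also have "\<dots> = aff_point ` {P \<in> S. value_at f (aff_point P) \<noteq> value_at f' (aff_point P)}"
      unfolding assms(2) S_def by auto
    also have "card \<dots> = card {P \<in> S. value_at f (aff_point P) \<noteq> value_at f' (aff_point P)}"
      by (rule card_image) (auto simp: inj_on_def dest: aff_point_inj)
    finally show ?thesis .
  qed
  have fS: "finite S" unfolding S_def by (rule finite_rational_diff)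
  have compl: "card {P \<in> S. p P} + card {P \<in> S. \<not> p P} = n" for p
  proof -
    have "{P \<in> S. p P} \<union> {P \<in> S. \<not> p P} = S" "{P \<in> S. p P} \<inter> {P \<in> S. \<not> p P} = {}" by auto
    then show ?thesis using card_Un_disjoint[of "{P \<in> S. p P}" "{P \<in> S. \<not> p P}"] fS nS by auto
  qed
  define RR where "RR = riemann_roch_space (Fq 6) GK (code_divisor m)"
  define C where "C = functional_code (Fq 6) GK Ps (code_divisor m)"
  have C: "C = (\<lambda>f. map (value_at f) Ps) ` RR" unfolding C_def functional_code_def RR_def by auto
  define Ds where "Ds = {hamming_distance c c' | c c'. c \<in> C \<and> c' \<in> C \<and> c \<noteq> c'}"
  have lower: "n - m * (q ^ 3 + 1) \<le> x" if x: "x \<in> Ds" for x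
  proof -
    obtain f f' where f: "f \<in> RR" "f' \<in> RR" "map (value_at f) Ps \<noteq> map (value_at f') Ps"
      "x = hamming_distance (map (value_at f) Ps) (map (value_at f') Ps)"
      using x unfolding Ds_def C by blast
    then obtain p where "p \<in> set Ps" "value_at f p \<noteq> value_at f' p" by auto
    then obtain P0 where P0: "P0 \<notin> rational (q ^ 2)" "value_at f (aff_point P0) \<noteq> value_at f' (aff_point P0)"
      unfolding assms(2) by auto
    have "card {P \<in> S. value_at f (aff_point P) = value_at f' (aff_point P)} \<le> m * (q ^ 3 + 1)"
      using few_agreements[OF f(1)[unfolded RR_def] f(2)[unfolded RR_def] P0] by (simp add: S_def)
    then show ?thesis using compl[of "\<lambda>P. value_at f (aff_point P) = value_at f' (aff_point P)"] unfolding f(4) ham by simp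
  qed
  moreover have "n - m * (q ^ 3 + 1) \<in> Ds"
  proof -
    have "m * (q ^ 3 + 1) < (q ^ 3 * (q\<^sup>2 - 1)) * (q ^ 3 + 1)"
      using M nS card_rational_diff unfolding n_def S_def by simp
    then have "m \<le> card code_xs" unfolding card_code_xs by (simp only: mult_less_cancel2) simp
    then obtain T where T: "T \<subseteq> code_xs" "card T = m" by (metis obtain_subset_with_card_n)
    obtain f where f: "f \<in> RR" "\<forall>P\<in>S. value_at f (aff_point P) = 0 \<longleftrightarrow> cx P \<in> T"
      using minimal_function[OF T(1)] unfolding T(2) RR_def S_def by blast
    define o0 where "o0 = \<zero>\<^bsub>K\<^esub>"
    have o: "o0 \<in> RR" unfolding RR_def o0_def riemann_roch_space_def by blast
    have o0: "value_at o0 (aff_point P) = 0" for P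
      using value_at_affine[OF is_frac_1(2), of P] unfolding o0_def zero_frac_class by (simp add: dehom_simps fn_app)
    have "{P \<in> S. value_at f (aff_point P) = value_at o0 (aff_point P)} = {P. cx P \<in> T}"
      using f(2) T(1) o0 rational_diff_eq unfolding S_def by auto
    moreover have "card {P :: 'f gk_point. cx P \<in> T} = (q ^ 3 + 1) * card T"
      using T(1) finite_subset[OF T(1) finite_code_xs] by (intro card_vimage_const(1) card_section(1)) auto
    ultimately have "card {P \<in> S. value_at f (aff_point P) = value_at o0 (aff_point P)} = m * (q ^ 3 + 1)"
      using T(2) by (simp add: mult.commute)
    then have d: "hamming_distance (map (value_at f) Ps) (map (value_at o0) Ps) = n - m * (q ^ 3 + 1)"
      unfolding ham using compl[of "\<lambda>P. value_at f (aff_point P) = value_at o0 (aff_point P)"] by simp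
    have "map (value_at f) Ps \<noteq> map (value_at o0) Ps"
    proof
      assume "map (value_at f) Ps = map (value_at o0) Ps"
      then have "hamming_distance (map (value_at f) Ps) (map (value_at o0) Ps) = 0"
        by (simp add: hamming_distance_def)
      then show False using d M by (simp add: n_def)
    qed
    moreover have "map (value_at f) Ps \<in> C" "map (value_at o0) Ps \<in> C" unfolding C using f(1) o by blast+
    ultimately show ?thesis unfolding Ds_def using d by (metis (mono_tags, lifting) mem_Collect_eq)
  qed
  ultimately have "Inf Ds = n - m * (q ^ 3 + 1)" by (intro cInf_eq_minimum)
  then show ?thesis unfolding minimum_distance_def Ds_def C_def n_def .
qed

end

theorem proposition3p2:
  fixes q m :: nat
    and \<X> :: "('f::{field, finite} alg_closure ^ 4) set set"
    and G D :: "('f alg_closure ^ 4) set divisor"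
    and Ps :: "('f alg_closure ^ 4) set list"
    and C :: "'f alg_closure list set"
    and dstar :: int
  assumes "primepow q" and "CARD('f) = q"
    and "\<X> = gk_curve q"
    and "G = (\<Sum>P \<in> rational_points (finite_subfield (q ^ 2)) \<X>. frag_cmul (int m) (frag_of P))"
    and "D = (\<Sum>P \<in> rational_points (finite_subfield (q ^ 6)) \<X> -
                    rational_points (finite_subfield (q ^ 2)) \<X>. frag_of P)"
    and "distinct Ps" and "set Ps = Poly_Mapping.keys D"
    and "C = functional_code (finite_subfield (q ^ 6)) \<X> Ps G"
    and "dstar = int (length Ps) - divisor_degree G"
  shows "int (length Ps) = int q ^ 8 - int q ^ 6 + int q ^ 5 - int q ^ 3 \<and>
    dstar = int q ^ 8 - int q ^ 6 + int q ^ 5 - int q ^ 3 - int m * (int q ^ 3 + 1) \<and>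
    (dstar > 0 \<longrightarrow> int (minimum_distance C) = dstar)"
proof -
  interpret gk q "TYPE('f)" using assms(1,2) by unfold_locales
  define S where "S = rational (q ^ 6) - rational (q ^ 2)"
  have fS: "finite (aff_point ` S)" unfolding S_def using finite_rational_diff by simp
  have D: "D = (\<Sum>P \<in> aff_point ` S. frag_of P)"
    unfolding assms(5) assms(3) code_points_eq S_def ..
  have "lkp D P = (if P \<in> aff_point ` S then 1 else 0)" for P
  proof -
    have "lkp D P = (\<Sum>Q \<in> aff_point ` S. if P = Q then 1 else 0)"
      unfolding D lookup_sum by (intro sum.cong) auto
    then show ?thesis using fS by simp
  qed
  then have keys: "Poly_Mapping.keys D = aff_point ` S" by (auto simp: in_keys_iff split: if_splits)
  have G: "G = code_divisor m" unfolding assms(4) assms(3) code_divisor_def ..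
  have "length Ps = card (aff_point ` S)" using distinct_card[OF assms(6)] assms(7) keys by simp
  also have "\<dots> = card S" by (rule card_image) (auto simp: inj_on_def dest: aff_point_inj)
  finally have len: "length Ps = q ^ 3 * (q\<^sup>2 - 1) * (q ^ 3 + 1)" unfolding S_def card_rational_diff .
  have "q\<^sup>2 \<ge> 1" using q_gt_1 by simp
  then have len': "int (length Ps) = int q ^ 8 - int q ^ 6 + int q ^ 5 - int q ^ 3"
    unfolding len of_nat_mult of_nat_diff[OF \<open>q\<^sup>2 \<ge> 1\<close>]
    by (simp add: algebra_simps flip: power_add)
  have deg: "divisor_degree G = int (m * (q ^ 3 + 1))" unfolding G degree_code_divisor by (simp add: algebra_simps)
  have "int (minimum_distance C) = dstar" if "dstar > 0"
  proof -
    have lt: "m * (q ^ 3 + 1) < length Ps" using that unfolding assms(9) deg by linarith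
    have "minimum_distance C = length Ps - m * (q ^ 3 + 1)"
      unfolding assms(8) assms(3) G using minimum_distance_eq[OF assms(6) _ lt] assms(7) keys unfolding S_def by simp
    then show ?thesis unfolding assms(9) deg using lt by (simp add: of_nat_diff)
  qed
  moreover have "dstar = int q ^ 8 - int q ^ 6 + int q ^ 5 - int q ^ 3 - int m * (int q ^ 3 + 1)"
    unfolding assms(9) len' G degree_code_divisor ..
  ultimately show ?thesis using len' by blast
qed

end
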